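(* For $i=1,2$ let $G_i$ be an étale essentially principal second countable groupoid whose unit space is compact and totally disconnected. The following are equivalent: (1) $G_1$ and $G_2$ are Kakutani equivalent; (2) there exist projections $p_1\in C(G_1^{(0)})$, $p_2\in C(G_2^{(0)})$ and an isomorphism $\pi:p_1C^*_r(G_1)p_1\to p_2C^*_r(G_2)p_2$ such that each $p_i$ is full in $C^*_r(G_i)$ and $\pi(p_1C(G_1^{(0)}))=p_2C(G_2^{(0)})$.
   Context: An étale groupoid is a locally compact Hausdorff groupoid whose range map $r$ is a local homeomorphism; $s$ is the source map. $G$ is essentially principal if the interior of $\{g: r(g)=s(g)\}$ is $G^{(0)}$. $C^*_r(G)$ is the reduced groupoid $C^*$-algebra, containing $C(G^{(0)})$ as a subalgebra. A projection is full if it is not contained in any proper closed two-sided ideal. $Y\subset G^{(0)}$ is $G$-full if for every $x$ there is $g$ with $r(g)=x$, $s(g)\in Y$; $G|Y=r^{-1}(Y)\cap s^{-1}(Y)$. $G_1,G_2$ are Kakutani equivalent if there exist $G_i$-full clopen $Y_i\subset G_i^{(0)}$ with $G_1|Y_1\cong G_2|Y_2$. *)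

theory Defs
  imports "HOL-Analysis.Analysis"
begin

text \<open>A groupoid is modelled on a whole type: the carrier of the groupoid is UNIV,
  the topology is the type's topology, units are identified with elements of G,
  and the unit space is the range of the range map.  Multiplication is only
  meaningful on composable pairs (s g = r h); its value elsewhere is irrelevant.\<close>

record 'g groupoid =
  rng  :: "'g \<Rightarrow> 'g"
  src  :: "'g \<Rightarrow> 'g"
  ginv :: "'g \<Rightarrow> 'g"
  gmul :: "'g \<Rightarrow> 'g \<Rightarrow> 'g"

definition unit_space :: "'g groupoid \<Rightarrow> 'g set" where
  "unit_space G = range (rng G)"

definition composable :: "'g groupoid \<Rightarrow> ('g \<times> 'g) set" where
  "composable G = {(g, h). src G g = rng G h}"

definition groupoid_axioms :: "'g groupoid \<Rightarrow> bool" where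
  "groupoid_axioms G \<longleftrightarrow>
     (\<forall>g. rng G (rng G g) = rng G g \<and> src G (rng G g) = rng G g
        \<and> rng G (src G g) = src G g \<and> src G (src G g) = src G g)
   \<and> (\<forall>g h. src G g = rng G h \<longrightarrow>
        rng G (gmul G g h) = rng G g \<and> src G (gmul G g h) = src G h)
   \<and> (\<forall>g h k. src G g = rng G h \<longrightarrow> src G h = rng G k \<longrightarrow>
        gmul G (gmul G g h) k = gmul G g (gmul G h k))
   \<and> (\<forall>g. gmul G (rng G g) g = g \<and> gmul G g (src G g) = g)
   \<and> (\<forall>g. rng G (ginv G g) = src G g \<and> src G (ginv G g) = rng G g
        \<and> gmul G g (ginv G g) = rng G g \<and> gmul G (ginv G g) g = src G g)"

definition topological_groupoid :: "('g::topological_space) groupoid \<Rightarrow> bool" where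
  "topological_groupoid G \<longleftrightarrow> groupoid_axioms G
     \<and> continuous_on UNIV (rng G) \<and> continuous_on UNIV (src G)
     \<and> continuous_on UNIV (ginv G)
     \<and> continuous_on (composable G) (\<lambda>(g, h). gmul G g h)"

definition etale_groupoid :: "('g::t2_space) groupoid \<Rightarrow> bool" where
  "etale_groupoid G \<longleftrightarrow> topological_groupoid G
     \<and> locally_compact_space (euclidean :: 'g topology)
     \<and> (\<forall>g. \<exists>V. open V \<and> g \<in> V \<and> open (rng G ` V)
            \<and> (\<exists>f. homeomorphism V (rng G ` V) (rng G) f))"

definition essentially_principal :: "('g::topological_space) groupoid \<Rightarrow> bool" where
  "essentially_principal G \<longleftrightarrow> interior {g. rng G g = src G g} = unit_space G"

definition totally_disconnected_set :: "('a::topological_space) set \<Rightarrow> bool" where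
  "totally_disconnected_set S \<longleftrightarrow> (\<forall>C. C \<subseteq> S \<longrightarrow> connected C \<longrightarrow> (\<exists>a. C \<subseteq> {a}))"

definition G_full :: "'g groupoid \<Rightarrow> 'g set \<Rightarrow> bool" where
  "G_full G Y \<longleftrightarrow> (\<forall>x \<in> unit_space G. \<exists>g. rng G g = x \<and> src G g \<in> Y)"

definition restrict_groupoid :: "'g groupoid \<Rightarrow> 'g set \<Rightarrow> 'g set" where
  "restrict_groupoid G Y = rng G -` Y \<inter> src G -` Y"

definition groupoid_iso_on ::
  "('g::topological_space) groupoid \<Rightarrow> 'g set \<Rightarrow> ('h::topological_space) groupoid \<Rightarrow> 'h set
   \<Rightarrow> ('g \<Rightarrow> 'h) \<Rightarrow> bool" where
  "groupoid_iso_on G1 H1 G2 H2 \<phi> \<longleftrightarrow>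
     (\<exists>\<psi>. homeomorphism H1 H2 \<phi> \<psi>)
   \<and> (\<forall>g\<in>H1. \<phi> (rng G1 g) = rng G2 (\<phi> g) \<and> \<phi> (src G1 g) = src G2 (\<phi> g))
   \<and> (\<forall>g\<in>H1. \<forall>h\<in>H1. src G1 g = rng G1 h \<longrightarrow> \<phi> (gmul G1 g h) = gmul G2 (\<phi> g) (\<phi> h))"

definition kakutani_equivalent ::
  "('g::topological_space) groupoid \<Rightarrow> ('h::topological_space) groupoid \<Rightarrow> bool" where
  "kakutani_equivalent G1 G2 \<longleftrightarrow>
     (\<exists>Y1 Y2 \<phi>. Y1 \<subseteq> unit_space G1 \<and> Y2 \<subseteq> unit_space G2
        \<and> openin (top_of_set (unit_space G1)) Y1 \<and> closedin (top_of_set (unit_space G1)) Y1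
        \<and> openin (top_of_set (unit_space G2)) Y2 \<and> closedin (top_of_set (unit_space G2)) Y2
        \<and> G_full G1 Y1 \<and> G_full G2 Y2
        \<and> groupoid_iso_on G1 (restrict_groupoid G1 Y1) G2 (restrict_groupoid G2 Y2) \<phi>)"

text \<open>C*_r(G) is realised concretely as the norm closure of the image of C_c(G)
  under the left regular representation on l^2(G) = direct sum over units x of
  l^2(G_x).  Operators are functions on 'g \<Rightarrow> complex, normalised to be 0
  off l^2(G).\<close>

definition l2 :: "('g \<Rightarrow> complex) set" where
  "l2 = {\<xi>. (\<lambda>\<gamma>. (cmod (\<xi> \<gamma>))\<^sup>2) summable_on UNIV}"

definition l2norm :: "('g \<Rightarrow> complex) \<Rightarrow> real" where
  "l2norm \<xi> = sqrt (infsum (\<lambda>\<gamma>. (cmod (\<xi> \<gamma>))\<^sup>2) UNIV)"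

definition l2inner :: "('g \<Rightarrow> complex) \<Rightarrow> ('g \<Rightarrow> complex) \<Rightarrow> complex" where
  "l2inner \<xi> \<eta> = infsum (\<lambda>\<gamma>. cnj (\<xi> \<gamma>) * \<eta> \<gamma>) UNIV"

type_synonym 'g op = "('g \<Rightarrow> complex) \<Rightarrow> ('g \<Rightarrow> complex)"

definition bounded_op :: "'g op \<Rightarrow> bool" where
  "bounded_op T \<longleftrightarrow>
     (\<forall>\<xi>\<in>l2. T \<xi> \<in> l2)
   \<and> (\<forall>\<xi>\<in>l2. \<forall>\<eta>\<in>l2. T (\<lambda>\<gamma>. \<xi> \<gamma> + \<eta> \<gamma>) = (\<lambda>\<gamma>. T \<xi> \<gamma> + T \<eta> \<gamma>))
   \<and> (\<forall>\<xi>\<in>l2. \<forall>c. T (\<lambda>\<gamma>. c * \<xi> \<gamma>) = (\<lambda>\<gamma>. c * T \<xi> \<gamma>))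
   \<and> (\<exists>K. \<forall>\<xi>\<in>l2. l2norm (T \<xi>) \<le> K * l2norm \<xi>)
   \<and> (\<forall>\<xi>. \<xi> \<notin> l2 \<longrightarrow> T \<xi> = (\<lambda>_. 0))"

definition opnorm :: "'g op \<Rightarrow> real" where
  "opnorm T = Sup {l2norm (T \<xi>) | \<xi>. \<xi> \<in> l2 \<and> l2norm \<xi> \<le> 1}"

definition op_add :: "'g op \<Rightarrow> 'g op \<Rightarrow> 'g op" where
  "op_add T S = (\<lambda>\<xi> \<gamma>. T \<xi> \<gamma> + S \<xi> \<gamma>)"

definition op_diff :: "'g op \<Rightarrow> 'g op \<Rightarrow> 'g op" where
  "op_diff T S = (\<lambda>\<xi> \<gamma>. T \<xi> \<gamma> - S \<xi> \<gamma>)"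

definition op_scale :: "complex \<Rightarrow> 'g op \<Rightarrow> 'g op" where
  "op_scale c T = (\<lambda>\<xi> \<gamma>. c * T \<xi> \<gamma>)"

definition op_zero :: "'g op" where
  "op_zero = (\<lambda>\<xi> \<gamma>. 0)"

definition op_adj :: "'g op \<Rightarrow> 'g op" where
  "op_adj T = (THE S. bounded_op S \<and>
       (\<forall>\<xi>\<in>l2. \<forall>\<eta>\<in>l2. l2inner (T \<xi>) \<eta> = l2inner \<xi> (S \<eta>)))"

definition Cc :: "('g::topological_space \<Rightarrow> complex) set" where
  "Cc = {f. continuous_on UNIV f \<and> compact (closure {g. f g \<noteq> 0})}"

definition lreg :: "'g groupoid \<Rightarrow> ('g \<Rightarrow> complex) \<Rightarrow> 'g op" where
  "lreg G f = (\<lambda>\<xi>. if \<xi> \<in> l2 then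
      (\<lambda>\<gamma>. infsum (\<lambda>\<alpha>. f \<alpha> * \<xi> (gmul G (ginv G \<alpha>) \<gamma>)) {\<alpha>. rng G \<alpha> = rng G \<gamma>})
    else (\<lambda>_. 0))"

definition Cred :: "('g::topological_space) groupoid \<Rightarrow> 'g op set" where
  "Cred G = {T. bounded_op T \<and> (\<forall>\<epsilon>>0. \<exists>f\<in>Cc. opnorm (op_diff T (lreg G f)) < \<epsilon>)}"

text \<open>Embedding of C(G^(0)) into C*_r(G): a function p on the unit space acts by
  (p\<xi>)(\<gamma>) = p(r(\<gamma>)) \<xi>(\<gamma>) (this is \<lambda>(p) for p extended by 0 off the clopen unit space).\<close>
definition mulop :: "'g groupoid \<Rightarrow> ('g \<Rightarrow> complex) \<Rightarrow> 'g op" where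
  "mulop G p = (\<lambda>\<xi>. if \<xi> \<in> l2 then (\<lambda>\<gamma>. p (rng G \<gamma>) * \<xi> \<gamma>) else (\<lambda>_. 0))"

definition C_units :: "('g::topological_space) groupoid \<Rightarrow> ('g \<Rightarrow> complex) set" where
  "C_units G = {f. continuous_on (unit_space G) f}"

definition projection_in_C_units :: "('g::topological_space) groupoid \<Rightarrow> ('g \<Rightarrow> complex) \<Rightarrow> bool" where
  "projection_in_C_units G p \<longleftrightarrow> p \<in> C_units G
     \<and> (\<forall>x\<in>unit_space G. p x * p x = p x \<and> cnj (p x) = p x)"

definition corner :: "'g op \<Rightarrow> 'g op set \<Rightarrow> 'g op set" where
  "corner P A = (\<lambda>T. P \<circ> T \<circ> P) ` A"

definition closed_ideal :: "'g op set \<Rightarrow> 'g op set \<Rightarrow> bool" where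
  "closed_ideal A I \<longleftrightarrow> I \<subseteq> A \<and> op_zero \<in> I
     \<and> (\<forall>T\<in>I. \<forall>S\<in>I. op_add T S \<in> I)
     \<and> (\<forall>T\<in>I. \<forall>c. op_scale c T \<in> I)
     \<and> (\<forall>T\<in>I. \<forall>a\<in>A. a \<circ> T \<in> I \<and> T \<circ> a \<in> I)
     \<and> (\<forall>T\<in>A. (\<forall>\<epsilon>>0. \<exists>S\<in>I. opnorm (op_diff T S) < \<epsilon>) \<longrightarrow> T \<in> I)"

definition full_in :: "'g op \<Rightarrow> 'g op set \<Rightarrow> bool" where
  "full_in P A \<longleftrightarrow> (\<forall>I. closed_ideal A I \<longrightarrow> P \<in> I \<longrightarrow> I = A)"

definition star_iso :: "'g op set \<Rightarrow> 'h op set \<Rightarrow> ('g op \<Rightarrow> 'h op) \<Rightarrow> bool" where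
  "star_iso A B \<pi> \<longleftrightarrow> bij_betw \<pi> A B
     \<and> (\<forall>T\<in>A. \<forall>S\<in>A. \<pi> (op_add T S) = op_add (\<pi> T) (\<pi> S))
     \<and> (\<forall>T\<in>A. \<forall>c. \<pi> (op_scale c T) = op_scale c (\<pi> T))
     \<and> (\<forall>T\<in>A. \<forall>S\<in>A. \<pi> (T \<circ> S) = \<pi> T \<circ> \<pi> S)
     \<and> (\<forall>T\<in>A. \<pi> (op_adj T) = op_adj (\<pi> T))"

end

theory Submission
  imports Defs
begin

text \<open>
  An operator \<open>T\<close> in the reduced algebra is determined by its kernel \<open>g \<mapsto> (T \<delta>\<^bsub>s g\<^esub>) g\<close>, a continuous
  function on the groupoid, and composition becomes convolution of kernels. The corner of a clopen
  \<open>Y\<close> consists of the operators whose kernel is supported in \<open>G|Y\<close>, and its diagonal of those with kernel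
  supported in \<open>Y\<close>.

  A groupoid isomorphism \<open>G\<^sub>1|Y\<^sub>1 \<cong> G\<^sub>2|Y\<^sub>2\<close> acts on kernels by composition. Boundedness of the transported
  kernel is where fullness of \<open>Y\<^sub>2\<close> is used: right translation by an arrow from \<open>x\<close> into \<open>Y\<^sub>2\<close> identifies
  the representation at \<open>x\<close> with one at a point of \<open>Y\<^sub>2\<close>.

  Conversely, a compact open bisection \<open>U\<close> of \<open>G\<^sub>1|Y\<^sub>1\<close> gives a partial isometry normalizing the diagonal,
  and so does its image \<open>v\<close>. Normalizing forces the range of an arrow in the support \<open>S\<close> of the kernel of
  \<open>v\<close> to be a function of its source, so the open set \<open>S S\<inverse>\<close> lies in the isotropy and, the groupoid being
  essentially principal, consists of units; hence \<open>S\<close> is again a compact open bisection.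
  The map \<open>U \<mapsto> S\<close> is a multiplicative order isomorphism between the compact open bisections, and
  these recover the groupoids by a noncommutative Stone duality. No use is made of adjoints here.
\<close>

section \<open>Square-summable functions and bounded operators\<close>

text \<open>Passing from operators to bisections loses the values of the kernel: the image of the
  indicator of \<open>U\<close> is an operator \<open>v\<close> with non-vanishing kernel on its
  support \<open>S\<close>, not necessarily an indicator. What survives is divisibility. If the
  support of \<open>T\<close> is a compact open bisection, the support of \<open>T'\<close> lies
  inside it exactly when \<open>T' = T d\<close> with \<open>d\<close> diagonal, and a
  multiplicative bijection matching the diagonals preserves this relation. It shows both that
  \<open>U |-> S\<close> is monotone and that pulling back the indicator of \<open>S\<close> gives
  an operator with support \<open>U\<close>. For the same reason normalizers are described by pairs
  \<open>v\<close>, \<open>v'\<close> with \<open>v v' v = v\<close>, a condition on products alone.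

  Fullness of a projection is compared with fullness of its support through ideals. Operators whose
  kernels vanish on all arrows over one orbit form a closed ideal, so the support of a full
  projection meets every orbit. Conversely, the clopen sets of units with indicator in a given ideal
  can be moved along bisections and joined; compactness of the unit space then puts the identity
  into the ideal.\<close>

lemma l2_iff:
  assumes "0 \<le> K"
  shows "v \<in> l2 \<and> l2norm v \<le> K \<longleftrightarrow> (\<forall>F. finite F \<longrightarrow> (\<Sum>x\<in>F. (cmod (v x))\<^sup>2) \<le> K\<^sup>2)"
proof (intro iffI allI impI conjI)
  fix F :: "'a set"
  assume *: "v \<in> l2 \<and> l2norm v \<le> K" and "finite F"
  then have "(\<Sum>x\<in>F. (cmod (v x))\<^sup>2) \<le> infsum (\<lambda>x. (cmod (v x))\<^sup>2) UNIV"
    by (intro finite_sum_le_infsum) (auto simp: l2_def)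
  also have "\<dots> = (l2norm v)\<^sup>2"
    by (simp add: l2norm_def infsum_nonneg)
  also have "\<dots> \<le> K\<^sup>2"
    using * by (intro power_mono) (auto simp: l2norm_def infsum_nonneg)
  finally show "(\<Sum>x\<in>F. (cmod (v x))\<^sup>2) \<le> K\<^sup>2" .
next
  assume *: "\<forall>F. finite F \<longrightarrow> (\<Sum>x\<in>F. (cmod (v x))\<^sup>2) \<le> K\<^sup>2"
  have s: "(\<lambda>x. (cmod (v x))\<^sup>2) summable_on UNIV"
    using * by (intro nonneg_bdd_above_summable_on) (auto simp: bdd_above_def)
  then show "v \<in> l2"
    by (simp add: l2_def)
  have "infsum (\<lambda>x. (cmod (v x))\<^sup>2) UNIV \<le> K\<^sup>2"
    using * by (intro infsum_le_finite_sums s) auto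
  then show "l2norm v \<le> K"
    unfolding l2norm_def using assms real_le_lsqrt by (simp add: real_sqrt_le_iff real_le_lsqrt)
qed

lemma l2norm_nonneg [simp]: "0 \<le> l2norm x"
  by (simp add: l2norm_def infsum_nonneg)

lemma l2I:
  assumes "0 \<le> K" "\<And>F. finite F \<Longrightarrow> (\<Sum>x\<in>F. (cmod (v x))\<^sup>2) \<le> K\<^sup>2"
  shows "v \<in> l2" "l2norm v \<le> K"
  using l2_iff[OF assms(1), of v] assms(2) by auto

lemma l2_sum_le: "v \<in> l2 \<Longrightarrow> finite F \<Longrightarrow> (\<Sum>x\<in>F. (cmod (v x))\<^sup>2) \<le> (l2norm v)\<^sup>2"
  using l2_iff[of "l2norm v" v] by auto

lemma l2_norm_sq: "(l2norm v)\<^sup>2 = infsum (\<lambda>x. (cmod (v x))\<^sup>2) UNIV"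
  by (simp add: l2norm_def infsum_nonneg)

lemma L2_set_le_l2norm: "v \<in> l2 \<Longrightarrow> finite F \<Longrightarrow> L2_set (\<lambda>x. cmod (v x)) F \<le> l2norm v"
  unfolding L2_set_def using l2_sum_le[of v F] by (simp add: real_le_lsqrt)

text \<open>Phrased with \<open>L2_set\<close> so that finite inequalities such as Minkowski's pass
  directly to square-summable functions.\<close>

lemma l2I_L2_set:
  assumes "\<And>F. finite F \<Longrightarrow> L2_set (\<lambda>x. cmod (v x)) F \<le> K"
  shows "v \<in> l2" "l2norm v \<le> K"
proof -
  have "0 \<le> K"
    using assms[of "{}"] by simp
  have "(\<Sum>x\<in>F. (cmod (v x))\<^sup>2) \<le> K\<^sup>2" if "finite F" for F
  proof -
    have "(L2_set (\<lambda>x. cmod (v x)) F)\<^sup>2 \<le> K\<^sup>2"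
      using assms[OF that] by (intro power_mono) auto
    then show ?thesis
      by (simp add: L2_set_def sum_nonneg)
  qed
  then show "v \<in> l2" "l2norm v \<le> K"
    using l2I[OF \<open>0 \<le> K\<close>] by auto
qed

lemma l2_add:
  assumes "v \<in> l2" "y \<in> l2"
  shows "(\<lambda>x. v x + y x) \<in> l2" "l2norm (\<lambda>x. v x + y x) \<le> l2norm v + l2norm y"
proof -
  have "L2_set (\<lambda>x. cmod (v x + y x)) F \<le> l2norm v + l2norm y" if "finite F" for F
  proof -
    have "L2_set (\<lambda>x. cmod (v x + y x)) F \<le> L2_set (\<lambda>x. cmod (v x) + cmod (y x)) F"
      by (intro L2_set_mono norm_triangle_ineq) auto
    also have "\<dots> \<le> L2_set (\<lambda>x. cmod (v x)) F + L2_set (\<lambda>x. cmod (y x)) F"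
      by (rule L2_set_triangle_ineq)
    finally show ?thesis
      using L2_set_le_l2norm[OF assms(1) that] L2_set_le_l2norm[OF assms(2) that] by linarith
  qed
  then show "(\<lambda>x. v x + y x) \<in> l2" "l2norm (\<lambda>x. v x + y x) \<le> l2norm v + l2norm y"
    by (auto intro: l2I_L2_set)
qed

lemma l2_scale:
  assumes "v \<in> l2"
  shows "(\<lambda>x. c * v x) \<in> l2" "l2norm (\<lambda>x. c * v x) \<le> cmod c * l2norm v"
proof -
  have "L2_set (\<lambda>x. cmod (c * v x)) F \<le> cmod c * l2norm v" if "finite F" for F
    using L2_set_le_l2norm[OF assms that]
    by (simp add: norm_mult L2_set_right_distrib[symmetric] mult_left_mono)
  then show "(\<lambda>x. c * v x) \<in> l2" "l2norm (\<lambda>x. c * v x) \<le> cmod c * l2norm v"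
    by (auto intro: l2I_L2_set)
qed

lemma l2_dominated:
  assumes "v \<in> l2" "\<And>x. cmod (y x) \<le> cmod (v x)"
  shows "y \<in> l2" "l2norm y \<le> l2norm v"
proof -
  have "L2_set (\<lambda>x. cmod (y x)) F \<le> l2norm v" if "finite F" for F
    using L2_set_le_l2norm[OF assms(1) that] assms(2)
    by (meson L2_set_mono norm_ge_zero order_trans)
  then show "y \<in> l2" "l2norm y \<le> l2norm v"
    by (auto intro: l2I_L2_set)
qed

lemma l2_zero [simp]: "(\<lambda>_. 0) \<in> l2" "l2norm (\<lambda>_. 0) = 0"
  by (auto simp: l2_def l2norm_def)

lemma cmod_le_l2norm: "v \<in> l2 \<Longrightarrow> cmod (v x) \<le> l2norm v"
  using L2_set_le_l2norm[of v "{x}"] by (simp add: L2_set_def)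

lemma l2_finite_support:
  assumes "finite {x. v x \<noteq> 0}"
  shows "v \<in> l2"
proof (rule l2I(1)[where K = "L2_set (\<lambda>x. cmod (v x)) {x. v x \<noteq> 0}"])
  fix F :: "'a set"
  assume "finite F"
  have "(\<Sum>x\<in>F. (cmod (v x))\<^sup>2) = (\<Sum>x\<in>F \<inter> {x. v x \<noteq> 0}. (cmod (v x))\<^sup>2)"
    using \<open>finite F\<close> by (intro sum.mono_neutral_right) auto
  also have "\<dots> \<le> (\<Sum>x\<in>{x. v x \<noteq> 0}. (cmod (v x))\<^sup>2)"
    using assms by (intro sum_mono2) auto
  finally show "(\<Sum>x\<in>F. (cmod (v x))\<^sup>2) \<le> (L2_set (\<lambda>x. cmod (v x)) {x. v x \<noteq> 0})\<^sup>2"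
    by (simp add: L2_set_def sum_nonneg)
qed simp

definition basis_vec :: "'g \<Rightarrow> 'g \<Rightarrow> complex" where
  "basis_vec a = (\<lambda>x. if x = a then 1 else 0)"

lemma basis_vec_l2 [simp]: "basis_vec a \<in> l2"
  by (rule l2_finite_support) (auto simp: basis_vec_def)

lemma l2norm_basis_vec [simp]: "l2norm (basis_vec a) = 1"
proof -
  have "(l2norm (basis_vec a))\<^sup>2 = infsum (\<lambda>x. (cmod (basis_vec a x))\<^sup>2) {a}"
    unfolding l2_norm_sq by (rule infsum_cong_neutral) (auto simp: basis_vec_def)
  then show ?thesis
    using power2_eq_imp_eq[of "l2norm (basis_vec a)" 1] by (simp add: basis_vec_def)
qed

text \<open>The bound holds for every finite superset of \<open>F\<close>, which is the form in
  which convergence along the filter of finite sets is checked.\<close>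

lemma l2_tail_small:
  assumes "v \<in> l2" "\<epsilon> > 0"
  obtains F where "finite F" "\<And>E. finite E \<Longrightarrow> F \<subseteq> E \<Longrightarrow> l2norm (\<lambda>x. if x \<in> E then 0 else v x) \<le> \<epsilon>"
proof -
  let ?f = "\<lambda>x. (cmod (v x))\<^sup>2"
  have s: "?f summable_on UNIV"
    using assms by (simp add: l2_def)
  obtain F where F: "finite F" "dist (sum ?f F) (infsum ?f UNIV) \<le> \<epsilon>\<^sup>2"
    using infsum_finite_approximation[OF s, of "\<epsilon>\<^sup>2"] assms by auto
  have "l2norm (\<lambda>x. if x \<in> E then 0 else v x) \<le> \<epsilon>" if E: "finite E" "F \<subseteq> E" for E
  proof (rule l2I(2))
    fix A :: "'a set"
    assume A: "finite A"
    have "(\<Sum>x\<in>A. (cmod (if x \<in> E then 0 else v x))\<^sup>2) = sum ?f (A - E)"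
      using A by (intro sum.mono_neutral_cong_right) auto
    \<comment> \<open>Since \<open>F\<close> lies in \<open>E\<close>, it is disjoint from
      \<open>A - E\<close>. The sum over the union is at most the total, and the total exceeds the
      sum over \<open>F\<close> by at most \<open>\<epsilon>\<^sup>2\<close>.\<close>
    also have "\<dots> = sum ?f ((A - E) \<union> F) - sum ?f F"
      using A E F by (subst sum.union_disjoint) auto
    also have "\<dots> \<le> infsum ?f UNIV - sum ?f F"
      using A F by (intro diff_right_mono finite_sum_le_infsum s) auto
    also have "\<dots> \<le> \<epsilon>\<^sup>2"
      using F(2) by (simp add: dist_real_def)
    finally show "(\<Sum>x\<in>A. (cmod (if x \<in> E then 0 else v x))\<^sup>2) \<le> \<epsilon>\<^sup>2" .
  qed (use assms in auto)
  then show thesis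
    using F(1) that by blast
qed

section \<open>Bounded operators and their matrices\<close>

lemma bounded_opD:
  assumes "bounded_op T"
  shows "v \<in> l2 \<Longrightarrow> T v \<in> l2"
    and "v \<in> l2 \<Longrightarrow> y \<in> l2 \<Longrightarrow> T (\<lambda>x. v x + y x) = (\<lambda>x. T v x + T y x)"
    and "v \<in> l2 \<Longrightarrow> T (\<lambda>x. c * v x) = (\<lambda>x. c * T v x)"
    and "v \<notin> l2 \<Longrightarrow> T v = (\<lambda>_. 0)"
  using assms unfolding bounded_op_def by blast+

lemma bounded_op_zero: "bounded_op T \<Longrightarrow> T (\<lambda>_. 0) = (\<lambda>_. 0)"
  using bounded_opD(3)[of T "\<lambda>_. 0" 0] by simp

lemma bounded_op_diff:
  assumes "bounded_op T" "v \<in> l2" "y \<in> l2"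
  shows "T (\<lambda>x. v x - y x) = (\<lambda>x. T v x - T y x)"
  using bounded_opD(2)[OF assms(1,2) l2_scale(1)[OF assms(3), of "-1"]]
    bounded_opD(3)[OF assms(1,3), of "-1"]
  by simp

lemma bounded_op_bound:
  assumes "bounded_op T"
  obtains K where "0 \<le> K" "\<And>x. x \<in> l2 \<Longrightarrow> l2norm (T x) \<le> K * l2norm x"
proof -
  obtain K where K: "\<And>x. x \<in> l2 \<Longrightarrow> l2norm (T x) \<le> K * l2norm x"
    using assms unfolding bounded_op_def by blast
  have "l2norm (T x) \<le> \<bar>K\<bar> * l2norm x" if "x \<in> l2" for x
    using K[OF that] by (meson abs_ge_self l2norm_nonneg mult_right_mono order_trans)
  then show thesis
    using that[of "\<bar>K\<bar>"] by simp
qed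

lemma opnorm_le:
  assumes "\<And>x. x \<in> l2 \<Longrightarrow> l2norm (T x) \<le> K * l2norm x" "0 \<le> K"
  shows "opnorm T \<le> K"
  unfolding opnorm_def
proof (rule cSup_least)
  show "{l2norm (T x) |x. x \<in> l2 \<and> l2norm x \<le> 1} \<noteq> {}"
    using l2_zero by fastforce
  fix c
  assume "c \<in> {l2norm (T x) |x. x \<in> l2 \<and> l2norm x \<le> 1}"
  then obtain x where x: "c = l2norm (T x)" "x \<in> l2" "l2norm x \<le> 1"
    by auto
  have "c \<le> K * l2norm x"
    using assms(1) x by simp
  also have "\<dots> \<le> K"
    using x(3) assms(2) by (simp add: mult_left_le)
  finally show "c \<le> K" .
qed

lemma l2norm_le_opnorm:
  assumes "bounded_op T" "v \<in> l2"
  shows "l2norm (T v) \<le> opnorm T * l2norm v"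
proof (cases "l2norm v = 0")
  case True
  obtain K where "l2norm (T v) \<le> K * l2norm v"
    using bounded_op_bound[OF assms(1)] assms(2) by metis
  with True show ?thesis
    by simp
next
  case False
  then have pos: "l2norm v > 0"
    using l2norm_nonneg[of v] by linarith
  define c where "c = inverse (l2norm v)"
  define y where "y = (\<lambda>x. complex_of_real c * v x)"
  have c: "c > 0" "c * l2norm v = 1"
    using pos by (auto simp: c_def)
  have y: "y \<in> l2" "l2norm y \<le> 1"
    using l2_scale[OF assms(2), of "complex_of_real c"] c by (auto simp: y_def)
  obtain K where K: "0 \<le> K" "\<And>v. v \<in> l2 \<Longrightarrow> l2norm (T v) \<le> K * l2norm v"
    using bounded_op_bound[OF assms(1)] by metis
  \<comment> \<open>\<open>Sup\<close> on the reals gives an upper bound only for sets known to be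
    bounded above.\<close>
  have "bdd_above {l2norm (T v) |v. v \<in> l2 \<and> l2norm v \<le> 1}"
  proof (rule bdd_aboveI)
    fix d
    assume "d \<in> {l2norm (T v) |v. v \<in> l2 \<and> l2norm v \<le> 1}"
    then obtain \<zeta> where \<zeta>: "d = l2norm (T \<zeta>)" "\<zeta> \<in> l2" "l2norm \<zeta> \<le> 1"
      by auto
    then have "d \<le> K * l2norm \<zeta>"
      using K by simp
    also have "\<dots> \<le> K"
      using \<zeta>(3) K(1) by (rule mult_left_le)
    finally show "d \<le> K" .
  qed
  then have *: "l2norm (T y) \<le> opnorm T"
    unfolding opnorm_def using y by (intro cSup_upper) auto
  have "T v = (\<lambda>x. complex_of_real (l2norm v) * T y x)"
  proof -
    have "v = (\<lambda>x. complex_of_real (l2norm v) * y x)"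
      using c(2) unfolding y_def
      by (metis (no_types, opaque_lifting) mult.commute mult.left_commute mult.right_neutral of_real_1 of_real_mult)
    then show ?thesis
      using bounded_opD(3)[OF assms(1) y(1), of "complex_of_real (l2norm v)"] by simp
  qed
  then have "l2norm (T v) \<le> cmod (complex_of_real (l2norm v)) * l2norm (T y)"
    using l2_scale(2)[OF bounded_opD(1)[OF assms(1) y(1)], of "complex_of_real (l2norm v)"] by simp
  also have "\<dots> \<le> l2norm v * opnorm T"
    using * by (simp add: mult_left_mono)
  finally show ?thesis
    by (simp add: mult.commute)
qed

lemma opnorm_nonneg: "bounded_op T \<Longrightarrow> 0 \<le> opnorm T"
  using l2norm_le_opnorm[of T "basis_vec undefined"]
    order_trans[OF l2norm_nonneg[of "T (basis_vec undefined)"]]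
  by simp

lemma bounded_op_finite_support:
  assumes "bounded_op T" "finite E"
  shows "T (\<lambda>x. if x \<in> E then v x else 0) y = (\<Sum>a\<in>E. T (basis_vec a) y * v a)"
  using assms(2)
proof (induction E)
  case empty
  then show ?case
    using bounded_op_zero[OF assms(1)] by simp
next
  case (insert b E)
  have "(\<lambda>x. if x \<in> insert b E then v x else 0)
      = (\<lambda>x. (if x \<in> E then v x else 0) + v b * basis_vec b x)"
    using insert by (auto simp: basis_vec_def)
  moreover have "(\<lambda>x. if x \<in> E then v x else 0) \<in> l2"
    using insert by (intro l2_finite_support) (auto elim: finite_subset[rotated])
  ultimately have "T (\<lambda>x. if x \<in> insert b E then v x else 0) y
      = T (\<lambda>x. if x \<in> E then v x else 0) y + v b * T (basis_vec b) y"
    using bounded_opD(2)[OF assms(1) _ l2_scale(1)[OF basis_vec_l2], of _ "v b" b]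
      bounded_opD(3)[OF assms(1) basis_vec_l2, of "v b" b]
    by simp
  then show ?case
    using insert by (simp add: mult.commute)
qed

text \<open>Continuity lets the operator pass to the limit of finite truncations, so an operator is
  determined by its matrix. The kernel calculus rests on this.\<close>

lemma bounded_op_has_sum:
  assumes T: "bounded_op T" and v: "v \<in> l2"
  shows "((\<lambda>a. T (basis_vec a) y * v a) has_sum T v y) UNIV"
  unfolding has_sum_def
proof (rule tendstoI)
  fix \<epsilon> :: real
  assume "\<epsilon> > 0"
  obtain K where K: "0 \<le> K" "\<And>v. v \<in> l2 \<Longrightarrow> l2norm (T v) \<le> K * l2norm v"
    using bounded_op_bound[OF T] by metis
  \<comment> \<open>The denominator is \<open>K + 1\<close> because \<open>K\<close> may be
    0.\<close>
  obtain F where F: "finite F"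
    "\<And>E. finite E \<Longrightarrow> F \<subseteq> E \<Longrightarrow> l2norm (\<lambda>x. if x \<in> E then 0 else v x) \<le> \<epsilon> / (K + 1)"
    using l2_tail_small[OF v, of "\<epsilon> / (K + 1)"] \<open>\<epsilon> > 0\<close> K(1) by auto
  have "dist (\<Sum>a\<in>E. T (basis_vec a) y * v a) (T v y) < \<epsilon>" if E: "finite E" "F \<subseteq> E" for E
  proof -
    let ?w = "\<lambda>x. if x \<in> E then v x else 0" and ?\<zeta> = "\<lambda>x. if x \<in> E then 0 else v x"
    have l: "?w \<in> l2" "?\<zeta> \<in> l2"
      using v by (auto intro!: l2_dominated(1)[OF v])
    have "v = (\<lambda>x. ?w x + ?\<zeta> x)"
      by auto
    then have "T v y = T ?w y + T ?\<zeta> y"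
      using bounded_opD(2)[OF T l] by metis
    then have "dist (\<Sum>a\<in>E. T (basis_vec a) y * v a) (T v y) = cmod (T ?\<zeta> y)"
      using bounded_op_finite_support[OF T E(1)] by (simp add: dist_norm)
    also have "\<dots> \<le> K * l2norm ?\<zeta>"
      using cmod_le_l2norm[OF bounded_opD(1)[OF T l(2)]] K(2)[OF l(2)] order_trans by blast
    also have "\<dots> \<le> K * (\<epsilon> / (K + 1))"
      using F(2)[OF E] K(1) by (rule mult_left_mono)
    also have "\<dots> < \<epsilon>"
      using K(1) \<open>\<epsilon> > 0\<close> by (simp add: divide_simps algebra_simps)
    finally show ?thesis .
  qed
  then show "\<forall>\<^sub>F E in finite_subsets_at_top UNIV. dist (\<Sum>a\<in>E. T (basis_vec a) y * v a) (T v y) < \<epsilon>"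
    unfolding eventually_finite_subsets_at_top using F(1) by blast
qed

lemma bounded_op_compose:
  assumes "bounded_op T" "bounded_op S"
  shows "bounded_op (T \<circ> S)"
proof -
  obtain K where K: "0 \<le> K" "\<And>x. x \<in> l2 \<Longrightarrow> l2norm (T x) \<le> K * l2norm x"
    using bounded_op_bound[OF assms(1)] by metis
  obtain L where L: "0 \<le> L" "\<And>x. x \<in> l2 \<Longrightarrow> l2norm (S x) \<le> L * l2norm x"
    using bounded_op_bound[OF assms(2)] by metis
  have "l2norm (T (S x)) \<le> (K * L) * l2norm x" if "x \<in> l2" for x
  proof -
    have "l2norm (T (S x)) \<le> K * l2norm (S x)"
      by (intro K(2) bounded_opD(1)[OF assms(2)] that)
    also have "\<dots> \<le> K * (L * l2norm x)"
      by (intro mult_left_mono L(2) K(1) that)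
    finally show ?thesis
      by simp
  qed
  then have "\<exists>M. \<forall>x\<in>l2. l2norm (T (S x)) \<le> M * l2norm x"
    by blast
  then show ?thesis
    unfolding bounded_op_def o_def
    by (simp add: bounded_opD[OF assms(1)] bounded_opD[OF assms(2)] bounded_op_zero[OF assms(1)])
qed

lemma opnorm_compose_le:
  assumes "bounded_op T" "bounded_op S"
  shows "opnorm (T \<circ> S) \<le> opnorm T * opnorm S"
proof (rule opnorm_le)
  fix x :: "'a \<Rightarrow> complex"
  assume x: "x \<in> l2"
  have "l2norm (T (S x)) \<le> opnorm T * l2norm (S x)"
    by (intro l2norm_le_opnorm assms bounded_opD(1)[OF assms(2)] x)
  also have "\<dots> \<le> opnorm T * (opnorm S * l2norm x)"
    by (intro mult_left_mono l2norm_le_opnorm opnorm_nonneg assms x)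
  finally show "l2norm ((T \<circ> S) x) \<le> opnorm T * opnorm S * l2norm x"
    by simp
qed (simp add: opnorm_nonneg assms)

text \<open>One computation serves sums, differences and scalar multiples:
  \<open>bounded_op_ops\<close> takes the coefficients 1, -1 and 0.\<close>

lemma bounded_op_lincomb:
  assumes "bounded_op T" "bounded_op S"
  shows "bounded_op (\<lambda>x y. c * T x y + d * S x y)"
    and "opnorm (\<lambda>x y. c * T x y + d * S x y) \<le> cmod c * opnorm T + cmod d * opnorm S"
proof -
  have l: "(\<lambda>y. c * T x y + d * S x y) \<in> l2"
    "l2norm (\<lambda>y. c * T x y + d * S x y) \<le> (cmod c * opnorm T + cmod d * opnorm S) * l2norm x"
    if "x \<in> l2" for x
  proof -
    have TS: "T x \<in> l2" "S x \<in> l2"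
      using bounded_opD(1) assms that by auto
    show "(\<lambda>y. c * T x y + d * S x y) \<in> l2"
      by (intro l2_add l2_scale TS)
    have "l2norm (\<lambda>y. c * T x y + d * S x y) \<le> cmod c * l2norm (T x) + cmod d * l2norm (S x)"
      using l2_add(2)[OF l2_scale(1) l2_scale(1), OF TS, of c d] l2_scale(2)[OF TS(1), of c]
        l2_scale(2)[OF TS(2), of d] by linarith
    also have "\<dots> \<le> cmod c * (opnorm T * l2norm x) + cmod d * (opnorm S * l2norm x)"
      by (intro add_mono mult_left_mono l2norm_le_opnorm assms that) auto
    finally show "l2norm (\<lambda>y. c * T x y + d * S x y) \<le> (cmod c * opnorm T + cmod d * opnorm S) * l2norm x"
      by (simp add: algebra_simps)
  qed
  show "bounded_op (\<lambda>x y. c * T x y + d * S x y)"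
    unfolding bounded_op_def
  proof (intro conjI ballI allI impI)
    show "\<exists>K. \<forall>x\<in>l2. l2norm (\<lambda>y. c * T x y + d * S x y) \<le> K * l2norm x"
      using l(2) by blast
  qed (use l(1) bounded_opD[OF assms(1)] bounded_opD[OF assms(2)] in \<open>auto simp: algebra_simps\<close>)
  show "opnorm (\<lambda>x y. c * T x y + d * S x y) \<le> cmod c * opnorm T + cmod d * opnorm S"
    using l(2) by (intro opnorm_le) (auto simp: opnorm_nonneg assms)
qed

lemma bounded_op_ops:
  assumes "bounded_op T" "bounded_op S"
  shows "bounded_op (op_add T S)" "bounded_op (op_diff T S)" "bounded_op (op_scale c T)"
    and "opnorm (op_add T S) \<le> opnorm T + opnorm S" "opnorm (op_scale c T) \<le> cmod c * opnorm T"
  using bounded_op_lincomb[OF assms, of 1 1] bounded_op_lincomb[OF assms, of 1 "-1"]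
    bounded_op_lincomb[OF assms(1,1), of c 0]
  by (simp_all add: op_add_def op_diff_def op_scale_def)

lemma cmod_matrix_le_opnorm:
  assumes "bounded_op T"
  shows "cmod (T (basis_vec a) b) \<le> opnorm T"
  using cmod_le_l2norm[OF bounded_opD(1)[OF assms basis_vec_l2], of a b]
    l2norm_le_opnorm[OF assms basis_vec_l2, of a] by simp

section \<open>Inner products and the adjoint\<close>

lemma l2_inner_summable:
  assumes "v \<in> l2" "y \<in> l2"
  shows "(\<lambda>x. cnj (v x) * y x) summable_on UNIV"
    and "cmod (l2inner v y) \<le> l2norm v * l2norm y"
proof -
  have b: "(\<Sum>x\<in>F. cmod (cnj (v x) * y x)) \<le> l2norm v * l2norm y" if "finite F" for F
  proof -
    have "(\<Sum>x\<in>F. cmod (cnj (v x) * y x)) \<le> L2_set (\<lambda>x. cmod (v x)) F * L2_set (\<lambda>x. cmod (y x)) F"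
      using L2_set_mult_ineq[of "\<lambda>x. cmod (v x)" "\<lambda>x. cmod (y x)" F] by (simp add: norm_mult)
    also have "\<dots> \<le> l2norm v * l2norm y"
      by (intro mult_mono L2_set_le_l2norm assms that) auto
    finally show ?thesis .
  qed
  have abs: "(\<lambda>x. cmod (cnj (v x) * y x)) summable_on UNIV"
    using b by (intro nonneg_bdd_above_summable_on) (auto simp: bdd_above_def)
  then show "(\<lambda>x. cnj (v x) * y x) summable_on UNIV"
    by (rule abs_summable_summable)
  have "cmod (l2inner v y) \<le> infsum (\<lambda>x. cmod (cnj (v x) * y x)) UNIV"
    unfolding l2inner_def using abs by (rule norm_infsum_bound)
  also have "\<dots> \<le> l2norm v * l2norm y"
    using b by (intro infsum_le_finite_sums abs) auto
  finally show "cmod (l2inner v y) \<le> l2norm v * l2norm y" .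
qed

lemma has_sum_finite_sum:
  fixes f :: "'b \<Rightarrow> 'a \<Rightarrow> complex"
  assumes "finite E" "\<And>a. a \<in> E \<Longrightarrow> (f a has_sum S a) A"
  shows "((\<lambda>x. \<Sum>a\<in>E. f a x) has_sum (\<Sum>a\<in>E. S a)) A"
  using assms by (induction E) (auto intro: has_sum_add)

lemma l2inner_basis_left: "l2inner (basis_vec a) y = y a"
proof -
  have "l2inner (basis_vec a) y = infsum (\<lambda>x. cnj (basis_vec a x) * y x) {a}"
    unfolding l2inner_def by (rule infsum_cong_neutral) (auto simp: basis_vec_def)
  then show ?thesis
    by (simp add: basis_vec_def)
qed

lemma l2inner_basis_right: "l2inner v (basis_vec a) = cnj (v a)"
proof -
  have "l2inner v (basis_vec a) = infsum (\<lambda>x. cnj (v x) * basis_vec a x) {a}"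
    unfolding l2inner_def by (rule infsum_cong_neutral) (auto simp: basis_vec_def)
  then show ?thesis
    by (simp add: basis_vec_def)
qed

lemma l2inner_add_right:
  assumes "v \<in> l2" "y \<in> l2" "\<zeta> \<in> l2"
  shows "l2inner v (\<lambda>x. y x + \<zeta> x) = l2inner v y + l2inner v \<zeta>"
  unfolding l2inner_def distrib_left by (intro infsum_add l2_inner_summable assms)

lemma l2inner_add_left:
  assumes "v \<in> l2" "y \<in> l2" "\<zeta> \<in> l2"
  shows "l2inner (\<lambda>x. y x + \<zeta> x) v = l2inner y v + l2inner \<zeta> v"
  unfolding l2inner_def complex_cnj_add distrib_right by (intro infsum_add l2_inner_summable assms)

lemma l2inner_scale_right: "l2inner v (\<lambda>x. c * y x) = c * l2inner v y"
  unfolding l2inner_def by (subst infsum_cmult_right'[symmetric]) (simp add: algebra_simps)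

text \<open>These coordinates are forced on any adjoint by testing against basis vectors;
  \<open>op_adj_eq\<close> concludes that the description by \<open>THE\<close> picks this operator.
  The value 0 off \<open>l2\<close> is the normalisation demanded by
  \<open>bounded_op\<close>.\<close>

definition adjoint :: "'g op \<Rightarrow> 'g op" where
  "adjoint T = (\<lambda>\<eta> a. if \<eta> \<in> l2 then l2inner (T (basis_vec a)) \<eta> else 0)"

lemma l2inner_finite_support:
  assumes T: "bounded_op T" and w: "w \<in> l2" and "finite E"
  shows "l2inner (T (\<lambda>x. if x \<in> E then v x else 0)) w = (\<Sum>a\<in>E. cnj (v a) * adjoint T w a)"
proof -
  have s: "(\<lambda>y. cnj (v a) * (cnj (T (basis_vec a) y) * w y)) summable_on UNIV" for a
    by (intro summable_on_cmult_right l2_inner_summable w bounded_opD(1)[OF T] basis_vec_l2)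
  have "l2inner (T (\<lambda>x. if x \<in> E then v x else 0)) w
      = infsum (\<lambda>y. \<Sum>a\<in>E. cnj (v a) * (cnj (T (basis_vec a) y) * w y)) UNIV"
    unfolding l2inner_def bounded_op_finite_support[OF T \<open>finite E\<close>]
    by (simp add: sum_distrib_right sum_distrib_left algebra_simps)
  also have "\<dots> = (\<Sum>a\<in>E. infsum (\<lambda>y. cnj (v a) * (cnj (T (basis_vec a) y) * w y)) UNIV)"
    using has_sum_finite_sum[OF \<open>finite E\<close> has_sum_infsum[OF s]] by (rule infsumI)
  also have "\<dots> = (\<Sum>a\<in>E. cnj (v a) * adjoint T w a)"
    using w by (simp add: adjoint_def l2inner_def infsum_cmult_right')
  finally show ?thesis .
qed

text \<open>Duality: testing \<open>T\<close> on the truncation of \<open>adjoint T y\<close> to a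
  finite set gives the square of the truncated norm. Cauchy-Schwarz bounds it by
  \<open>K * l2norm y\<close> times that norm, and one factor cancels.\<close>

lemma adjoint_bounded:
  assumes T: "bounded_op T"
  shows "bounded_op (adjoint T)"
proof -
  obtain K where K: "0 \<le> K" "\<And>v. v \<in> l2 \<Longrightarrow> l2norm (T v) \<le> K * l2norm v"
    using bounded_op_bound[OF T] by metis
  have bound: "adjoint T y \<in> l2" "l2norm (adjoint T y) \<le> K * l2norm y" if y: "y \<in> l2" for y
  proof -
    have "L2_set (\<lambda>a. cmod (adjoint T y a)) E \<le> K * l2norm y" if E: "finite E" for E
    proof -
      let ?t = "L2_set (\<lambda>a. cmod (adjoint T y a)) E"
      let ?c = "\<lambda>x. if x \<in> E then adjoint T y x else 0"
      have c: "?c \<in> l2"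
        using E by (intro l2_finite_support) (auto elim: finite_subset[rotated])
      have t2: "?t\<^sup>2 = (\<Sum>a\<in>E. (cmod (adjoint T y a))\<^sup>2)"
        by (simp add: L2_set_def sum_nonneg)
      have "l2norm ?c \<le> ?t"
      proof (rule l2I(2))
        fix F :: "'a set"
        assume "finite F"
        have "(\<Sum>x\<in>F. (cmod (?c x))\<^sup>2) = (\<Sum>x\<in>F \<inter> E. (cmod (adjoint T y x))\<^sup>2)"
          using \<open>finite F\<close> by (intro sum.mono_neutral_cong_right) auto
        also have "\<dots> \<le> (\<Sum>x\<in>E. (cmod (adjoint T y x))\<^sup>2)"
          using E by (intro sum_mono2) auto
        finally show "(\<Sum>x\<in>F. (cmod (?c x))\<^sup>2) \<le> ?t\<^sup>2"
          using t2 by simp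
      qed simp
      have "l2inner (T ?c) y = (\<Sum>a\<in>E. cnj (adjoint T y a) * adjoint T y a)"
        by (rule l2inner_finite_support[OF T y E])
      also have "\<dots> = complex_of_real (?t\<^sup>2)"
        unfolding t2 by (simp add: complex_norm_square mult.commute del: of_real_power)
      finally have "?t\<^sup>2 = cmod (l2inner (T ?c) y)"
        by (simp add: norm_power)
      also have "\<dots> \<le> l2norm (T ?c) * l2norm y"
        by (rule l2_inner_summable(2)[OF bounded_opD(1)[OF T c] y])
      also have "\<dots> \<le> (K * ?t) * l2norm y"
        using K(2)[OF c] \<open>l2norm ?c \<le> ?t\<close> K(1)
        by (intro mult_right_mono) (auto intro: order_trans[OF _ mult_left_mono])
      finally have "?t * ?t \<le> ?t * (K * l2norm y)"
        by (simp add: power2_eq_square algebra_simps)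
      then show ?thesis
        using K(1) L2_set_nonneg[of "\<lambda>a. cmod (adjoint T y a)" E]
        by (cases "?t = 0") (auto simp: mult_le_cancel_left)
    qed
    then show "adjoint T y \<in> l2" "l2norm (adjoint T y) \<le> K * l2norm y"
      by (auto intro: l2I_L2_set)
  qed
  have l: "T (basis_vec a) \<in> l2" for a
    by (intro bounded_opD(1)[OF T] basis_vec_l2)
  have "\<exists>K. \<forall>v\<in>l2. l2norm (adjoint T v) \<le> K * l2norm v"
    using bound(2) by blast
  then show ?thesis
    unfolding bounded_op_def
    using bound(1) by (auto simp: adjoint_def l2inner_add_right l l2_add l2_scale l2inner_scale_right fun_eq_iff)
qed

text \<open>The identity is exact on finite truncations of \<open>v\<close>. The tail changes the
  two sides by at most \<open>M\<close> times its norm, where \<open>M\<close> adds the constants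
  for both.\<close>

lemma adjoint_inner:
  assumes T: "bounded_op T" and v: "v \<in> l2" and y: "y \<in> l2"
  shows "l2inner (T v) y = l2inner v (adjoint T y)"
proof -
  obtain K where K: "0 \<le> K" "\<And>v. v \<in> l2 \<Longrightarrow> l2norm (T v) \<le> K * l2norm v"
    using bounded_op_bound[OF T] by metis
  have Sy: "adjoint T y \<in> l2"
    using bounded_opD(1)[OF adjoint_bounded[OF T] y] .
  define M where "M = K * l2norm y + l2norm (adjoint T y)"
  have M: "0 \<le> M"
    using K(1) by (simp add: M_def)
  \<comment> \<open>The summand 0 puts the estimate into the form that
    \<open>field_le_epsilon\<close> takes.\<close>
  have "cmod (l2inner (T v) y - l2inner v (adjoint T y)) \<le> 0 + \<epsilon>" if "\<epsilon> > 0" for \<epsilon>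
  proof -
    have "\<epsilon> / (M + 1) > 0"
      using that M by simp
    then obtain E where E: "finite E" "l2norm (\<lambda>x. if x \<in> E then 0 else v x) \<le> \<epsilon> / (M + 1)"
      using l2_tail_small[OF v] by (metis order_refl)
    let ?a = "\<lambda>x. if x \<in> E then v x else 0" and ?b = "\<lambda>x. if x \<in> E then 0 else v x"
    have l: "?a \<in> l2" "?b \<in> l2"
      by (auto intro!: l2_dominated(1)[OF v])
    have eq: "v = (\<lambda>x. ?a x + ?b x)"
      by auto
    have "l2inner (T v) y = l2inner (T ?a) y + l2inner (T ?b) y"
      using bounded_opD(2)[OF T l] l2inner_add_left[OF y bounded_opD(1)[OF T l(1)] bounded_opD(1)[OF T l(2)]] eq
      by metis
    moreover have "l2inner v (adjoint T y) = l2inner ?a (adjoint T y) + l2inner ?b (adjoint T y)"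
      using l2inner_add_left[OF Sy l] eq by metis
    moreover have "l2inner ?a (adjoint T y) = (\<Sum>a\<in>E. cnj (v a) * adjoint T y a)"
    proof -
      have "l2inner ?a (adjoint T y) = infsum (\<lambda>x. cnj (?a x) * adjoint T y x) E"
        unfolding l2inner_def by (rule infsum_cong_neutral) auto
      also have "\<dots> = (\<Sum>a\<in>E. cnj (v a) * adjoint T y a)"
        using E(1) by (simp cong: sum.cong)
      finally show ?thesis .
    qed
    ultimately have "l2inner (T v) y - l2inner v (adjoint T y) = l2inner (T ?b) y - l2inner ?b (adjoint T y)"
      using l2inner_finite_support[OF T y E(1), of v] by simp
    then have "cmod (l2inner (T v) y - l2inner v (adjoint T y))
        \<le> cmod (l2inner (T ?b) y) + cmod (l2inner ?b (adjoint T y))"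
      by (simp add: norm_triangle_ineq4)
    also have "\<dots> \<le> l2norm (T ?b) * l2norm y + l2norm ?b * l2norm (adjoint T y)"
      by (intro add_mono l2_inner_summable(2) bounded_opD(1)[OF T] l y Sy)
    also have "\<dots> \<le> (K * l2norm ?b) * l2norm y + l2norm ?b * l2norm (adjoint T y)"
      by (intro add_mono mult_right_mono K(2) l) auto
    also have "\<dots> = M * l2norm ?b"
      by (simp add: M_def algebra_simps)
    also have "\<dots> \<le> M * (\<epsilon> / (M + 1))"
      using E(2) M by (rule mult_left_mono)
    also have "\<dots> \<le> \<epsilon>"
      using M that by (simp add: divide_simps algebra_simps)
    finally show ?thesis
      by simp
  qed
  then have "cmod (l2inner (T v) y - l2inner v (adjoint T y)) \<le> 0"
    by (rule field_le_epsilon)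
  then show ?thesis
    by simp
qed

lemma op_adj_eq:
  assumes T: "bounded_op T"
  shows "op_adj T = adjoint T"
  unfolding op_adj_def
proof (rule the_equality)
  show "bounded_op (adjoint T) \<and> (\<forall>x\<in>l2. \<forall>y\<in>l2. l2inner (T x) y = l2inner x (adjoint T y))"
    by (intro conjI ballI adjoint_bounded[OF T] adjoint_inner[OF T])
  fix S
  assume S: "bounded_op S \<and> (\<forall>x\<in>l2. \<forall>y\<in>l2. l2inner (T x) y = l2inner x (S y))"
  show "S = adjoint T"
  proof (intro ext)
    fix y a
    show "S y a = adjoint T y a"
    proof (cases "y \<in> l2")
      case True
      then have "l2inner (T (basis_vec a)) y = l2inner (basis_vec a) (S y)"
        by (rule conjunct2[OF S, rule_format, OF basis_vec_l2])
      then show ?thesis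
        using True by (simp add: adjoint_def l2inner_basis_left)
    next
      case False
      then show ?thesis
        using bounded_opD(4)[of S y] S by (simp add: adjoint_def)
    qed
  qed
qed

section \<open>Compact open bisections\<close>

locale grpd =
  fixes G :: "'g groupoid"
  assumes axioms: "groupoid_axioms G"
begin

abbreviation r where "r \<equiv> rng G"
abbreviation s where "s \<equiv> src G"
abbreviation iv where "iv \<equiv> ginv G"
abbreviation units where "units \<equiv> unit_space G"
abbreviation mult (infixl "\<odot>" 70) where "g \<odot> h \<equiv> gmul G g h"

lemma ax [simp]:
  "r (r g) = r g" "s (r g) = r g" "r (s g) = s g" "s (s g) = s g"
  "r g \<odot> g = g" "g \<odot> s g = g"
  "r (iv g) = s g" "s (iv g) = r g" "g \<odot> iv g = r g" "iv g \<odot> g = s g"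
  using axioms unfolding groupoid_axioms_def by blast+

lemma ax_mult [simp]:
  assumes "s g = r h"
  shows "r (g \<odot> h) = r g" "s (g \<odot> h) = s h"
  using axioms assms unfolding groupoid_axioms_def by blast+

lemma assoc: "s g = r h \<Longrightarrow> s h = r k \<Longrightarrow> (g \<odot> h) \<odot> k = g \<odot> (h \<odot> k)"
  using axioms unfolding groupoid_axioms_def by blast

lemma cancel [simp]:
  "s g = r h \<Longrightarrow> iv g \<odot> (g \<odot> h) = h"
  "r g = r h \<Longrightarrow> g \<odot> (iv g \<odot> h) = h"
  "s g = r h \<Longrightarrow> (g \<odot> h) \<odot> iv h = g"
  "s g = s h \<Longrightarrow> (g \<odot> iv h) \<odot> h = g"
proof -
  show "s g = r h \<Longrightarrow> iv g \<odot> (g \<odot> h) = h"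
    by (subst assoc[symmetric]) auto
  show "r g = r h \<Longrightarrow> g \<odot> (iv g \<odot> h) = h"
    by (subst assoc[symmetric]) auto
  show "s g = r h \<Longrightarrow> (g \<odot> h) \<odot> iv h = g"
    by (subst assoc) (auto, metis ax(6))
  show "s g = s h \<Longrightarrow> (g \<odot> iv h) \<odot> h = g"
    by (subst assoc) (auto, metis ax(6))
qed

lemma iv_iv [simp]: "iv (iv g) = g"
  by (metis ax(10) ax(6) ax(7) ax(8) cancel(1))

lemma iv_mult:
  assumes "s g = r h"
  shows "iv (g \<odot> h) = iv h \<odot> iv g"
proof -
  have "(g \<odot> h) \<odot> (iv h \<odot> iv g) = r g"
    using assms by (subst assoc[symmetric]) auto
  then have "iv (g \<odot> h) = iv (g \<odot> h) \<odot> ((g \<odot> h) \<odot> (iv h \<odot> iv g))"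
    using assms by (metis ax(6) ax(8) ax_mult(1))
  then show ?thesis
    using assms by simp
qed

lemma units_iff: "u \<in> units \<longleftrightarrow> r u = u" "u \<in> units \<longleftrightarrow> s u = u"
  unfolding unit_space_def by (metis ax(1) rangeE rangeI, metis ax(2,3) rangeE rangeI)

lemma r_units [simp]: "r g \<in> units" and s_units [simp]: "s g \<in> units"
  by (simp_all add: units_iff)

lemma unitsD [simp]: "u \<in> units \<Longrightarrow> r u = u" "u \<in> units \<Longrightarrow> s u = u" "u \<in> units \<Longrightarrow> iv u = u"
  using units_iff by (auto, metis ax(6) ax(8) ax(9) ax(5) ax(7))

lemma mult_units [simp]: "r g = u \<Longrightarrow> u \<odot> g = g" "s g = u \<Longrightarrow> g \<odot> u = g"
  using ax by metis+

text \<open>Turns information on quotients of arrows into injectivity; this is how a statement about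
  units becomes one about bisections.\<close>

lemma eq_of_mult_iv_unit: "s g = s h \<Longrightarrow> g \<odot> iv h \<in> units \<Longrightarrow> g = h"
  by (metis ax(7) ax_mult(2) cancel(4) ax(8) mult_units(1) units_iff(2))

text \<open>The substitution that turns the convolution sum over arrows with a given range into a
  matrix sum over a source fibre.\<close>

lemma bij_betw_mult_iv:
  "bij_betw (\<lambda>b. y \<odot> iv b) {b. s b = s y} {\<alpha>. r \<alpha> = r y}"
  by (rule bij_betw_byWitness[where f' = "\<lambda>\<alpha>. iv \<alpha> \<odot> y"]) (auto simp: iv_mult)

definition setmul :: "'g set \<Rightarrow> 'g set \<Rightarrow> 'g set" where
  "setmul U V = {g \<odot> h |g h. g \<in> U \<and> h \<in> V \<and> s g = r h}"

lemma setmulI: "g \<in> U \<Longrightarrow> h \<in> V \<Longrightarrow> s g = r h \<Longrightarrow> g \<odot> h \<in> setmul U V"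
  by (auto simp: setmul_def)

lemma setmul_units:
  assumes "W \<subseteq> units" "s ` V \<subseteq> W"
  shows "setmul V W = V"
proof
  show "setmul V W \<subseteq> V"
  proof
    fix z
    assume "z \<in> setmul V W"
    then obtain a b where z: "a \<in> V" "b \<in> W" "s a = r b" "z = a \<odot> b"
      by (auto simp: setmul_def)
    then have "b = s a"
      using assms(1) by auto
    then show "z \<in> V"
      using z by simp
  qed
  show "V \<subseteq> setmul V W"
    using setmulI[of _ V "s _" W] assms(2) by force
qed

lemma setmul_iv_left: "inj_on r U \<Longrightarrow> setmul (iv ` U) U = s ` U"
proof
  assume inj: "inj_on r U"
  show "setmul (iv ` U) U \<subseteq> s ` U"
  proof
    fix z
    assume "z \<in> setmul (iv ` U) U"
    then obtain a b where z: "a \<in> U" "b \<in> U" "r a = r b" "z = iv a \<odot> b"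
      by (auto simp: setmul_def)
    then show "z \<in> s ` U"
      using inj_onD[OF inj z(3,1,2)] by simp
  qed
  show "s ` U \<subseteq> setmul (iv ` U) U"
  proof
    fix z
    assume "z \<in> s ` U"
    then obtain a where "a \<in> U" "z = s a"
      by auto
    then show "z \<in> setmul (iv ` U) U"
      using setmulI[of "iv a" "iv ` U" a U] by simp
  qed
qed

lemma setmul_iv_right: "inj_on s U \<Longrightarrow> setmul U (iv ` U) = r ` U"
proof -
  assume inj: "inj_on s U"
  have "inj_on r (iv ` U)"
    using inj by (auto simp: inj_on_def)
  then have "setmul (iv ` iv ` U) (iv ` U) = s ` iv ` U"
    by (rule setmul_iv_left)
  then show ?thesis
    by (simp only: image_image iv_iv ax image_ident)
qed

definition restr :: "'g set \<Rightarrow> 'g set" where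
  "restr Y = restrict_groupoid G Y"

lemma restr_iff: "g \<in> restr Y \<longleftrightarrow> r g \<in> Y \<and> s g \<in> Y"
  by (auto simp: restr_def restrict_groupoid_def)

lemma setmul_restr: "U \<subseteq> restr Y \<Longrightarrow> V \<subseteq> restr Y \<Longrightarrow> setmul U V \<subseteq> restr Y"
  by (fastforce simp: setmul_def restr_iff)

end

section \<open>Etale groupoids and products of bisections\<close>

locale etale = fixes G :: "('g::t2_space) groupoid"
  assumes etale: "etale_groupoid G"

sublocale etale \<subseteq> grpd G
  by unfold_locales (use etale in \<open>simp add: etale_groupoid_def topological_groupoid_def\<close>)

context etale
begin

lemma cont_structure:
  "continuous_on UNIV r" "continuous_on UNIV s" "continuous_on UNIV iv"
  "continuous_on (composable G) (\<lambda>(g, h). g \<odot> h)"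
  using etale by (auto simp: etale_groupoid_def topological_groupoid_def)

lemma cont [continuous_intros]:
  assumes "continuous_on A f"
  shows "continuous_on A (\<lambda>x. r (f x))" "continuous_on A (\<lambda>x. s (f x))" "continuous_on A (\<lambda>x. iv (f x))"
  using assms cont_structure continuous_on_compose2 by (metis subset_UNIV)+

lemma cont_mult:
  assumes "continuous_on A f" "continuous_on A g" "\<And>x. x \<in> A \<Longrightarrow> s (f x) = r (g x)"
  shows "continuous_on A (\<lambda>x. f x \<odot> g x)"
proof -
  have "continuous_on A (\<lambda>x. (\<lambda>(g, h). g \<odot> h) (f x, g x))"
    using assms by (intro continuous_on_compose2[OF cont_structure(4)] continuous_on_Pair)
      (auto simp: composable_def)
  then show ?thesis
    by simp
qed

lemma open_vimage: "open A \<Longrightarrow> open (r -` A)" "open A \<Longrightarrow> open (s -` A)" "open A \<Longrightarrow> open (iv -` A)"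
  using cont_structure by (auto intro: open_vimage)

lemma closed_vimage: "closed A \<Longrightarrow> closed (r -` A)" "closed A \<Longrightarrow> closed (s -` A)"
  using cont_structure by (auto intro: closed_vimage)

lemma iv_image: "iv ` A = iv -` A"
  by force

lemma open_r_image:
  assumes "open A"
  shows "open (r ` A)"
proof (subst open_subopen, intro ballI)
  fix x
  assume "x \<in> r ` A"
  then obtain g where g: "g \<in> A" "x = r g"
    by auto
  obtain V f where V: "open V" "g \<in> V" "open (r ` V)" "homeomorphism V (r ` V) r f"
    using etale unfolding etale_groupoid_def by metis
  have "openin (top_of_set (r ` V)) (r ` (A \<inter> V))"
    using homeomorphism_imp_open_map[OF V(4), of "A \<inter> V"] assms
    by (metis inf.commute openin_open_Int)
  then have "open (r ` (A \<inter> V))"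
    using V(3) openin_open_trans by blast
  then show "\<exists>T. open T \<and> x \<in> T \<and> T \<subseteq> r ` A"
    using g V(2) by (intro exI[of _ "r ` (A \<inter> V)"]) auto
qed

lemma open_s_image:
  assumes "open A"
  shows "open (s ` A)"
proof -
  have "s ` A = r ` (iv ` A)"
    by (simp add: image_image)
  then show ?thesis
    using open_r_image open_vimage(3)[OF assms] by (simp add: iv_image)
qed

lemma open_units [simp]: "open units"
  unfolding unit_space_def by (simp add: open_r_image)

lemma closed_units [simp]: "closed units"
proof -
  have "units = {u. r u = u}"
    using units_iff(1) by blast
  then show ?thesis
    using closed_Collect_eq[OF cont_structure(1) continuous_on_id] by (simp only:)
qed

text \<open>The compact open bisections. They behave like arrows, with \<open>setmul\<close> as
  product and the image under \<open>iv\<close> as inverse.\<close>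

definition cob :: "'g set \<Rightarrow> bool" where
  "cob U \<longleftrightarrow> open U \<and> compact U \<and> inj_on r U \<and> inj_on s U"

lemma cobD: "cob U \<Longrightarrow> open U" "cob U \<Longrightarrow> compact U" "cob U \<Longrightarrow> closed U"
    "cob U \<Longrightarrow> inj_on r U" "cob U \<Longrightarrow> inj_on s U"
  by (auto simp: cob_def compact_imp_closed)

lemma cob_Int_clopen: "cob U \<Longrightarrow> open V \<Longrightarrow> closed V \<Longrightarrow> cob (U \<inter> V)"
  by (auto simp: cob_def inj_on_subset compact_Int_closed inj_on_def)

text \<open>Here the Hausdorff property matters: a compact open bisection is also closed, so
  relative complements stay compact and open. Disjointness of bisections can therefore be expressed
  inside the family.\<close>

lemma cob_Diff: "cob U \<Longrightarrow> cob V \<Longrightarrow> cob (U - V)"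
  using cob_Int_clopen[of U "- V"] cobD(1,3)[of V] by (auto simp: Diff_eq open_Compl closed_Compl)

lemma cob_empty [simp]: "cob {}"
  by (simp add: cob_def)

lemma cob_iv:
  assumes "cob U"
  shows "cob (iv ` U)"
  unfolding cob_def
proof (intro conjI)
  show "open (iv ` U)"
    using open_vimage(3) cobD(1)[OF assms] by (simp add: iv_image)
  show "compact (iv ` U)"
    using cobD(2)[OF assms] cont_structure(3) by (metis compact_continuous_image continuous_on_subset subset_UNIV)
qed (use assms in \<open>auto simp: cob_def inj_on_def\<close>)

lemma cob_units: "open W \<Longrightarrow> compact W \<Longrightarrow> W \<subseteq> units \<Longrightarrow> cob W"
  unfolding cob_def inj_on_def by (metis subsetD unitsD(1,2))

lemma cob_r_image:
  assumes "cob U"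
  shows "cob (r ` U)" "cob (s ` U)"
  using assms cont_structure
  by (auto intro!: cob_units open_r_image open_s_image compact_continuous_image
      simp: cobD elim: continuous_on_subset)

text \<open>The sections of range and source over a bisection. The second goes through inversion, so
  its continuity follows from that of the first.\<close>

definition rsec :: "'g set \<Rightarrow> 'g \<Rightarrow> 'g" where "rsec U = the_inv_into U r"
definition ssec :: "'g set \<Rightarrow> 'g \<Rightarrow> 'g" where "ssec U x = iv (rsec (iv ` U) x)"

lemma rsec:
  assumes "cob U"
  shows "g \<in> U \<Longrightarrow> rsec U (r g) = g" "x \<in> r ` U \<Longrightarrow> rsec U x \<in> U" "x \<in> r ` U \<Longrightarrow> r (rsec U x) = x"
    "continuous_on (r ` U) (rsec U)"
proof -
  show "g \<in> U \<Longrightarrow> rsec U (r g) = g" "x \<in> r ` U \<Longrightarrow> rsec U x \<in> U" "x \<in> r ` U \<Longrightarrow> r (rsec U x) = x"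
    unfolding rsec_def using the_inv_into_f_f[OF cobD(4)[OF assms]] by auto
  show "continuous_on (r ` U) (rsec U)"
    unfolding rsec_def using assms cont_structure
    by (intro continuous_on_inv_into) (auto simp: cobD elim: continuous_on_subset)
qed

lemma ssec:
  assumes "cob U"
  shows "g \<in> U \<Longrightarrow> ssec U (s g) = g" "x \<in> s ` U \<Longrightarrow> ssec U x \<in> U" "x \<in> s ` U \<Longrightarrow> s (ssec U x) = x"
    "continuous_on (s ` U) (ssec U)"
proof -
  show "g \<in> U \<Longrightarrow> ssec U (s g) = g"
    using rsec(1)[OF cob_iv[OF assms], of "iv g"] by (simp add: ssec_def)
  show "x \<in> s ` U \<Longrightarrow> ssec U x \<in> U" "x \<in> s ` U \<Longrightarrow> s (ssec U x) = x"
    using rsec(2,3)[OF cob_iv[OF assms], of x] by (auto simp: ssec_def image_image)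
  show "continuous_on (s ` U) (ssec U)"
    unfolding ssec_def[abs_def] using rsec(4)[OF cob_iv[OF assms]] by (intro cont) (simp add: image_image)
qed

text \<open>This is left translation by the inverse of \<open>U\<close>: an arrow \<open>y\<close>
  is divided by the unique element of \<open>U\<close> with the same range.\<close>

lemma continuous_on_translate:
  assumes "cob U"
  shows "continuous_on (r -` (r ` U)) (\<lambda>y. iv (rsec U (r y)) \<odot> y)"
proof (rule cont_mult)
  show "continuous_on (r -` (r ` U)) (\<lambda>y. iv (rsec U (r y)))"
    using cont_structure
    by (intro cont(3) continuous_on_compose2[OF rsec(4)[OF assms], of _ r])
      (auto elim: continuous_on_subset)
qed (use rsec(3)[OF assms] in auto)

text \<open>Presents a product as a preimage under translation, so that openness in
  \<open>open_setmul\<close> becomes a matter of continuity.\<close>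

lemma setmul_iff:
  assumes "cob U"
  shows "y \<in> setmul U V \<longleftrightarrow> r y \<in> r ` U \<and> iv (rsec U (r y)) \<odot> y \<in> V"
proof
  assume "y \<in> setmul U V"
  then obtain g h where "g \<in> U" "h \<in> V" "s g = r h" "y = g \<odot> h"
    by (auto simp: setmul_def)
  then show "r y \<in> r ` U \<and> iv (rsec U (r y)) \<odot> y \<in> V"
    using rsec(1)[OF assms] by simp
next
  assume *: "r y \<in> r ` U \<and> iv (rsec U (r y)) \<odot> y \<in> V"
  then have "rsec U (r y) \<in> U" "r (rsec U (r y)) = r y"
    using rsec[OF assms] by auto
  then show "y \<in> setmul U V"
    using setmulI[of "rsec U (r y)" U "iv (rsec U (r y)) \<odot> y" V] * by simp
qed

lemma open_setmul:
  assumes "cob U" "open V"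
  shows "open (setmul U V)"
proof -
  have "setmul U V = r -` (r ` U) \<inter> (\<lambda>y. iv (rsec U (r y)) \<odot> y) -` V"
    using setmul_iff[OF assms(1)] by auto
  moreover have "open (r -` (r ` U))"
    by (intro open_vimage open_r_image cobD assms)
  ultimately show ?thesis
    using continuous_open_preimage[OF continuous_on_translate[OF assms(1)] _ assms(2)] by simp
qed

lemma compact_setmul:
  assumes "compact U" "compact V"
  shows "compact (setmul U V)"
proof -
  have "closed {p :: 'g \<times> 'g. s (fst p) = r (snd p)}"
    by (intro closed_Collect_eq cont continuous_intros)
  then have "compact ((U \<times> V) \<inter> composable G)"
    using assms by (intro compact_Int_closed compact_Times)
      (auto simp: composable_def case_prod_unfold)
  moreover have "setmul U V = (\<lambda>(g, h). g \<odot> h) ` ((U \<times> V) \<inter> composable G)"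
    by (auto simp: setmul_def composable_def)
  ultimately show ?thesis
    using compact_continuous_image[OF continuous_on_subset[OF cont_structure(4)]] by simp
qed

lemma cob_setmul:
  assumes "cob U" "cob V"
  shows "cob (setmul U V)"
  unfolding cob_def
proof (intro conjI)
  show "open (setmul U V)" "compact (setmul U V)"
    using assms open_setmul compact_setmul cobD by auto
  show "inj_on r (setmul U V)"
  proof (rule inj_onI)
    fix x y
    assume *: "x \<in> setmul U V" "y \<in> setmul U V" "r x = r y"
    then obtain g h g' h' where gh: "g \<in> U" "h \<in> V" "s g = r h" "x = g \<odot> h"
      "g' \<in> U" "h' \<in> V" "s g' = r h'" "y = g' \<odot> h'"
      by (auto simp: setmul_def)
    then have "g = g'"
      using * cobD(4)[OF assms(1)] by (auto simp: inj_on_def)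
    then have "h = h'"
      using gh cobD(4)[OF assms(2)] by (auto simp: inj_on_def)
    then show "x = y"
      using gh \<open>g = g'\<close> by simp
  qed
  show "inj_on s (setmul U V)"
  proof (rule inj_onI)
    fix x y
    assume *: "x \<in> setmul U V" "y \<in> setmul U V" "s x = s y"
    then obtain g h g' h' where gh: "g \<in> U" "h \<in> V" "s g = r h" "x = g \<odot> h"
      "g' \<in> U" "h' \<in> V" "s g' = r h'" "y = g' \<odot> h'"
      by (auto simp: setmul_def)
    then have "h = h'"
      using * cobD(5)[OF assms(2)] by (auto simp: inj_on_def)
    then have "g = g'"
      using gh cobD(5)[OF assms(1)] by (auto simp: inj_on_def)
    then show "x = y"
      using gh \<open>h = h'\<close> by simp
  qed
qed

end

section \<open>Ample groupoids: compact open bisections form a basis\<close>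

locale ample = etale G for G :: "('g::t2_space) groupoid" +
  assumes compact_units: "compact (unit_space G)"
    and totally_disconnected_units: "totally_disconnected_set (unit_space G)"
begin

text \<open>In a compact Hausdorff space components and quasi-components agree. Total
  disconnectedness makes the components points, so a point can be split off from a disjoint closed
  set by a clopen set.\<close>

lemma clopen_unit_nbhd:
  assumes "x \<in> units" "open A" "x \<in> A"
  obtains C where "open C" "compact C" "x \<in> C" "C \<subseteq> A" "C \<subseteq> units"
proof -
  let ?X = "top_of_set units"
  have "separated_between ?X {x} (units - A)"
  proof (rule cut_wire_fence_theorem)
    show "compact_space ?X"
      using compact_units by (simp add: compact_space_subtopology)
    show "Hausdorff_space ?X"

    proof (rule Hausdorff_space_subtopology)
      show "Hausdorff_space (euclidean :: 'g topology)"
        unfolding Hausdorff_space_def using hausdorff by (auto simp: disjnt_def)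
    qed
    show "closedin ?X {x}"
      using assms(1) by (intro closedin_subset_topspace) auto
    show "closedin ?X (units - A)"
      using assms(2) by (simp add: closed_Diff closedin_subset_topspace)
    fix C
    assume "connectedin ?X C"
    then have "C \<subseteq> units" "connected C"
      by (auto simp: connectedin_subtopology)
    then obtain a where "C \<subseteq> {a}"
      using totally_disconnected_units unfolding totally_disconnected_set_def by blast
    then show "disjnt C {x} \<or> disjnt C (units - A)"
      using assms(3) by (auto simp: disjnt_def)
  qed
  then obtain C where C: "closedin ?X C" "openin ?X C" "x \<in> C" "units - A \<subseteq> units - C"
    unfolding separated_between by auto
  have "C \<subseteq> units"
    using C(2) openin_imp_subset by blast
  then show thesis
    using that[of C] C open_units compact_units openin_open_trans
    by (metis DiffD2 DiffI closedin_compact subsetD subsetI)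
qed

text \<open>An open neighbourhood on which range and source are injective is cut down to the part
  over a compact open set \<open>C\<close> of units. That part is the image of \<open>C\<close>
  under the local inverse of the range map, hence compact.\<close>

lemma cob_basis:
  assumes "open A" "g \<in> A"
  obtains U where "cob U" "g \<in> U" "U \<subseteq> A"
proof -
  obtain V f where V: "open V" "g \<in> V" "open (r ` V)" "homeomorphism V (r ` V) r f"
    using etale unfolding etale_groupoid_def by metis
  \<comment> \<open>The local homeomorphism condition concerns the range only; a second chart around
    the inverse of \<open>g\<close> gives injectivity of the source.\<close>
  obtain V' f' where V': "open V'" "iv g \<in> V'" "open (r ` V')" "homeomorphism V' (r ` V') r f'"
    using etale unfolding etale_groupoid_def by metis
  define B where "B = A \<inter> V \<inter> iv -` V'"
  have B: "open B" "g \<in> B"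
    using assms V V' open_vimage(3)[OF V'(1)] by (auto simp: B_def)
  have "inj_on r V" "inj_on r V'"
    using inj_on_inverseI[of V f r] inj_on_inverseI[of V' f' r] V(4) V'(4)
    by (auto simp: homeomorphism_def)
  then have inj: "inj_on r B" "inj_on s B"
  proof -
    show "inj_on r B"
      using \<open>inj_on r V\<close> by (rule inj_on_subset) (auto simp: B_def)
    have "g = h" if "g \<in> B" "h \<in> B" "s g = s h" for g h
    proof -
      have "iv g = iv h"
        using inj_onD[OF \<open>inj_on r V'\<close>, of "iv g" "iv h"] that by (simp add: B_def)
      then show ?thesis
        using iv_iv by metis
    qed
    then show "inj_on s B"
      by (rule inj_onI)
  qed
  have "r g \<in> r ` B"
    using B(2) by (rule imageI)
  then obtain C where C: "open C" "compact C" "r g \<in> C" "C \<subseteq> r ` B"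
    using clopen_unit_nbhd[OF r_units open_r_image[OF B(1)]] by metis
  have CV: "C \<subseteq> r ` V"
    using C(4) by (auto simp: B_def)
  have "f ` C = B \<inter> r -` C"
  proof
    show "f ` C \<subseteq> B \<inter> r -` C"
    proof
      fix y assume "y \<in> f ` C"
      then obtain b where b: "b \<in> B" "r b \<in> C" "y = f (r b)"
        using C(4) by blast
      then have "y = b"
        using V(4) by (auto simp: B_def homeomorphism_def)
      with b show "y \<in> B \<inter> r -` C" by simp
    qed
    show "B \<inter> r -` C \<subseteq> f ` C"
      using V(4) by (force simp: B_def homeomorphism_def)
  qed
  moreover have "compact (f ` C)"
    using C(2) CV V(4) by (meson compact_continuous_image continuous_on_subset homeomorphism_cont2)
  ultimately have "cob (B \<inter> r -` C)"
    using B(1) C(1) inj unfolding cob_def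
    by (auto intro!: open_Int open_vimage(1) intro: inj_on_subset)
  then show thesis
    using that[of "B \<inter> r -` C"] B(2) C(3) by (auto simp: B_def)
qed

lemma cob_units_full [simp]: "cob units"
  by (simp add: cob_units compact_units)

lemma compact_cover_cob:
  assumes "compact K" "K \<subseteq> A" "open A"
  obtains \<U> where "finite \<U>" "K \<subseteq> \<Union>\<U>" "\<And>U. U \<in> \<U> \<Longrightarrow> cob U \<and> U \<subseteq> A"
proof -
  define \<C> where "\<C> = {U. cob U \<and> U \<subseteq> A}"
  have "K \<subseteq> \<Union>\<C>"
  proof
    fix g
    assume "g \<in> K"
    then show "g \<in> \<Union>\<C>"
      using cob_basis[OF assms(3), of g] assms(2) unfolding \<C>_def by blast
  qed
  moreover have "\<And>U. U \<in> \<C> \<Longrightarrow> open U"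
    by (simp add: \<C>_def cobD)
  ultimately obtain \<U> where "\<U> \<subseteq> \<C>" "finite \<U>" "K \<subseteq> \<Union>\<U>"
    using compactE[OF assms(1)] by metis
  then show thesis
    unfolding \<C>_def by (intro that) auto
qed

end

section \<open>Convolution operators and their kernels\<close>

context grpd
begin

text \<open>
  \<open>kern T\<close> is Renault's coefficient function \<open>j(T)\<close>; \<open>kmat k\<close> is the matrix of left convolution by \<open>k\<close>
  in the standard basis.
\<close>

definition kern :: "'g op \<Rightarrow> 'g \<Rightarrow> complex" where
  "kern T g = T (basis_vec (s g)) g"

definition kmat :: "('g \<Rightarrow> complex) \<Rightarrow> 'g \<Rightarrow> 'g \<Rightarrow> complex" where
  "kmat k \<gamma> \<beta> = (if s \<beta> = s \<gamma> then k (\<gamma> \<odot> iv \<beta>) else 0)"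

text \<open>Matrix entries vanish between different source fibres and otherwise depend only on the
  quotient of the indices: the operator commutes with right translations. This property makes a
  single function \<open>kern T\<close> carry all the information.\<close>

definition conv_op :: "'g op \<Rightarrow> bool" where
  "conv_op T \<longleftrightarrow> bounded_op T \<and> (\<forall>a b. T (basis_vec a) b = kmat (kern T) b a)"

lemma lreg_apply:
  assumes "x \<in> l2"
  shows "lreg G k x y = infsum (\<lambda>b. kmat k y b * x b) UNIV"
proof -
  have "lreg G k x y = infsum (\<lambda>\<alpha>. k \<alpha> * x (iv \<alpha> \<odot> y)) {\<alpha>. r \<alpha> = r y}"
    using assms by (simp add: lreg_def)
  also have "\<dots> = infsum (\<lambda>b. k (y \<odot> iv b) * x (iv (y \<odot> iv b) \<odot> y)) {b. s b = s y}"
    by (rule infsum_reindex_bij_betw[OF bij_betw_mult_iv, symmetric])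
  also have "\<dots> = infsum (\<lambda>b. kmat k y b * x b) UNIV"
    by (rule infsum_cong_neutral) (auto simp: kmat_def iv_mult)
  finally show ?thesis .
qed

lemma lreg_not_l2: "x \<notin> l2 \<Longrightarrow> lreg G k x = (\<lambda>_. 0)"
  by (simp add: lreg_def)

lemma lreg_basis: "lreg G k (basis_vec a) b = kmat k b a"
proof -
  have "lreg G k (basis_vec a) b = infsum (\<lambda>d. kmat k b d * basis_vec a d) {a}"
    unfolding lreg_apply[OF basis_vec_l2] by (rule infsum_cong_neutral) (auto simp: basis_vec_def)
  then show ?thesis
    by (simp add: basis_vec_def)
qed

lemma kern_lreg [simp]: "kern (lreg G k) = k"
  by (rule ext) (simp add: kern_def lreg_basis kmat_def)

lemma conv_op_lreg: "bounded_op (lreg G k) \<Longrightarrow> conv_op (lreg G k)"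
  by (simp add: conv_op_def lreg_basis)

lemma conv_opD: "conv_op T \<Longrightarrow> bounded_op T" "conv_op T \<Longrightarrow> T (basis_vec a) b = kmat (kern T) b a"
  by (auto simp: conv_op_def)

lemma conv_op_has_sum:
  assumes "conv_op T" "x \<in> l2"
  shows "((\<lambda>b. kmat (kern T) y b * x b) has_sum T x y) UNIV"
  using bounded_op_has_sum[of T x y] assms conv_opD by simp

lemma conv_op_eq_lreg:
  assumes "conv_op T"
  shows "lreg G (kern T) = T"
proof (intro ext)
  fix x y
  show "lreg G (kern T) x y = T x y"
  proof (cases "x \<in> l2")
    case True
    then show ?thesis
      using lreg_apply conv_op_has_sum[OF assms True] infsumI by metis
  next
    case False
    then show ?thesis
      using bounded_opD(4) conv_opD(1)[OF assms] lreg_not_l2 by metis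
  qed
qed

text \<open>The principle by which equations between operators are proved below: compare kernels
  pointwise.\<close>

lemma conv_op_eqI: "conv_op T \<Longrightarrow> conv_op S \<Longrightarrow> (\<And>g. kern T g = kern S g) \<Longrightarrow> T = S"
  using conv_op_eq_lreg by (metis ext)

text \<open>Matrix multiplication, read on kernels, is convolution. Right invariance of the product
  matrix comes from translating the summation index.\<close>

lemma conv_op_compose:
  assumes "conv_op T" "conv_op S"
  shows "conv_op (T \<circ> S)"
    and "((\<lambda>d. kern T (g \<odot> iv d) * kern S d) has_sum kern (T \<circ> S) g) {d. s d = s g}"
proof -
  have m: "((\<lambda>d. kmat (kern T) b d * kmat (kern S) d a) has_sum (T \<circ> S) (basis_vec a) b) UNIV" for a b
    using conv_op_has_sum[OF assms(1) bounded_opD(1)[OF conv_opD(1)[OF assms(2)] basis_vec_l2[of a]], of b]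
    by (simp add: conv_opD(2)[OF assms(2)])
  show k: "((\<lambda>d. kern T (g \<odot> iv d) * kern S d) has_sum kern (T \<circ> S) g) {d. s d = s g}" for g
    using m[of g "s g"] unfolding kern_def[of "T \<circ> S"]
    by (rule iffD1[OF has_sum_cong_neutral, rotated -1]) (auto simp: kmat_def)
  have "(T \<circ> S) (basis_vec a) b = kmat (kern (T \<circ> S)) b a" for a b
  proof (cases "s a = s b")
    case True
    \<comment> \<open>The source of \<open>b \<odot> iv a\<close> is the range of \<open>a\<close>,
      so right translation by \<open>a\<close> moves the fibre of the convolution sum onto the fibre
      of the matrix sum.\<close>
    have bij: "bij_betw (\<lambda>d. d \<odot> a) {d. s d = s (b \<odot> iv a)} {d. s d = s a}"
      by (rule bij_betw_byWitness[where f' = "\<lambda>d. d \<odot> iv a"]) (use True in auto)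
    have "((\<lambda>d. kmat (kern T) b d * kmat (kern S) d a) has_sum (T \<circ> S) (basis_vec a) b) {d. s d = s a}"
      using m[of b a] by (rule iffD1[OF has_sum_cong_neutral, rotated -1]) (auto simp: kmat_def)
    then have "((\<lambda>d. kmat (kern T) b (d \<odot> a) * kmat (kern S) (d \<odot> a) a) has_sum (T \<circ> S) (basis_vec a) b)
        {d. s d = s (b \<odot> iv a)}"
      using has_sum_reindex_bij_betw[OF bij, where f = "\<lambda>d. kmat (kern T) b d * kmat (kern S) d a"]
      by blast
    moreover have "kmat (kern T) b (d \<odot> a) * kmat (kern S) (d \<odot> a) a
        = kern T ((b \<odot> iv a) \<odot> iv d) * kern S d" if "s d = s (b \<odot> iv a)" for d
      using that True by (simp add: kmat_def iv_mult assoc)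
    ultimately have "((\<lambda>d. kern T ((b \<odot> iv a) \<odot> iv d) * kern S d) has_sum (T \<circ> S) (basis_vec a) b)
        {d. s d = s (b \<odot> iv a)}"
      by (subst has_sum_cong[symmetric]) auto
    then have "(T \<circ> S) (basis_vec a) b = kern (T \<circ> S) (b \<odot> iv a)"
      using k[of "b \<odot> iv a"] has_sum_unique by blast
    then show ?thesis
      using True by (simp add: kmat_def)
  next
    case False
    have "((\<lambda>d. 0) has_sum (T \<circ> S) (basis_vec a) b) (UNIV :: 'g set)"
    proof (rule iffD1[OF has_sum_cong, OF _ m[of b a]])
      show "kmat (kern T) b d * kmat (kern S) d a = 0" for d
        using False by (auto simp: kmat_def)
    qed
    then have "(T \<circ> S) (basis_vec a) b = 0"
      using has_sum_unique[OF _ has_sum_0_simp] by blast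
    then show ?thesis
      using False by (simp add: kmat_def)
  qed
  then show "conv_op (T \<circ> S)"
    using bounded_op_compose conv_opD(1) assms unfolding conv_op_def by blast
qed

lemma kern_compose_eq_0:
  assumes "conv_op T" "conv_op S"
    and "\<And>b. s b = s g \<Longrightarrow> kern T (g \<odot> iv b) = 0 \<or> kern S b = 0"
  shows "kern (T \<circ> S) g = 0"
proof -
  have "((\<lambda>b. 0) has_sum kern (T \<circ> S) g) {b. s b = s g}"
    by (rule iffD1[OF has_sum_cong, OF _ conv_op_compose(2)[OF assms(1,2)]]) (use assms(3) in auto)
  then show ?thesis
    using has_sum_unique[OF _ has_sum_0_simp] by blast
qed

lemma kern_ops [simp]:
  "kern (op_add T S) g = kern T g + kern S g"
  "kern (op_diff T S) g = kern T g - kern S g"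
  "kern (op_scale c T) g = c * kern T g"
  by (simp_all add: kern_def op_add_def op_diff_def op_scale_def)

lemma conv_op_ops:
  assumes "conv_op T" "conv_op S"
  shows "conv_op (op_add T S)" "conv_op (op_diff T S)" "conv_op (op_scale c T)"
  using assms bounded_op_ops[OF assms[THEN conv_opD(1)]] conv_opD(2)[OF assms(1)] conv_opD(2)[OF assms(2)]
  by (auto simp: conv_op_def kmat_def) (auto simp: op_add_def op_diff_def op_scale_def kmat_def)

lemma cmod_kern_le: "bounded_op T \<Longrightarrow> cmod (kern T g) \<le> opnorm T"
  by (simp add: kern_def cmod_matrix_le_opnorm)

text \<open>Summability of the rows is asked for separately: \<open>infsum\<close> of a non-summable
  family is 0, so linearity cannot be read off from finite bounds on the values alone.\<close>

lemma bounded_op_lregI: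
  assumes "0 \<le> K"
    and "\<And>x y. x \<in> l2 \<Longrightarrow> (\<lambda>d. kmat k y d * x d) summable_on UNIV"
    and "\<And>x F. x \<in> l2 \<Longrightarrow> finite F \<Longrightarrow> (\<Sum>y\<in>F. (cmod (lreg G k x y))\<^sup>2) \<le> (K * l2norm x)\<^sup>2"
  shows "bounded_op (lreg G k)" "opnorm (lreg G k) \<le> K"
proof -
  have b: "lreg G k x \<in> l2" "l2norm (lreg G k x) \<le> K * l2norm x" if "x \<in> l2" for x
    using l2I[of "K * l2norm x" "lreg G k x"] assms(1,3) that by auto
  then show "opnorm (lreg G k) \<le> K"
    using assms(1) by (intro opnorm_le) auto
  show "bounded_op (lreg G k)"
    unfolding bounded_op_def
  proof (intro conjI ballI allI impI)
    fix x w :: "'g \<Rightarrow> complex"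
    assume l: "x \<in> l2" "w \<in> l2"
    show "lreg G k (\<lambda>y. x y + w y) = (\<lambda>y. lreg G k x y + lreg G k w y)"
      using assms(2)[OF l(1)] assms(2)[OF l(2)]
      by (simp add: fun_eq_iff lreg_apply l l2_add distrib_left infsum_add)
  next
    fix x :: "'g \<Rightarrow> complex" and c
    assume l: "x \<in> l2"
    have "infsum (\<lambda>d. kmat k y d * (c * x d)) UNIV = c * infsum (\<lambda>d. kmat k y d * x d) UNIV" for y
      by (subst infsum_cmult_right'[symmetric]) (simp add: algebra_simps)
    then show "lreg G k (\<lambda>y. c * x y) = (\<lambda>y. c * lreg G k x y)"
      by (simp add: fun_eq_iff lreg_apply l l2_scale)
  next
    show "\<exists>K. \<forall>x\<in>l2. l2norm (lreg G k x) \<le> K * l2norm x"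
      using b(2) by blast
  qed (use b lreg_not_l2 in auto)
qed

text \<open>For a function supported on a bisection each row of the matrix has at most one non-zero
  entry, so convolution becomes a weighted translation.\<close>

lemma lreg_has_sum_bisection:
  assumes inj: "inj_on r U" and supp: "\<And>g. g \<notin> U \<Longrightarrow> f g = 0"
  shows "\<alpha> \<in> U \<Longrightarrow> r \<alpha> = r \<gamma> \<Longrightarrow> ((\<lambda>\<beta>. kmat f \<gamma> \<beta> * \<xi> \<beta>) has_sum f \<alpha> * \<xi> (iv \<alpha> \<odot> \<gamma>)) UNIV"
    and "r \<gamma> \<notin> r ` U \<Longrightarrow> ((\<lambda>\<beta>. kmat f \<gamma> \<beta> * \<xi> \<beta>) has_sum 0) UNIV"
proof -
  assume \<alpha>: "\<alpha> \<in> U" "r \<alpha> = r \<gamma>"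
  have "kmat f \<gamma> \<beta> = 0" if "\<beta> \<noteq> iv \<alpha> \<odot> \<gamma>" for \<beta>
  proof (rule ccontr)
    assume "kmat f \<gamma> \<beta> \<noteq> 0"
    then have "s \<beta> = s \<gamma>" "f (\<gamma> \<odot> iv \<beta>) \<noteq> 0"
      by (auto simp: kmat_def split: if_splits)
    then have "\<gamma> \<odot> iv \<beta> = \<alpha>"
      using supp inj_onD[OF inj, of "\<gamma> \<odot> iv \<beta>" \<alpha>] \<alpha> by auto
    then have "iv \<alpha> \<odot> \<gamma> = \<beta>"
      using \<open>s \<beta> = s \<gamma>\<close> by (simp add: iv_mult flip: \<open>\<gamma> \<odot> iv \<beta> = \<alpha>\<close>)
    then show False
      using that by simp
  qed
  moreover have "kmat f \<gamma> (iv \<alpha> \<odot> \<gamma>) = f \<alpha>"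
    using \<alpha>(2) by (simp add: kmat_def iv_mult)
  ultimately show "((\<lambda>\<beta>. kmat f \<gamma> \<beta> * \<xi> \<beta>) has_sum f \<alpha> * \<xi> (iv \<alpha> \<odot> \<gamma>)) UNIV"
    by (intro has_sum_finite_neutralI[of "{iv \<alpha> \<odot> \<gamma>}"]) auto
next
  assume "r \<gamma> \<notin> r ` U"
  then have "kmat f \<gamma> \<beta> = 0" for \<beta>
    using supp[of "\<gamma> \<odot> iv \<beta>"] unfolding kmat_def
    by (metis ax(7) ax_mult(1) imageI)
  then show "((\<lambda>\<beta>. kmat f \<gamma> \<beta> * \<xi> \<beta>) has_sum 0) UNIV"
    by simp
qed

text \<open>The operator is a weighted partial permutation of the basis, with weights bounded by
  \<open>M\<close>. Injectivity of the range makes it single-valued, injectivity of the source makes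
  the permutation \<open>t\<close> injective.\<close>

lemma bounded_op_lreg_bisection:
  assumes inj: "inj_on r U" "inj_on s U" and supp: "\<And>g. g \<notin> U \<Longrightarrow> f g = 0"
    and M: "\<And>g. cmod (f g) \<le> M"
  shows "bounded_op (lreg G f)" "opnorm (lreg G f) \<le> M"
proof -
  have "0 \<le> M"
    using M[of undefined] norm_ge_zero order_trans by blast
  note hs = lreg_has_sum_bisection[OF inj(1) supp]
  have summ: "(\<lambda>\<beta>. kmat f \<gamma> \<beta> * \<xi> \<beta>) summable_on UNIV" for \<gamma> \<xi>
  proof (cases "r \<gamma> \<in> r ` U")
    case True
    then obtain \<alpha> where "\<alpha> \<in> U" "r \<alpha> = r \<gamma>"
      by (metis imageE)
    then show ?thesis
      by (intro has_sum_imp_summable[OF hs(1)])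
  next
    case False
    then show ?thesis
      by (intro has_sum_imp_summable[OF hs(2)])
  qed
  have bound: "(\<Sum>\<gamma>\<in>F. (cmod (lreg G f \<xi> \<gamma>))\<^sup>2) \<le> (M * l2norm \<xi>)\<^sup>2" if l: "\<xi> \<in> l2" and F: "finite F" for \<xi> F
  proof -
    define F' where "F' = {\<gamma> \<in> F. r \<gamma> \<in> r ` U}"
    define \<sigma> where "\<sigma> = the_inv_into U r"
    define t where "t \<gamma> = iv (\<sigma> (r \<gamma>)) \<odot> \<gamma>" for \<gamma>
    have \<sigma>: "\<sigma> x \<in> U" "r (\<sigma> x) = x" if "x \<in> r ` U" for x
      using that the_inv_into_f_f[OF inj(1)] unfolding \<sigma>_def by auto
    have "inj_on t F'"
    proof (rule inj_onI)
      fix \<gamma> \<gamma>'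
      assume *: "\<gamma> \<in> F'" "\<gamma>' \<in> F'" "t \<gamma> = t \<gamma>'"
      let ?\<alpha> = "\<sigma> (r \<gamma>)" and ?\<alpha>' = "\<sigma> (r \<gamma>')"
      have a: "?\<alpha> \<in> U" "r ?\<alpha> = r \<gamma>" "?\<alpha>' \<in> U" "r ?\<alpha>' = r \<gamma>'"
        using \<sigma> * by (auto simp: F'_def)
      \<comment> \<open>The range of \<open>t \<gamma>\<close> recovers the source of the dividing
        arrow, hence that arrow itself, and then \<open>\<gamma>\<close> by cancellation.\<close>
      have "s ?\<alpha> = r (t \<gamma>)" "s ?\<alpha>' = r (t \<gamma>')"
        using a by (simp_all add: t_def)
      then have "?\<alpha> = ?\<alpha>'"
        using * a inj_onD[OF inj(2)] by simp
      then show "\<gamma> = \<gamma>'"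
        using * a unfolding t_def by (metis cancel(2))
    qed
    have "(\<Sum>\<gamma>\<in>F. (cmod (lreg G f \<xi> \<gamma>))\<^sup>2) = (\<Sum>\<gamma>\<in>F'. (cmod (lreg G f \<xi> \<gamma>))\<^sup>2)"
    proof (rule sum.mono_neutral_right)
      show "\<forall>\<gamma>\<in>F - F'. (cmod (lreg G f \<xi> \<gamma>))\<^sup>2 = 0"
      proof
        fix \<gamma>
        assume "\<gamma> \<in> F - F'"
        then have "r \<gamma> \<notin> r ` U"
          by (auto simp: F'_def)
        then show "(cmod (lreg G f \<xi> \<gamma>))\<^sup>2 = 0"
          using infsumI[OF hs(2)] by (simp add: lreg_apply[OF l])
      qed
    qed (use F in \<open>auto simp: F'_def\<close>)
    also have "\<dots> \<le> (\<Sum>\<gamma>\<in>F'. M\<^sup>2 * (cmod (\<xi> (t \<gamma>)))\<^sup>2)"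
    proof (rule sum_mono)
      fix \<gamma>
      assume "\<gamma> \<in> F'"
      then have "lreg G f \<xi> \<gamma> = f (\<sigma> (r \<gamma>)) * \<xi> (t \<gamma>)"
        using infsumI[OF hs(1)[where \<alpha> = "\<sigma> (r \<gamma>)" and \<gamma> = \<gamma> and \<xi> = \<xi>]] \<sigma>[of "r \<gamma>"]
        by (simp add: lreg_apply[OF l] F'_def t_def)
      then show "(cmod (lreg G f \<xi> \<gamma>))\<^sup>2 \<le> M\<^sup>2 * (cmod (\<xi> (t \<gamma>)))\<^sup>2"
        using M by (simp add: norm_mult power_mult_distrib mult_right_mono power_mono)
    qed
    also have "\<dots> = M\<^sup>2 * (\<Sum>\<beta>\<in>t ` F'. (cmod (\<xi> \<beta>))\<^sup>2)"
      using \<open>inj_on t F'\<close> by (simp add: sum_distrib_left sum.reindex)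
    also have "\<dots> \<le> M\<^sup>2 * (l2norm \<xi>)\<^sup>2"
      using F by (intro mult_left_mono l2_sum_le l) (auto simp: F'_def)
    finally show ?thesis
      by (simp add: power_mult_distrib)
  qed
  show "bounded_op (lreg G f)" "opnorm (lreg G f) \<le> M"
    using bounded_op_lregI[OF \<open>0 \<le> M\<close>, of f] summ bound by auto
qed

lemma kern_compose_bisection:
  assumes S: "conv_op S" and b: "bounded_op (lreg G f)"
    and inj: "inj_on r U" and supp: "\<And>g. g \<notin> U \<Longrightarrow> f g = 0"
  shows "\<alpha> \<in> U \<Longrightarrow> r \<alpha> = r g \<Longrightarrow> kern (lreg G f \<circ> S) g = f \<alpha> * kern S (iv \<alpha> \<odot> g)"
    and "r g \<notin> r ` U \<Longrightarrow> kern (lreg G f \<circ> S) g = 0"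
proof -
  let ?\<xi> = "S (basis_vec (s g))"
  have l: "?\<xi> \<in> l2"
    using bounded_opD(1)[OF conv_opD(1)[OF S]] by simp
  have eq: "kern (lreg G f \<circ> S) g = infsum (\<lambda>\<beta>. kmat f g \<beta> * ?\<xi> \<beta>) UNIV"
    by (simp add: kern_def lreg_apply[OF l])
  show "kern (lreg G f \<circ> S) g = f \<alpha> * kern S (iv \<alpha> \<odot> g)" if "\<alpha> \<in> U" "r \<alpha> = r g"
    unfolding eq using infsumI[OF lreg_has_sum_bisection(1)[where \<xi> = ?\<xi> and \<gamma> = g, OF inj supp that]] that
    by (simp add: kern_def)
  show "kern (lreg G f \<circ> S) g = 0" if "r g \<notin> r ` U"
    unfolding eq by (rule infsumI[OF lreg_has_sum_bisection(2)[OF inj supp that]])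
qed

text \<open>Extension by zero from the clopen unit space. The units form a bisection, so convolution
  by this function is the multiplication operator \<open>mulop\<close>, as
  \<open>mulop_eq_lreg\<close> records.\<close>

definition diag :: "('g \<Rightarrow> complex) \<Rightarrow> 'g \<Rightarrow> complex" where
  "diag p g = (if g \<in> units then p g else 0)"

lemma mulop_eq_lreg: "mulop G p = lreg G (diag p)"
proof (intro ext)
  fix \<xi> \<gamma>
  show "mulop G p \<xi> \<gamma> = lreg G (diag p) \<xi> \<gamma>"
  proof (cases "\<xi> \<in> l2")
    case True
    have "((\<lambda>\<beta>. kmat (diag p) \<gamma> \<beta> * \<xi> \<beta>) has_sum diag p (r \<gamma>) * \<xi> (iv (r \<gamma>) \<odot> \<gamma>)) UNIV"
      by (rule lreg_has_sum_bisection(1)[of units]) (auto simp: diag_def inj_on_def)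
    then show ?thesis
      using True by (simp add: mulop_def lreg_apply infsumI diag_def)
  qed (simp add: mulop_def lreg_not_l2)
qed

lemma kern_mulop [simp]: "kern (mulop G p) = diag p"
  by (simp add: mulop_eq_lreg)

lemma kern_mulop_compose:
  assumes "bounded_op T"
  shows "kern (mulop G p \<circ> T) g = p (r g) * kern T g"
  using bounded_opD(1)[OF assms basis_vec_l2] by (simp add: kern_def mulop_def)

lemma kern_compose_mulop:
  assumes "bounded_op T"
  shows "kern (T \<circ> mulop G p) g = kern T g * p (s g)"
proof -
  have "mulop G p (basis_vec (s g)) = (\<lambda>x. p (s g) * basis_vec (s g) x)"
    using basis_vec_l2[of "s g"] by (auto simp: mulop_def basis_vec_def fun_eq_iff)
  then show ?thesis
    using bounded_opD(3)[OF assms basis_vec_l2] by (simp add: kern_def)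
qed

lemma compose_mulop_one: "bounded_op T \<Longrightarrow> T \<circ> mulop G (\<lambda>_. 1) = T"
  using bounded_opD(4)[of T] bounded_op_zero[of T] by (auto simp: mulop_def fun_eq_iff)

end

lemma (in grpd) conv_op_adj:
  assumes T: "conv_op T"
  shows "conv_op (op_adj T)" "kern (op_adj T) g = cnj (kern T (iv g))"
proof -
  have m: "op_adj T (basis_vec a) b = cnj (kmat (kern T) a b)" for a b
    by (simp add: op_adj_eq[OF conv_opD(1)[OF T]] adjoint_def l2inner_basis_right conv_opD(2)[OF T])
  show k: "kern (op_adj T) g = cnj (kern T (iv g))" for g
    unfolding kern_def[of "op_adj T"] m by (simp add: kmat_def)
  show "conv_op (op_adj T)"
    unfolding conv_op_def
  proof (intro conjI allI)
    show "bounded_op (op_adj T)"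
      using adjoint_bounded conv_opD(1)[OF T] by (simp add: op_adj_eq)
    show "op_adj T (basis_vec a) b = kmat (kern (op_adj T)) b a" for a b
      unfolding m by (simp add: kmat_def k iv_mult)
  qed
qed

section \<open>The reduced algebra\<close>

lemma CcI:
  fixes f :: "'a::t2_space \<Rightarrow> complex"
  assumes "continuous_on UNIV f" "compact K" "\<And>g. f g \<noteq> 0 \<Longrightarrow> g \<in> K"
  shows "f \<in> Cc"
proof -
  have "closure {g. f g \<noteq> 0} \<subseteq> K"
    using assms by (intro closure_minimal) (auto simp: compact_imp_closed)
  then have "compact (closure {g. f g \<noteq> 0})"
    using assms(2) by (metis closed_closure compact_Int_closed inf.absorb2)
  then show ?thesis
    using assms(1) by (simp add: Cc_def)
qed

lemma CcD:
  assumes "f \<in> Cc"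
  shows "continuous_on UNIV f" "compact (closure {g. f g \<noteq> 0})" "f g \<noteq> 0 \<Longrightarrow> g \<in> closure {g. f g \<noteq> 0}"
  using assms closure_subset[of "{g. f g \<noteq> 0}"] by (auto simp: Cc_def)

lemma Cc_bounded:
  assumes "f \<in> Cc"
  obtains M where "0 \<le> M" "\<And>g. cmod (f g) \<le> M"
proof -
  let ?K = "closure {g. f g \<noteq> 0}"
  have "compact (f ` ?K)"
    using CcD[OF assms] by (meson compact_continuous_image continuous_on_subset subset_UNIV)
  then obtain M where M: "\<And>x. x \<in> f ` ?K \<Longrightarrow> cmod x \<le> M"
    using compact_imp_bounded bounded_iff by metis
  have "cmod (f g) \<le> max M 0" for g
    using M[of "f g"] CcD(3)[OF assms, of g] by (cases "f g = 0") (auto simp: le_max_iff_disj)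
  then show thesis
    using that[of "max M 0"] by simp
qed

lemma continuous_on_clopen_extend:
  fixes f :: "'a::topological_space \<Rightarrow> complex"
  assumes "open A" "closed A" "continuous_on A f"
  shows "continuous_on UNIV (\<lambda>x. if x \<in> A then f x else 0)"
proof -
  have "continuous_on (A \<union> - A) (\<lambda>x. if x \<in> A then f x else 0)"
    using assms by (intro continuous_on_cases) auto
  then show ?thesis
    by simp
qed

context etale
begin

lemma lreg_add:
  assumes "bounded_op (lreg G f)" "bounded_op (lreg G h)"
  shows "lreg G (\<lambda>g. f g + h g) = op_add (lreg G f) (lreg G h)"
    and "lreg G (\<lambda>g. f g - h g) = op_diff (lreg G f) (lreg G h)"
  using conv_op_eq_lreg[OF conv_op_ops(1)[OF assms[THEN conv_op_lreg]]]
    conv_op_eq_lreg[OF conv_op_ops(2)[OF assms[THEN conv_op_lreg]]]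
  by (simp_all add: kern_ops[abs_def])

end

context ample
begin

text \<open>A compact support is covered by finitely many compact open bisections. These are also
  closed, so cutting a function off along one keeps both pieces continuous, and bisections can be
  split off one at a time.\<close>

lemma Cc_induct [consumes 1, case_names zero add cob]:
  assumes "f \<in> Cc"
    and zero: "Q (\<lambda>_. 0)"
    and add: "\<And>f h. f \<in> Cc \<Longrightarrow> h \<in> Cc \<Longrightarrow> Q f \<Longrightarrow> Q h \<Longrightarrow> Q (\<lambda>g. f g + h g)"
    and cob: "\<And>U f. cob U \<Longrightarrow> continuous_on UNIV f \<Longrightarrow> (\<And>g. g \<notin> U \<Longrightarrow> f g = 0) \<Longrightarrow> Q f"
  shows "Q f"
proof -
  obtain \<U> where \<U>: "finite \<U>" "closure {g. f g \<noteq> 0} \<subseteq> \<Union>\<U>" "\<And>U. U \<in> \<U> \<Longrightarrow> cob U"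
    using compact_cover_cob[OF CcD(2)[OF assms(1)] subset_UNIV] by auto
  \<comment> \<open>The function is generalised along with the cover, since the induction hypothesis
    is applied to what remains after splitting off one bisection.\<close>
  have *: "Q f" if "finite \<U>" "\<And>U. U \<in> \<U> \<Longrightarrow> cob U" "continuous_on UNIV f"
      "\<And>g. f g \<noteq> 0 \<Longrightarrow> g \<in> \<Union>\<U>" for f :: "'g \<Rightarrow> complex" and \<U>
    using that
  proof (induction \<U> arbitrary: f)
    case empty
    then have "f = (\<lambda>_. 0)"
      by auto
    then show ?case
      using zero by simp
  next
    case (insert U \<U>)
    define f1 f2 where "f1 = (\<lambda>g. if g \<in> U then f g else 0)" and "f2 = (\<lambda>g. if g \<in> - U then f g else 0)"
    have U: "open U" "closed U" "compact U" "cob U"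
      using insert cobD by auto
    have "continuous_on A f" for A
      using insert by (meson continuous_on_subset subset_UNIV)
    then have c: "continuous_on UNIV f1" "continuous_on UNIV f2"
      unfolding f1_def f2_def using U by (intro continuous_on_clopen_extend; auto)+
    have s2: "g \<in> \<Union>\<U>" if "f2 g \<noteq> 0" for g
      using insert.prems(3)[of g] that by (auto simp: f2_def split: if_splits)
    have "Q f2"
      using insert.IH[of f2] insert.prems c(2) s2 by blast
    moreover have "Q f1"
      using cob[OF U(4) c(1)] by (simp add: f1_def)
    moreover have "f1 \<in> Cc"
      using CcI[OF c(1) U(3)] by (simp add: f1_def split: if_splits)
    moreover have "f2 \<in> Cc"
      using insert.hyps insert.prems cobD(2) s2 by (intro CcI[OF c(2), of "\<Union>\<U>"] compact_Union) auto
    moreover have "f = (\<lambda>g. f1 g + f2 g)"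
      by (auto simp: f1_def f2_def)
    ultimately show ?case
      using add by metis
  qed
  show ?thesis
    using *[OF \<U>(1) _ CcD(1)[OF assms(1)]] \<U>(3) CcD(3)[OF assms(1)] \<U>(2) by (metis subsetD)
qed

lemma Cc_add:
  fixes f h :: "'g \<Rightarrow> complex"
  assumes f: "f \<in> Cc" and h: "h \<in> Cc"
  shows "(\<lambda>g. f g + h g) \<in> Cc"
proof (rule CcI)
  show "continuous_on UNIV (\<lambda>g. f g + h g)"
    "compact (closure {g. f g \<noteq> 0} \<union> closure {g. h g \<noteq> 0})"
    by (intro continuous_on_add compact_Un CcD assms)+
  show "f g + h g \<noteq> 0 \<Longrightarrow> g \<in> closure {g. f g \<noteq> 0} \<union> closure {g. h g \<noteq> 0}" for g
    using CcD(3)[OF f, of g] CcD(3)[OF h, of g] by (cases "f g = 0") simp_all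
qed

lemma Cc_cob: "cob U \<Longrightarrow> continuous_on UNIV f \<Longrightarrow> (\<And>g. g \<notin> U \<Longrightarrow> f g = 0) \<Longrightarrow> f \<in> Cc"
  by (rule CcI[of f U]) (auto simp: cobD)

lemma bounded_lreg_Cc: "f \<in> Cc \<Longrightarrow> bounded_op (lreg G f)"
proof (induction f rule: Cc_induct)
  case zero
  have "inj_on r {}" "inj_on s {}"
    by auto
  then show ?case
    by (rule bounded_op_lreg_bisection(1)[where f = "\<lambda>_. 0" and M = 0]) auto
next
  case (add f h)
  then show ?case
    by (simp add: lreg_add bounded_op_ops)
next
  case (cob U f)
  then obtain M where "\<And>g. cmod (f g) \<le> M"
    using Cc_bounded[OF Cc_cob] by metis
  then show ?case
    by (intro bounded_op_lreg_bisection(1)[OF cobD(4,5)[OF cob(1)] cob(3)])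
qed

lemma conv_op_lreg_Cc: "f \<in> Cc \<Longrightarrow> conv_op (lreg G f)"
  by (simp add: bounded_lreg_Cc conv_op_lreg)

text \<open>Only the left factor is decomposed. When it lives on a bisection, the product kernel is
  a translate of \<open>h\<close> times a weight, so continuity and compact support can be seen
  directly.\<close>

lemma lreg_Cc_compose:
  assumes "f \<in> Cc" "h \<in> Cc"
  shows "\<exists>k\<in>Cc. lreg G f \<circ> lreg G h = lreg G k"
  using assms(1)
proof (induction f rule: Cc_induct)
  case zero
  have "lreg G (\<lambda>_. 0) = (\<lambda>_ _. 0)"
    by (auto simp: fun_eq_iff lreg_def)
  then have "lreg G (\<lambda>_. 0) \<circ> lreg G h = lreg G (\<lambda>_. 0)"
    by (simp add: fun_eq_iff)
  moreover have "(\<lambda>_. 0) \<in> (Cc :: ('g \<Rightarrow> complex) set)"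
    using Cc_cob[OF cob_empty, of "\<lambda>_. 0"] by simp
  ultimately show ?case
    by blast
next
  case (add f1 f2)
  then obtain k1 k2 where k: "k1 \<in> Cc" "k2 \<in> Cc" "lreg G f1 \<circ> lreg G h = lreg G k1" "lreg G f2 \<circ> lreg G h = lreg G k2"
    by metis
  have "lreg G (\<lambda>g. f1 g + f2 g) \<circ> lreg G h = op_add (lreg G f1 \<circ> lreg G h) (lreg G f2 \<circ> lreg G h)"
    using add by (simp add: lreg_add bounded_lreg_Cc op_add_def fun_eq_iff)
  also have "\<dots> = lreg G (\<lambda>g. k1 g + k2 g)"
    using k by (simp add: lreg_add bounded_lreg_Cc)
  finally show ?case
    using Cc_add k by blast
next
  case (cob U f)
  have f: "f \<in> Cc"
    using cob Cc_cob by blast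
  let ?t = "\<lambda>y. iv (rsec U (r y)) \<odot> y" and ?A = "r -` (r ` U)"
  define k where "k y = (if y \<in> ?A then f (rsec U (r y)) * h (?t y) else 0)" for y
  have "k = kern (lreg G f \<circ> lreg G h)"
  proof
    fix y
    show "k y = kern (lreg G f \<circ> lreg G h) y"
      using kern_compose_bisection[OF conv_op_lreg_Cc[OF assms(2)] bounded_lreg_Cc[OF f] cobD(4)[OF cob(1)] cob(3)]
        rsec[OF cob(1)]
      by (cases "y \<in> ?A") (auto simp: k_def)
  qed
  then have "lreg G f \<circ> lreg G h = lreg G k"
    using conv_op_eq_lreg conv_op_compose(1) conv_op_lreg_Cc f assms(2) by metis
  moreover have "k \<in> Cc"
  proof (rule CcI)
    have "continuous_on ?A (\<lambda>y. f (rsec U (r y)) * h (?t y))"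
    proof (intro continuous_on_mult)
      have "continuous_on ?A (\<lambda>y. rsec U (r y))"
        using cont_structure(1)
        by (intro continuous_on_compose2[OF rsec(4)[OF cob(1)], of _ r]) (auto elim: continuous_on_subset)
      then show "continuous_on ?A (\<lambda>y. f (rsec U (r y)))"
        by (rule continuous_on_compose2[OF cob(2)]) simp
      show "continuous_on ?A (\<lambda>y. h (?t y))"
        by (rule continuous_on_compose2[OF CcD(1)[OF assms(2)] continuous_on_translate[OF cob(1)]]) simp
    qed
    then show "continuous_on UNIV k"
      unfolding k_def using cobD cob_r_image[OF cob(1)]
      by (intro continuous_on_clopen_extend open_vimage closed_vimage) auto
    show "compact (setmul U (closure {g. h g \<noteq> 0}))"
      by (intro compact_setmul cobD(2)[OF cob(1)] CcD(2)[OF assms(2)])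
    show "g \<in> setmul U (closure {g. h g \<noteq> 0})" if "k g \<noteq> 0" for g
      using that CcD(3)[OF assms(2), of "?t g"] by (auto simp: k_def setmul_iff[OF cob(1)] split: if_splits)
  qed
  ultimately show ?case
    by blast
qed

section \<open>Norm limits: kernels, products and sums in the reduced algebra\<close>

lemma Cred_bounded: "T \<in> Cred G \<Longrightarrow> bounded_op T"
  by (simp add: Cred_def)

text \<open>Right invariance is a relation between single matrix entries, and these are controlled
  by the operator norm, so it survives norm limits.\<close>

lemma Cred_conv_op:
  assumes "T \<in> Cred G"
  shows "conv_op T"
  unfolding conv_op_def
proof (intro conjI allI)
  show b: "bounded_op T"
    using assms by (rule Cred_bounded)
  fix a b
  have *: "cmod (T (basis_vec a) b - kmat (kern T) b a) \<le> 0 + \<epsilon>" if \<epsilon>: "\<epsilon> > 0" for \<epsilon>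
  proof -
    obtain f where f: "f \<in> Cc" "opnorm (op_diff T (lreg G f)) < \<epsilon> / 2"
      using assms half_gt_zero[OF \<epsilon>] unfolding Cred_def by blast
    have bd: "bounded_op (op_diff T (lreg G f))"
      by (intro bounded_op_ops b bounded_lreg_Cc f)
    have 1: "cmod (T (basis_vec a) b - kmat f b a) < \<epsilon> / 2"
      using cmod_matrix_le_opnorm[OF bd, of a b] f(2) by (simp add: op_diff_def lreg_basis)
    have "cmod (kern T g - f g) < \<epsilon> / 2" for g
      using cmod_kern_le[OF bd, of g] f(2) by simp
    then have 2: "cmod (kmat f b a - kmat (kern T) b a) < \<epsilon> / 2"
      using that by (simp add: kmat_def norm_minus_commute)
    show ?thesis
      using norm_diff_triangle_less[OF 1 2] by simp
  qed
  have "cmod (T (basis_vec a) b - kmat (kern T) b a) \<le> 0"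
    by (rule field_le_epsilon) (rule *)
  then show "T (basis_vec a) b = kmat (kern T) b a"
    by simp
qed

lemma Cred_approx:
  assumes "T \<in> Cred G" "\<epsilon> > 0"
  obtains f where "f \<in> Cc" "opnorm (op_diff T (lreg G f)) < \<epsilon>"
  using assms by (auto simp: Cred_def)

text \<open>Kernel values are dominated by the operator norm uniformly in the arrow, so norm
  approximation by \<open>Cc\<close> is uniform approximation of kernels.\<close>

lemma continuous_kern:
  assumes "T \<in> Cred G"
  shows "continuous_on UNIV (kern T)"
proof -
  have "\<exists>f\<in>Cc. opnorm (op_diff T (lreg G f)) < inverse (real (Suc n))" for n
    using Cred_approx[OF assms, of "inverse (real (Suc n))"] by (metis inverse_positive_iff_positive of_nat_0_less_iff zero_less_Suc)
  then obtain f where f: "\<And>n. f n \<in> Cc" "\<And>n. opnorm (op_diff T (lreg G (f n))) < inverse (real (Suc n))"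
    by metis
  have *: "cmod (kern T g - f n g) < inverse (real (Suc n))" for g n
    using cmod_kern_le[OF bounded_op_ops(2)[OF Cred_bounded[OF assms] bounded_lreg_Cc[OF f(1)]], of n g] f(2)[of n]
    by simp
  have "uniform_limit UNIV f (kern T) sequentially"
  proof (rule uniform_limitI)
    fix e :: real
    assume "e > 0"
    then obtain N where N: "inverse (real (Suc N)) < e"
      using reals_Archimedean by blast
    have "dist (f n g) (kern T g) < e" if "n \<ge> N" for n g
    proof -
      have "inverse (real (Suc n)) \<le> inverse (real (Suc N))"
        using that by (intro le_imp_inverse_le) auto
      then show ?thesis
        using *[of g n] N unfolding dist_norm by (subst norm_minus_commute) linarith
    qed
    then show "\<forall>\<^sub>F n in sequentially. \<forall>x\<in>UNIV. dist (f n x) (kern T x) < e"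
      unfolding eventually_sequentially by blast
  qed
  then show ?thesis
    using CcD(1)[OF f(1)] by (intro uniform_limit_theorem[of _ f]) auto
qed

lemma Cred_closed:
  assumes "bounded_op T" "\<And>\<epsilon>. \<epsilon> > 0 \<Longrightarrow> \<exists>S\<in>Cred G. opnorm (op_diff T S) < \<epsilon>"
  shows "T \<in> Cred G"
proof -
  have "\<exists>f\<in>Cc. opnorm (op_diff T (lreg G f)) < \<epsilon>" if \<epsilon>: "\<epsilon> > 0" for \<epsilon>
  proof -
    obtain S where S: "S \<in> Cred G" "opnorm (op_diff T S) < \<epsilon> / 2"
      using assms(2)[OF half_gt_zero[OF \<epsilon>]] by blast
    obtain f where f: "f \<in> Cc" "opnorm (op_diff S (lreg G f)) < \<epsilon> / 2"
      using Cred_approx[OF S(1) half_gt_zero[OF \<epsilon>]] by blast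
    have "op_diff T (lreg G f) = op_add (op_diff T S) (op_diff S (lreg G f))"
      by (simp add: op_diff_def op_add_def)
    then have "opnorm (op_diff T (lreg G f)) \<le> opnorm (op_diff T S) + opnorm (op_diff S (lreg G f))"
      using bounded_op_ops assms(1) Cred_bounded S(1) bounded_lreg_Cc f(1) by metis
    then show ?thesis
      using f S by force
  qed
  then show ?thesis
    using assms(1) by (simp add: Cred_def)
qed

lemma opnorm_diff_self [simp]: "opnorm (op_diff T T) \<le> 0"
  by (rule opnorm_le) (auto simp: op_diff_def)

lemma lreg_Cc_Cred: "f \<in> Cc \<Longrightarrow> lreg G f \<in> Cred G"
  unfolding Cred_def using le_less_trans[OF opnorm_diff_self[of "lreg G f"]] bounded_lreg_Cc by blast

lemma Cred_compose:
  assumes "T \<in> Cred G" "S \<in> Cred G"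
  shows "T \<circ> S \<in> Cred G"
proof (rule Cred_closed)
  have b: "bounded_op T" "bounded_op S"
    using assms Cred_bounded by auto
  show "bounded_op (T \<circ> S)"
    using b by (rule bounded_op_compose)
  fix \<epsilon> :: real
  assume "\<epsilon> > 0"
  \<comment> \<open>The bound 1 keeps the norm of the second approximant below
    \<open>opnorm S + 1\<close>. The denominator is one more than
    \<open>opnorm T + (opnorm S + 1)\<close>, which makes the final estimate strict.\<close>
  define \<delta> where "\<delta> = min 1 (\<epsilon> / (opnorm T + opnorm S + 2))"
  have pos: "opnorm T \<ge> 0" "opnorm S \<ge> 0"
    using b opnorm_nonneg by auto
  then have \<delta>: "\<delta> > 0" "\<delta> \<le> 1" "\<delta> \<le> \<epsilon> / (opnorm T + opnorm S + 2)"
    using \<open>\<epsilon> > 0\<close> by (auto simp: \<delta>_def)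
  obtain f where f: "f \<in> Cc" "opnorm (op_diff T (lreg G f)) < \<delta>"
    using Cred_approx[OF assms(1) \<delta>(1)] by metis
  obtain h where h: "h \<in> Cc" "opnorm (op_diff S (lreg G h)) < \<delta>"
    using Cred_approx[OF assms(2) \<delta>(1)] by metis
  let ?F = "lreg G f" and ?H = "lreg G h"
  have bF: "bounded_op ?F" "bounded_op ?H"
    using f h bounded_lreg_Cc by auto
  have "?H = op_add S (op_scale (-1) (op_diff S ?H))"
    by (simp add: op_add_def op_scale_def op_diff_def fun_eq_iff)
  then have "opnorm ?H \<le> opnorm S + opnorm (op_diff S ?H)"
    using bounded_op_ops(4)[OF b(2) bounded_op_ops(3)[OF bounded_op_ops(2)[OF b(2) bF(2)], of S "-1"]]
      bounded_op_ops(5)[OF bounded_op_ops(2)[OF b(2) bF(2)], of S "-1"] b by fastforce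
  then have H: "opnorm ?H \<le> opnorm S + 1"
    using h(2) \<delta>(2) by linarith
  have "op_diff (T \<circ> S) (?F \<circ> ?H) = op_add (T \<circ> op_diff S ?H) (op_diff T ?F \<circ> ?H)"
  proof (intro ext)
    fix x :: "'g \<Rightarrow> complex" and y
    show "op_diff (T \<circ> S) (?F \<circ> ?H) x y = op_add (T \<circ> op_diff S ?H) (op_diff T ?F \<circ> ?H) x y"
    proof (cases "x \<in> l2")
      case True
      then have "T (\<lambda>y. S x y - ?H x y) = (\<lambda>y. T (S x) y - T (?H x) y)"
        by (intro bounded_op_diff b bounded_opD(1)[OF b(2)] bounded_opD(1)[OF bF(2)])
      then show ?thesis
        by (simp add: op_add_def op_diff_def)
    next
      case False
      then have "S x = (\<lambda>_. 0)" "?H x = (\<lambda>_. 0)"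
        using bounded_opD(4)[OF b(2)] bounded_opD(4)[OF bF(2)] by auto
      then show ?thesis
        using bounded_op_zero[OF b(1)] by (simp add: op_add_def op_diff_def)
    qed
  qed
  then have "opnorm (op_diff (T \<circ> S) (?F \<circ> ?H)) \<le> opnorm (T \<circ> op_diff S ?H) + opnorm (op_diff T ?F \<circ> ?H)"
    using bounded_op_ops(4)[OF bounded_op_compose bounded_op_compose] bounded_op_ops(2) b bF by metis
  also have "\<dots> \<le> opnorm T * opnorm (op_diff S ?H) + opnorm (op_diff T ?F) * opnorm ?H"
    by (intro add_mono opnorm_compose_le bounded_op_ops b bF)
  also have "\<dots> \<le> opnorm T * \<delta> + \<delta> * (opnorm S + 1)"
    using f(2) h(2) H pos \<delta>(1) opnorm_nonneg[OF bF(2)] opnorm_nonneg[OF bounded_op_ops(2)[OF b(2) bF(2)]]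
    by (intro add_mono mult_mono) auto
  also have "\<dots> < \<delta> * (opnorm T + opnorm S + 2)"
    using \<delta>(1) by (simp add: algebra_simps)
  also have "\<dots> \<le> \<epsilon>"
    using \<delta>(3) pos by (simp add: field_simps)
  finally have "opnorm (op_diff (T \<circ> S) (?F \<circ> ?H)) < \<epsilon>" .
  moreover have "?F \<circ> ?H \<in> Cred G"
    using lreg_Cc_compose[OF f(1) h(1)] lreg_Cc_Cred by auto
  ultimately show "\<exists>S'\<in>Cred G. opnorm (op_diff (T \<circ> S) S') < \<epsilon>"
    by blast
qed

lemma Cred_add:
  assumes "T \<in> Cred G" "S \<in> Cred G"
  shows "op_add T S \<in> Cred G"
proof (rule Cred_closed)
  have b: "bounded_op T" "bounded_op S"
    using assms Cred_bounded by auto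
  then show "bounded_op (op_add T S)"
    by (rule bounded_op_ops)
  fix \<epsilon> :: real
  assume "\<epsilon> > 0"
  obtain f where f: "f \<in> Cc" "opnorm (op_diff T (lreg G f)) < \<epsilon> / 2"
    using Cred_approx[OF assms(1), of "\<epsilon> / 2"] \<open>\<epsilon> > 0\<close> by auto
  obtain h where h: "h \<in> Cc" "opnorm (op_diff S (lreg G h)) < \<epsilon> / 2"
    using Cred_approx[OF assms(2), of "\<epsilon> / 2"] \<open>\<epsilon> > 0\<close> by auto
  have bF: "bounded_op (lreg G f)" "bounded_op (lreg G h)"
    using f h bounded_lreg_Cc by auto
  have "op_diff (op_add T S) (lreg G (\<lambda>g. f g + h g)) = op_add (op_diff T (lreg G f)) (op_diff S (lreg G h))"
    by (simp add: lreg_add bF) (simp add: op_add_def op_diff_def fun_eq_iff)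
  then have "opnorm (op_diff (op_add T S) (lreg G (\<lambda>g. f g + h g))) < \<epsilon>"
    using bounded_op_ops(4)[OF bounded_op_ops(2)[OF b(1) bF(1)] bounded_op_ops(2)[OF b(2) bF(2)]] f(2) h(2) by force
  then show "\<exists>S'\<in>Cred G. opnorm (op_diff (op_add T S) S') < \<epsilon>"
    using lreg_Cc_Cred[OF Cc_add[OF f(1) h(1)]] by blast
qed

lemma diag_Cc:
  assumes "p \<in> C_units G"
  shows "diag p \<in> Cc"
  unfolding diag_def[abs_def]
proof (rule Cc_cob[OF cob_units_full])
  show "continuous_on UNIV (\<lambda>g. if g \<in> units then p g else 0)"
    using assms by (intro continuous_on_clopen_extend) (auto simp: C_units_def)
qed simp

lemma mulop_Cred: "p \<in> C_units G \<Longrightarrow> mulop G p \<in> Cred G"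
  by (simp add: mulop_eq_lreg diag_Cc lreg_Cc_Cred)

text \<open>Constants are continuous on the compact unit space, so scaling is composition with a
  multiplication operator and closure under products suffices.\<close>

lemma Cred_scale:
  assumes "T \<in> Cred G"
  shows "op_scale c T \<in> Cred G"
proof -
  have "mulop G (\<lambda>_. c) \<circ> T = op_scale c T"
    using bounded_opD(1,4)[OF Cred_bounded[OF assms]] by (auto simp: mulop_def op_scale_def fun_eq_iff)
  then show ?thesis
    using Cred_compose[OF mulop_Cred assms, of "\<lambda>_. c"] by (simp add: C_units_def)
qed

text \<open>The partial isometry attached to a bisection, or the projection when \<open>U\<close>
  consists of units. By \<open>char_op_compose\<close> these multiply as the sets do.\<close>

definition char_op :: "'g set \<Rightarrow> 'g op" where
  "char_op U = lreg G (\<lambda>g. if g \<in> U then 1 else 0)"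

lemma ind_Cc: "cob U \<Longrightarrow> (\<lambda>g. if g \<in> U then 1 else 0) \<in> (Cc :: ('g \<Rightarrow> complex) set)"
  by (rule Cc_cob[of U]) (auto intro!: continuous_on_clopen_extend simp: cobD)

lemma kern_char_op [simp]: "kern (char_op U) g = (if g \<in> U then 1 else 0)"
  by (simp add: char_op_def)

lemma char_op_Cred: "cob U \<Longrightarrow> char_op U \<in> Cred G"
  by (simp add: char_op_def ind_Cc lreg_Cc_Cred)

lemma char_op_compose:
  assumes "cob U" "cob V"
  shows "char_op U \<circ> char_op V = char_op (setmul U V)"
proof (rule conv_op_eqI)
  have c: "conv_op (char_op U)" "conv_op (char_op V)"
    using assms by (auto intro!: Cred_conv_op char_op_Cred)
  then show "conv_op (char_op U \<circ> char_op V)"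
    by (rule conv_op_compose)
  show "conv_op (char_op (setmul U V))"
    using assms by (intro Cred_conv_op char_op_Cred cob_setmul)
  fix g
  note k = kern_compose_bisection[OF c(2) conv_opD(1)[OF c(1), unfolded char_op_def] cobD(4)[OF assms(1)], folded char_op_def]
  show "kern (char_op U \<circ> char_op V) g = kern (char_op (setmul U V)) g"
  proof (cases "r g \<in> r ` U")
    case True
    then show ?thesis
      using k(1)[of "rsec U (r g)" g] rsec(2,3)[OF assms(1) True] by (simp add: setmul_iff[OF assms(1)])
  next
    case False
    then show ?thesis
      using k(2)[of g] by (simp add: setmul_iff[OF assms(1)])
  qed
qed

end

lemma (in ample) opnorm_char_op_le: "cob U \<Longrightarrow> opnorm (char_op U) \<le> 1"
  unfolding char_op_def by (rule bounded_op_lreg_bisection(2)[OF cobD(4,5)]) auto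

section \<open>Corners, diagonals and fullness\<close>

context ample
begin

definition clopen_units :: "'g set \<Rightarrow> bool" where
  "clopen_units Y \<longleftrightarrow> Y \<subseteq> units \<and> open Y \<and> compact Y"

text \<open>Corner and diagonal are described by supports of kernels, the form used in all
  arguments; \<open>corner_eq\<close> and \<open>diag_eq\<close> identify them with the algebras in
  the theorem.\<close>

definition corner_alg :: "'g set \<Rightarrow> 'g op set" where
  "corner_alg Y = {T \<in> Cred G. \<forall>g. kern T g \<noteq> 0 \<longrightarrow> g \<in> restr Y}"

definition diag_alg :: "'g set \<Rightarrow> 'g op set" where
  "diag_alg Y = {T \<in> Cred G. \<forall>g. kern T g \<noteq> 0 \<longrightarrow> g \<in> Y}"

lemma clopen_unitsD:
  assumes "clopen_units Y"
  shows "Y \<subseteq> units" "open Y" "compact Y" "closed Y" "cob Y"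
  using assms by (auto simp: clopen_units_def compact_imp_closed cob_units)

lemma clopen_units_restr: "clopen_units Y \<Longrightarrow> Y \<subseteq> restr Y"
  unfolding clopen_units_def restr_iff by (metis restr_iff subsetD subsetI unitsD(1,2))

lemma clopen_restr: "clopen_units Y \<Longrightarrow> open (restr Y)" "clopen_units Y \<Longrightarrow> closed (restr Y)"
  unfolding restr_def restrict_groupoid_def
  by (simp_all add: clopen_unitsD open_Int closed_Int open_vimage closed_vimage)

lemma diag_alg_subset: "clopen_units Y \<Longrightarrow> diag_alg Y \<subseteq> corner_alg Y"
  using clopen_units_restr by (auto simp: diag_alg_def corner_alg_def)

lemma diag_alg_mulop:
  assumes "clopen_units Y" "T \<in> diag_alg Y"
  shows "T = mulop G (kern T)" "kern T \<in> C_units G" "\<And>x. cmod (kern T x) \<le> opnorm T"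
proof -
  have T: "T \<in> Cred G" "\<And>g. kern T g \<noteq> 0 \<Longrightarrow> g \<in> units"
    using assms clopen_unitsD(1) by (auto simp: diag_alg_def)
  show "kern T \<in> C_units G"
    using continuous_kern[OF T(1)] by (auto simp: C_units_def elim: continuous_on_subset)
  then have "conv_op (mulop G (kern T))"
    by (intro Cred_conv_op mulop_Cred)
  then show "T = mulop G (kern T)"
    using T by (intro conv_op_eqI) (auto simp: diag_def Cred_conv_op)
  show "cmod (kern T x) \<le> opnorm T" for x
    using Cred_bounded[OF T(1)] by (rule cmod_kern_le)
qed

lemma kern_compose_diag:
  assumes "clopen_units Y" "d \<in> diag_alg Y" "bounded_op T"
  shows "kern (T \<circ> d) g = kern T g * kern d (s g)" "kern (d \<circ> T) g = kern d (r g) * kern T g"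
  using kern_compose_mulop[OF assms(3), of "kern d"] kern_mulop_compose[OF assms(3), of "kern d"]
    diag_alg_mulop(1)[OF assms(1,2)] by simp_all

lemma diag_alg_commute:
  assumes "clopen_units Y" "c \<in> diag_alg Y" "d \<in> diag_alg Y"
  shows "c \<circ> d = d \<circ> c"
proof (rule conv_op_eqI)
  have "c \<in> Cred G" "d \<in> Cred G"
    using assms by (auto simp: diag_alg_def)
  then show "conv_op (c \<circ> d)" "conv_op (d \<circ> c)"
    by (auto intro: Cred_conv_op Cred_compose)
  have "bounded_op c" "bounded_op d"
    using \<open>c \<in> Cred G\<close> \<open>d \<in> Cred G\<close> Cred_bounded by auto
  then have k: "kern (c \<circ> d) g = kern c g * kern d (s g)" "kern (d \<circ> c) g = kern d g * kern c (s g)" for g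
    using kern_compose_diag(1)[OF assms(1,3)] kern_compose_diag(1)[OF assms(1,2)] by auto
  have z: "kern c g = 0" "kern d g = 0" if "g \<notin> units" for g
    using that assms clopen_unitsD(1)[OF assms(1)] unfolding diag_alg_def by blast+
  show "kern (c \<circ> d) g = kern (d \<circ> c) g" for g
    unfolding k by (cases "g \<in> units") (simp_all add: z)
qed

lemma mulop_diag_alg:
  assumes "clopen_units Y" "q \<in> C_units G" "\<And>x. x \<in> units \<Longrightarrow> q x \<noteq> 0 \<Longrightarrow> x \<in> Y"
  shows "mulop G q \<in> diag_alg Y"
  using assms mulop_Cred by (auto simp: diag_alg_def diag_def)

lemma char_op_diag_alg: "clopen_units W \<Longrightarrow> W \<subseteq> Y \<Longrightarrow> char_op W \<in> diag_alg Y"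
  using char_op_Cred[OF clopen_unitsD(5)] by (auto simp: diag_alg_def)

lemma char_op_corner_alg: "cob U \<Longrightarrow> U \<subseteq> restr Y \<Longrightarrow> char_op U \<in> corner_alg Y"
  using char_op_Cred by (auto simp: corner_alg_def)

lemma ind_C_units:
  assumes "clopen_units Y"
  shows "(\<lambda>x. if x \<in> Y then 1 else 0) \<in> C_units G"
  unfolding C_units_def using continuous_on_clopen_extend[of Y "\<lambda>_. 1"] clopen_unitsD[OF assms]
  by (auto elim!: continuous_on_subset)

text \<open>A projection has values 0 and 1 on units, so its support is both the preimage of
  \<open>{1}\<close>, which is closed, and the preimage of the non-zero numbers, which is
  open.\<close>

lemma projection_support:
  assumes "projection_in_C_units G p"
  obtains Y where "clopen_units Y" "\<And>x. x \<in> units \<Longrightarrow> p x = (if x \<in> Y then 1 else 0)"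
proof -
  define Y where "Y = {x \<in> units. p x = 1}"
  have p: "p x = 0 \<or> p x = 1" if "x \<in> units" for x
    using assms that unfolding projection_in_C_units_def by (metis mult_cancel_right1)
  have c: "continuous_on units p"
    using assms by (simp add: projection_in_C_units_def C_units_def)
  have "closed (units \<inter> p -` {1})"
    using continuous_closed_preimage[OF c] by simp
  moreover have "units \<inter> p -` {1} = Y"
    by (auto simp: Y_def)
  ultimately have "compact (units \<inter> Y)"
    using compact_units by (metis compact_Int_closed)
  moreover have "open (units \<inter> p -` (- {0}))"
    using continuous_open_preimage[OF c open_units, of "- {0}"] by (simp add: open_Compl)
  moreover have "units \<inter> p -` (- {0}) = Y" "units \<inter> Y = Y"
    using p by (auto simp: Y_def)
  ultimately have "clopen_units Y"
    by (auto simp: clopen_units_def Y_def)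
  then show thesis
    by (rule that) (use p in \<open>auto simp: Y_def\<close>)
qed

lemma projection_ind:
  assumes "clopen_units Y"
  shows "projection_in_C_units G (\<lambda>x. if x \<in> Y then 1 else 0)"
  using ind_C_units[OF assms] by (auto simp: projection_in_C_units_def)

lemma mulop_ind:
  assumes "clopen_units Y" "\<And>x. x \<in> units \<Longrightarrow> p x = (if x \<in> Y then 1 else 0)"
  shows "mulop G p = char_op Y"
proof -
  have "diag p = (\<lambda>g. if g \<in> Y then 1 else 0)"
    using assms clopen_unitsD(1)[OF assms(1)] by (auto simp: diag_def fun_eq_iff)
  then show ?thesis
    by (simp add: mulop_eq_lreg char_op_def)
qed

lemma corner_eq:
  assumes Y: "clopen_units Y"
  shows "corner (char_op Y) (Cred G) = corner_alg Y"
proof -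
  have eY: "char_op Y \<in> diag_alg Y" "char_op Y \<in> Cred G"
    using char_op_diag_alg[OF Y subset_refl] by (auto simp: diag_alg_def)
  have k: "kern (char_op Y \<circ> T \<circ> char_op Y) g = (if g \<in> restr Y then kern T g else 0)" if "T \<in> Cred G" for T g
    using kern_compose_diag(1)[OF Y eY(1) Cred_bounded[OF Cred_compose[OF eY(2) that]], of g]
      kern_compose_diag(2)[OF Y eY(1) Cred_bounded[OF that], of g]
    by (auto simp: restr_iff)
  show ?thesis
  proof
    show "corner (char_op Y) (Cred G) \<subseteq> corner_alg Y"
      using k Cred_compose eY(2) unfolding corner_def corner_alg_def
      by (auto simp del: comp_apply split: if_splits)
    show "corner_alg Y \<subseteq> corner (char_op Y) (Cred G)"
    proof
      fix T
      assume T: "T \<in> corner_alg Y"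
      then have TC: "T \<in> Cred G"
        by (simp add: corner_alg_def)
      have "T = char_op Y \<circ> T \<circ> char_op Y"
      proof (rule conv_op_eqI)
        show "conv_op T" "conv_op (char_op Y \<circ> T \<circ> char_op Y)"
          using TC eY(2) by (auto intro!: Cred_conv_op Cred_compose)
        show "kern T g = kern (char_op Y \<circ> T \<circ> char_op Y) g" for g
          unfolding k[OF TC] using T by (auto simp: corner_alg_def)
      qed
      then show "T \<in> corner (char_op Y) (Cred G)"
        using TC unfolding corner_def by (rule image_eqI)
    qed
  qed
qed

lemma diag_eq:
  assumes Y: "clopen_units Y"
  shows "{char_op Y \<circ> mulop G f | f. f \<in> C_units G} = diag_alg Y"
proof
  have eY: "char_op Y \<in> diag_alg Y" "char_op Y \<in> Cred G"
    using char_op_diag_alg[OF Y subset_refl] by (auto simp: diag_alg_def)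
  have k: "kern (char_op Y \<circ> mulop G f) g = (if g \<in> Y then f g else 0)" if "f \<in> C_units G" for f g
    using kern_compose_diag(2)[OF Y eY(1) Cred_bounded[OF mulop_Cred[OF that]], of g]
      clopen_unitsD(1)[OF Y] by (auto simp: diag_def)
  show "{char_op Y \<circ> mulop G f | f. f \<in> C_units G} \<subseteq> diag_alg Y"
    using k Cred_compose eY(2) mulop_Cred by (auto simp: diag_alg_def simp del: comp_apply split: if_splits)
  show "diag_alg Y \<subseteq> {char_op Y \<circ> mulop G f | f. f \<in> C_units G}"
  proof
    fix T
    assume T: "T \<in> diag_alg Y"
    note m = diag_alg_mulop[OF Y T]
    have "T = char_op Y \<circ> mulop G (kern T)"
    proof (rule conv_op_eqI)
      show "conv_op T" "conv_op (char_op Y \<circ> mulop G (kern T))"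
        using T eY(2) mulop_Cred[OF m(2)] by (auto intro!: Cred_conv_op Cred_compose simp: diag_alg_def)
      show "kern T g = kern (char_op Y \<circ> mulop G (kern T)) g" for g
        unfolding k[OF m(2)] using T by (auto simp: diag_alg_def)
    qed
    then show "T \<in> {char_op Y \<circ> mulop G f | f. f \<in> C_units G}"
      using m(2) by blast
  qed
qed

text \<open>If the orbit of \<open>x\<close> misses \<open>Y\<close>, the operators with kernel
  vanishing on arrows over that orbit form a closed ideal containing the projection. It is proper,
  because the identity has kernel 1 at \<open>x\<close>.\<close>

lemma full_imp_G_full:
  assumes Y: "clopen_units Y" and full: "full_in (char_op Y) (Cred G)"
  shows "G_full G Y"
  unfolding G_full_def
proof (rule ballI, rule ccontr)
  fix x
  assume x: "x \<in> units" and no: "\<nexists>g. r g = x \<and> s g \<in> Y"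
  define orb where "orb = {y. \<exists>k. r k = x \<and> s k = y}"
  have orb: "s g \<in> orb \<longleftrightarrow> r g \<in> orb" for g
  proof
    assume "s g \<in> orb"
    then obtain k where "r k = x" "s k = s g"
      by (auto simp: orb_def)
    then show "r g \<in> orb"
      unfolding orb_def by (intro CollectI exI[of _ "k \<odot> iv g"]) simp
  next
    assume "r g \<in> orb"
    then obtain k where "r k = x" "s k = r g"
      by (auto simp: orb_def)
    then show "s g \<in> orb"
      unfolding orb_def by (intro CollectI exI[of _ "k \<odot> g"]) simp
  qed
  define I where "I = {T \<in> Cred G. \<forall>g. s g \<in> orb \<longrightarrow> kern T g = 0}"
  have "closed_ideal (Cred G) I"
    unfolding closed_ideal_def
  proof (intro conjI ballI allI impI)
    show "I \<subseteq> Cred G"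
      by (auto simp: I_def)
    have "op_zero = op_scale 0 (char_op {})"
      by (simp add: op_zero_def op_scale_def)
    moreover have "op_scale 0 (char_op {}) \<in> I"
      unfolding I_def using Cred_scale[OF char_op_Cred[OF cob_empty]] by simp
    ultimately show "op_zero \<in> I"
      by simp
    show "op_add T S \<in> I" if "T \<in> I" "S \<in> I" for T S
      using that Cred_add by (auto simp: I_def)
    show "op_scale c T \<in> I" if "T \<in> I" for T c
      using that Cred_scale by (auto simp: I_def)
  next
    fix T a
    assume T: "T \<in> I" and a: "a \<in> Cred G"
    have TC: "T \<in> Cred G" "\<And>g. s g \<in> orb \<Longrightarrow> kern T g = 0"
      using T by (auto simp: I_def)
    have "kern (a \<circ> T) g = 0" if "s g \<in> orb" for g
      using TC that by (intro kern_compose_eq_0 Cred_conv_op a) auto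
    then show "a \<circ> T \<in> I"
      using Cred_compose[OF a TC(1)] by (simp add: I_def)
    \<comment> \<open>Here \<open>T\<close> is evaluated at \<open>g \<odot> iv b\<close>, whose
      source is the range of \<open>b\<close>. It lies in the orbit because the source of
      \<open>b\<close> does.\<close>
    have "kern (T \<circ> a) g = 0" if "s g \<in> orb" for g
      using TC(2) orb that by (intro kern_compose_eq_0 Cred_conv_op a TC(1)) (metis ax(7) ax(8) ax_mult(2))
    then show "T \<circ> a \<in> I"
      using Cred_compose[OF TC(1) a] by (simp add: I_def)
  next
    fix T
    assume T: "T \<in> Cred G" and appr: "\<forall>\<epsilon>>0. \<exists>S\<in>I. opnorm (op_diff T S) < \<epsilon>"
    have "kern T g = 0" if g: "s g \<in> orb" for g
    proof -
      have "cmod (kern T g) \<le> 0 + \<epsilon>" if \<epsilon>: "\<epsilon> > 0" for \<epsilon>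
      proof -
        obtain S where S: "S \<in> I" "opnorm (op_diff T S) < \<epsilon>"
          using appr \<epsilon> by blast
        then have "bounded_op (op_diff T S)"
          by (intro bounded_op_ops Cred_bounded T) (simp add: I_def)
        then show ?thesis
          using cmod_kern_le[of "op_diff T S" g] S g by (simp add: I_def)
      qed
      then have "cmod (kern T g) \<le> 0"
        by (rule field_le_epsilon)
      then show ?thesis
        by simp
    qed
    then show "T \<in> I"
      using T by (simp add: I_def)
  qed
  moreover have "char_op Y \<in> I"
  proof -
    have "s g \<notin> orb" if "g \<in> Y" for g
    proof
      assume "s g \<in> orb"
      then obtain k where k: "r k = x" "s k = s g"
        unfolding orb_def by blast
      have "s g = g"
        using that clopen_unitsD(1)[OF Y] by (intro unitsD(2)) blast
      then show False
        using k no that by metis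
    qed
    then show ?thesis
      using char_op_Cred[OF clopen_unitsD(5)[OF Y]] by (auto simp: I_def)
  qed
  ultimately have "I = Cred G"
    using full by (simp add: full_in_def)
  then have "kern (char_op units) x = 0" if "s x \<in> orb"
    using char_op_Cred[OF cob_units_full] that unfolding I_def by blast
  moreover have "s x \<in> orb"
    unfolding orb_def using x by (intro CollectI exI[of _ x]) simp
  ultimately show False
    using x by simp
qed

text \<open>A bisection \<open>U\<close> with sources in \<open>Y\<close> conjugates the projection
  of \<open>Y\<close> to that of the range of \<open>U\<close>. Such ranges cover the compact unit
  space, and a finite union of them with \<open>Y\<close> gives the identity.\<close>

lemma G_full_imp_full:
  assumes Y: "clopen_units Y" and full: "G_full G Y"
  shows "full_in (char_op Y) (Cred G)"
  unfolding full_in_def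
proof (intro allI impI)
  fix I
  assume I: "closed_ideal (Cred G) I" and eY: "char_op Y \<in> I"
  have mult: "a \<circ> T \<in> I" "T \<circ> a \<in> I" if "T \<in> I" "a \<in> Cred G" for T a
    using I that unfolding closed_ideal_def by auto
  define \<W> where "\<W> = {W. clopen_units W \<and> char_op W \<in> I}"
  have sub: "V \<in> \<W>" if "W \<in> \<W>" "clopen_units V" "V \<subseteq> W" for V W
  proof -
    have VW: "V \<subseteq> units" "W \<subseteq> units"
      using that clopen_unitsD(1) by (auto simp: \<W>_def)
    then have "setmul V W = V"
      using that(3) by (intro setmul_units) (auto dest!: subsetD)
    then have "char_op V \<circ> char_op W = char_op V"
      using char_op_compose that clopen_unitsD(5) by (auto simp: \<W>_def)
    then show ?thesis
      using mult(1)[of "char_op W" "char_op V"] that char_op_Cred clopen_unitsD(5) by (auto simp: \<W>_def)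
  qed
  \<comment> \<open>Indicators add up to the indicator of the union only for disjoint sets, hence
    the passage to \<open>V - W\<close>, which stays in the family by \<open>sub\<close>.\<close>
  have un: "V \<union> W \<in> \<W>" if VW: "V \<in> \<W>" "W \<in> \<W>" for V W
  proof -
    have c: "clopen_units V" "clopen_units W" "char_op V \<in> I" "char_op W \<in> I"
      using VW by (auto simp: \<W>_def)
    have cd: "clopen_units (V - W)" "clopen_units (V \<union> W)"
      using c(1,2) unfolding clopen_units_def
      by (auto simp: compact_imp_closed open_Diff compact_diff compact_Un open_Un)
    then have "char_op (V - W) \<in> I"
      using sub[OF VW(1), of "V - W"] by (auto simp: \<W>_def)
    then have add: "op_add (char_op (V - W)) (char_op W) \<in> I"
      using I c(4) by (simp add: closed_ideal_def)
    have "op_add (char_op (V - W)) (char_op W) = char_op (V \<union> W)"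
      using cd c by (intro conv_op_eqI conv_op_ops Cred_conv_op char_op_Cred clopen_unitsD) auto
    then show ?thesis
      using add cd by (simp add: \<W>_def)
  qed
  have nbhd: "\<exists>W\<in>\<W>. x \<in> W" if "x \<in> units" for x
  proof -
    obtain g where g: "r g = x" "s g \<in> Y"
      using full \<open>x \<in> units\<close> unfolding G_full_def by blast
    obtain U where U: "cob U" "g \<in> U" "U \<subseteq> s -` Y"
      using cob_basis[of "s -` Y" g] g open_vimage(2)[OF clopen_unitsD(2)[OF Y]] by blast
    have "setmul (setmul U Y) (iv ` U) = r ` U"
    proof -
      have "s ` U \<subseteq> Y"
        using U(3) by auto
      then show ?thesis
        using setmul_units[OF clopen_unitsD(1)[OF Y]] setmul_iv_right[OF cobD(5)[OF U(1)]] by simp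
    qed
    then have "char_op U \<circ> char_op Y \<circ> char_op (iv ` U) = char_op (r ` U)"
      using U(1) clopen_unitsD(5)[OF Y] by (simp add: char_op_compose cob_setmul cob_iv)
    moreover have "char_op U \<circ> char_op Y \<circ> char_op (iv ` U) \<in> I"
      using U(1) eY by (intro mult char_op_Cred cob_iv)
    moreover have "clopen_units (r ` U)"
      using cob_r_image(1)[OF U(1)] by (auto simp: clopen_units_def cobD)
    ultimately have "r ` U \<in> \<W>"
      by (simp add: \<W>_def)
    then show ?thesis
      using g(1) U(2) by blast
  qed
  have "units \<subseteq> \<Union>\<W>"
    using nbhd by blast
  moreover have "\<And>W. W \<in> \<W> \<Longrightarrow> open W"
    by (simp add: \<W>_def clopen_unitsD)
  ultimately obtain \<F> where \<F>: "\<F> \<subseteq> \<W>" "finite \<F>" "units \<subseteq> \<Union>\<F>"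
    using compactE[OF compact_units] by metis
  \<comment> \<open>With \<open>Y\<close> inserted the finite family is non-empty, as the induction
    on unions needs.\<close>
  have "insert Y \<F> \<subseteq> \<W>"
    using \<F> eY Y by (simp add: \<W>_def)
  moreover have "\<Union>\<F>' \<in> \<W>" if "finite \<F>'" "\<F>' \<noteq> {}" "\<F>' \<subseteq> \<W>" for \<F>'
    using that by (induction \<F>' rule: finite_ne_induct) (auto intro: un)
  ultimately have "\<Union>(insert Y \<F>) \<in> \<W>"
    using \<F>(2) by (meson finite_insert insert_not_empty)
  moreover from this have "\<Union>(insert Y \<F>) \<subseteq> units"
    using clopen_unitsD(1)[of "\<Union>(insert Y \<F>)"] by (simp add: \<W>_def)
  then have "\<Union>(insert Y \<F>) = units"
    using \<F>(3) by auto
  ultimately have "char_op units \<in> I"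
    by (simp add: \<W>_def)
  moreover have "char_op units = mulop G (\<lambda>_. 1)"
    using mulop_ind[of units "\<lambda>_. 1"] compact_units by (simp add: clopen_units_def)
  ultimately have "T \<in> I" if "T \<in> Cred G" for T
    using mult(1)[of "char_op units" T] compose_mulop_one[OF Cred_bounded[OF that]] that by simp
  then show "I = Cred G"
    using I by (auto simp: closed_ideal_def)
qed

end

section \<open>Normalizers of the diagonal\<close>

context ample
begin

definition supp :: "'g op \<Rightarrow> 'g set" where
  "supp T = {g. kern T g \<noteq> 0}"

lemma supp_char_op [simp]: "supp (char_op U) = U"
  by (auto simp: supp_def)

lemma corner_alg_iff: "T \<in> corner_alg Y \<longleftrightarrow> T \<in> Cred G \<and> supp T \<subseteq> restr Y"
  by (auto simp: corner_alg_def supp_def)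

lemma diag_alg_iff: "T \<in> diag_alg Y \<longleftrightarrow> T \<in> Cred G \<and> supp T \<subseteq> Y"
  by (auto simp: diag_alg_def supp_def)

lemma open_supp:
  assumes "T \<in> Cred G"
  shows "open (supp T)"
proof -
  have "supp T = kern T -` (- {0})"
    by (auto simp: supp_def)
  then show ?thesis
    using Topological_Spaces.open_vimage[OF _ continuous_kern[OF assms], of "- {0}"] by (simp add: open_Compl)
qed

lemma supp_compose_diag:
  assumes "clopen_units Y" "d \<in> diag_alg Y" "T \<in> Cred G"
  shows "supp (T \<circ> d) \<subseteq> supp T"
  using kern_compose_diag(1)[OF assms(1,2) Cred_bounded[OF assms(3)]] by (auto simp: supp_def)

text \<open>With a bisection on the left each convolution sum has at most one term, so no
  cancellation can shrink the support of the product.\<close>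

lemma supp_compose_cob:
  assumes v: "v \<in> Cred G" "cob (supp v)" and w: "w \<in> Cred G"
  shows "supp (v \<circ> w) = setmul (supp v) (supp w)"
proof (rule set_eqI)
  fix g
  have "lreg G (kern v) = v"
    by (intro conv_op_eq_lreg Cred_conv_op v)
  note k = kern_compose_bisection[OF Cred_conv_op[OF w], of "kern v", unfolded this,
      OF Cred_bounded[OF v(1)] cobD(4)[OF v(2)]]
  show "g \<in> supp (v \<circ> w) \<longleftrightarrow> g \<in> setmul (supp v) (supp w)"
  proof (cases "r g \<in> r ` supp v")
    case True
    then have "rsec (supp v) (r g) \<in> supp v" "r (rsec (supp v) (r g)) = r g"
      using rsec[OF v(2)] by auto
    then show ?thesis
      using k(1)[of "rsec (supp v) (r g)" g] True by (simp add: setmul_iff[OF v(2)]) (simp add: supp_def)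
  next
    case False
    then show ?thesis
      using k(2)[of g] by (simp add: setmul_iff[OF v(2)]) (simp add: supp_def)
  qed
qed

text \<open>Over a bisection each source belongs to one arrow, so the quotient of the two kernels is
  a function of the source. It is continuous because the section \<open>ssec\<close> is, and it is
  extended by zero over the clopen set of sources.\<close>

lemma cob_factor:
  assumes Y: "clopen_units Y" and T: "T \<in> Cred G" "cob (supp T)" "supp T \<subseteq> restr Y"
    and T': "T' \<in> Cred G" "supp T' \<subseteq> supp T"
  obtains d where "d \<in> diag_alg Y" "T' = T \<circ> d"
proof -
  let ?S = "supp T"
  define q where "q x = (if x \<in> s ` ?S then kern T' (ssec ?S x) / kern T (ssec ?S x) else 0)" for x
  note ss = ssec[OF T(2)]
  have c: "continuous_on UNIV q"
    unfolding q_def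
  proof (rule continuous_on_clopen_extend)
    show "open (s ` ?S)" "closed (s ` ?S)"
      using cob_r_image(2)[OF T(2)] by (auto simp: cobD)
    have "continuous_on (s ` ?S) (\<lambda>x. kern X (ssec ?S x))" if "X \<in> Cred G" for X
      by (rule continuous_on_compose2[OF continuous_kern[OF that] ss(4)]) simp
    moreover have "kern T (ssec ?S x) \<noteq> 0" if "x \<in> s ` ?S" for x
      using ss(2)[OF that] by (simp add: supp_def)
    ultimately show "continuous_on (s ` ?S) (\<lambda>x. kern T' (ssec ?S x) / kern T (ssec ?S x))"
      using T T' by (intro continuous_on_divide) auto
  qed
  then have q: "q \<in> C_units G"
    by (auto simp: C_units_def elim: continuous_on_subset)
  have d: "mulop G q \<in> diag_alg Y"
  proof (rule mulop_diag_alg[OF Y q])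
    show "x \<in> Y" if "q x \<noteq> 0" for x
      using that T(3) by (auto simp: q_def restr_iff split: if_splits)
  qed
  have "T' = T \<circ> mulop G q"
  proof (rule conv_op_eqI)
    show "conv_op T'" "conv_op (T \<circ> mulop G q)"
      using T T' q by (auto intro!: Cred_conv_op Cred_compose mulop_Cred)
    fix g
    have "kern (T \<circ> mulop G q) g = kern T g * q (s g)"
      by (rule kern_compose_mulop[OF Cred_bounded[OF T(1)]])
    also have "\<dots> = kern T' g"
    proof (cases "g \<in> ?S")
      case True
      then have "ssec ?S (s g) = g" "kern T g \<noteq> 0"
        using ss(1) by (auto simp: supp_def)
      then show ?thesis
        using True by (simp add: q_def)
    next
      case False
      then show ?thesis
        using T'(2) by (auto simp: supp_def)
    qed
    finally show "kern T' g = kern (T \<circ> mulop G q) g"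
      by simp
  qed
  then show thesis
    using that d by blast
qed

text \<open>A multiplicative stand-in for a partial isometry normalizing the diagonal:
  \<open>v'\<close> plays the adjoint but is only asked to be a generalised inverse. A
  multiplicative bijection that matches corners and diagonals carries such pairs to such
  pairs.\<close>

definition normalizer_pair :: "'g set \<Rightarrow> 'g op \<Rightarrow> 'g op \<Rightarrow> bool" where
  "normalizer_pair Y v v' \<longleftrightarrow> v \<in> corner_alg Y \<and> v' \<in> corner_alg Y \<and> v \<circ> v' \<circ> v = v
     \<and> v \<circ> v' \<in> diag_alg Y \<and> v' \<circ> v \<in> diag_alg Y
     \<and> (\<forall>d \<in> diag_alg Y. v' \<circ> d \<circ> v \<in> diag_alg Y \<and> v \<circ> d \<circ> v' \<in> diag_alg Y)"

lemma separate_units: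
  assumes Y: "clopen_units Y" and "x \<in> Y" "y \<noteq> x"
  obtains C where "clopen_units C" "C \<subseteq> Y" "x \<in> C" "y \<notin> C"
proof -
  have "x \<in> units" "open (Y \<inter> - {y})" "x \<in> Y \<inter> - {y}"
    using assms clopen_unitsD[OF Y] by (auto intro!: open_Int simp: open_Compl)
  then obtain C where "open C" "compact C" "x \<in> C" "C \<subseteq> Y \<inter> - {y}" "C \<subseteq> units"
    by (rule clopen_unit_nbhd)
  then show thesis
    using that[of C] by (auto simp: clopen_units_def)
qed

text \<open>
  Put \<open>d' = v' d v\<close>, which is diagonal. Since \<open>v v'\<close> commutes with \<open>d\<close>, one has \<open>d v = v d'\<close>, that is
  \<open>d(r g) = d'(s g)\<close> on the support of \<open>v\<close>; and the diagonal elements \<open>d\<close> separate units.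
\<close>

lemma normalizer_range_eq:
  assumes Y: "clopen_units Y" and n: "normalizer_pair Y v v'"
    and g: "g \<in> supp v" "h \<in> supp v" "s g = s h"
  shows "r g = r h"
proof (rule ccontr)
  assume ne: "r g \<noteq> r h"
  have v: "v \<in> corner_alg Y" "v' \<in> corner_alg Y" "v \<circ> v' \<circ> v = v" "v \<circ> v' \<in> diag_alg Y"
    "\<And>d. d \<in> diag_alg Y \<Longrightarrow> v' \<circ> d \<circ> v \<in> diag_alg Y"
    using n by (auto simp: normalizer_pair_def)
  have bv: "bounded_op v"
    using v(1) by (auto simp: corner_alg_iff Cred_bounded)
  have "r g \<in> Y"
    using g v(1) by (auto simp: corner_alg_iff restr_iff)
  then obtain C where C: "clopen_units C" "C \<subseteq> Y" "r g \<in> C" "r h \<notin> C"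
    using separate_units[OF Y _ ne[symmetric]] by metis
  have d: "char_op C \<in> diag_alg Y"
    by (rule char_op_diag_alg[OF C(1,2)])
  let ?d' = "v' \<circ> char_op C \<circ> v"
  have "char_op C \<circ> v = char_op C \<circ> (v \<circ> v' \<circ> v)"
    by (simp only: v(3))
  also have "\<dots> = (char_op C \<circ> (v \<circ> v')) \<circ> v"
    by (simp only: o_assoc)
  also have "\<dots> = ((v \<circ> v') \<circ> char_op C) \<circ> v"
    by (simp only: diag_alg_commute[OF Y d v(4)])
  also have "\<dots> = v \<circ> ?d'"
    by (simp only: o_assoc)
  finally have "kern (char_op C \<circ> v) k = kern (v \<circ> ?d') k" for k
    by simp
  then have eq: "kern (char_op C) (r k) * kern v k = kern v k * kern ?d' (s k)" for k
    using kern_compose_diag(2)[OF Y d bv] kern_compose_diag(1)[OF Y v(5)[OF d] bv] by metis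
  then have "kern (char_op C) (r g) = kern ?d' (s g)" "kern (char_op C) (r h) = kern ?d' (s h)"
    using g eq[of g] eq[of h] by (auto simp: supp_def mult.commute simp del: kern_char_op)
  then show False
    using C g(3) by simp
qed

text \<open>The mirror image of the previous argument: with \<open>d' = v d v'\<close>, and
  \<open>v' v\<close> commuting with \<open>d\<close>, one gets \<open>v d = d' v\<close>.\<close>

lemma normalizer_source_eq:
  assumes Y: "clopen_units Y" and n: "normalizer_pair Y v v'"
    and g: "g \<in> supp v" "h \<in> supp v" "r g = r h"
  shows "s g = s h"
proof (rule ccontr)
  assume ne: "s g \<noteq> s h"
  have v: "v \<in> corner_alg Y" "v' \<in> corner_alg Y" "v \<circ> v' \<circ> v = v" "v' \<circ> v \<in> diag_alg Y"
    "\<And>d. d \<in> diag_alg Y \<Longrightarrow> v \<circ> d \<circ> v' \<in> diag_alg Y"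
    using n by (auto simp: normalizer_pair_def)
  have bv: "bounded_op v"
    using v(1) by (auto simp: corner_alg_iff Cred_bounded)
  have "s g \<in> Y"
    using g v(1) by (auto simp: corner_alg_iff restr_iff)
  then obtain C where C: "clopen_units C" "C \<subseteq> Y" "s g \<in> C" "s h \<notin> C"
    using separate_units[OF Y _ ne[symmetric]] by metis
  have d: "char_op C \<in> diag_alg Y"
    by (rule char_op_diag_alg[OF C(1,2)])
  let ?d' = "v \<circ> char_op C \<circ> v'"
  have "v \<circ> char_op C = (v \<circ> v' \<circ> v) \<circ> char_op C"
    by (simp only: v(3))
  also have "\<dots> = v \<circ> ((v' \<circ> v) \<circ> char_op C)"
    by (simp only: o_assoc)
  also have "\<dots> = v \<circ> (char_op C \<circ> (v' \<circ> v))"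
    by (simp only: diag_alg_commute[OF Y d v(4)])
  also have "\<dots> = ?d' \<circ> v"
    by (simp only: o_assoc)
  finally have "kern (v \<circ> char_op C) k = kern (?d' \<circ> v) k" for k
    by simp
  then have eq: "kern v k * kern (char_op C) (s k) = kern ?d' (r k) * kern v k" for k
    using kern_compose_diag(1)[OF Y d bv] kern_compose_diag(2)[OF Y v(5)[OF d] bv] by metis
  then have "kern (char_op C) (s g) = kern ?d' (r g)" "kern (char_op C) (s h) = kern ?d' (r h)"
    using g eq[of g] eq[of h] by (auto simp: supp_def mult.commute simp del: kern_char_op)
  then show False
    using C g(3) by simp
qed

text \<open>The point where essential principality acts: an open set of isotropy lies in the
  interior of the isotropy.\<close>

lemma isotropy_open_units:
  assumes "essentially_principal G" "open A" "\<And>g. g \<in> A \<Longrightarrow> r g = s g"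
  shows "A \<subseteq> units"
  using assms interior_maximal[of A "{g. r g = s g}"] unfolding essentially_principal_def by auto

text \<open>The open set \<open>S S\<inverse>\<close> consists of isotropy, hence of units.\<close>

lemma inj_on_source:
  assumes ep: "essentially_principal G" and S: "open S"
    and rs: "\<And>g h. g \<in> S \<Longrightarrow> h \<in> S \<Longrightarrow> s g = s h \<Longrightarrow> r g = r h"
  shows "inj_on s S"
proof (rule inj_onI)
  fix g h
  assume gh: "g \<in> S" "h \<in> S" "s g = s h"
  obtain U V where U: "cob U" "g \<in> U" "U \<subseteq> S" and V: "cob V" "h \<in> V" "V \<subseteq> S"
    using cob_basis[OF S gh(1)] cob_basis[OF S gh(2)] by metis
  have "setmul U (iv ` V) \<subseteq> units"
  proof (rule isotropy_open_units[OF ep])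
    show "open (setmul U (iv ` V))"
      using U V by (intro open_setmul) (auto simp: cob_iv cobD)
    show "r x = s x" if x: "x \<in> setmul U (iv ` V)" for x
    proof -
      obtain a b where "a \<in> U" "b \<in> V" "s a = s b" "x = a \<odot> iv b"
        using x by (auto simp: setmul_def)
      then show ?thesis
        using rs[of a b] U V by auto
    qed
  qed
  moreover have "g \<odot> iv h \<in> setmul U (iv ` V)"
    using U V gh by (intro setmulI) auto
  ultimately show "g = h"
    using eq_of_mult_iv_unit gh(3) by blast
qed

text \<open>Injectivity of source and range comes from \<open>inj_on_source\<close>, applied to the
  support and to its inverse. Compactness comes from the idempotent \<open>v' v\<close>: its support
  \<open>W\<close> is a compact set of units, and the source map is a homeomorphism from the support
  of \<open>v\<close> onto it.\<close>

lemma normalizer_cob: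
  assumes ep: "essentially_principal G" and Y: "clopen_units Y" and n: "normalizer_pair Y v v'"
  shows "cob (supp v)" "supp v \<subseteq> restr Y"
proof -
  let ?S = "supp v"
  have v: "v \<in> corner_alg Y" "v' \<in> corner_alg Y" "v \<circ> v' \<circ> v = v" "v' \<circ> v \<in> diag_alg Y"
    using n by (auto simp: normalizer_pair_def)
  have vC: "v \<in> Cred G" "v' \<in> Cred G"
    using v by (auto simp: corner_alg_iff)
  show "?S \<subseteq> restr Y"
    using v(1) by (simp add: corner_alg_iff)
  have op: "open ?S"
    using vC(1) by (rule open_supp)
  have inj_s: "inj_on s ?S"
    using inj_on_source[OF ep op] normalizer_range_eq[OF Y n] by blast
  have "open (iv ` ?S)"
    using open_vimage(3)[OF op] by (simp add: iv_image)
  then have "inj_on s (iv ` ?S)"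
  proof (rule inj_on_source[OF ep])
    fix g h
    assume "g \<in> iv ` ?S" "h \<in> iv ` ?S" "s g = s h"
    then obtain a b where "a \<in> ?S" "b \<in> ?S" "g = iv a" "h = iv b" "r a = r b"
      by auto
    then show "r g = r h"
      using normalizer_source_eq[OF Y n, of a b] by simp
  qed
  then have inj_r: "inj_on r ?S"
    by (auto simp: inj_on_def) (metis iv_iv)
  let ?\<epsilon> = "v' \<circ> v"
  define W where "W = supp ?\<epsilon>"
  have b\<epsilon>: "bounded_op ?\<epsilon>"
    using vC by (intro bounded_op_compose Cred_bounded)
  have WY: "W \<subseteq> Y"
    using v(4) by (simp add: W_def diag_alg_iff)
  \<comment> \<open>A diagonal idempotent has kernel values 0 and 1, so its support is closed as
    well as open.\<close>
  have "?\<epsilon> \<circ> ?\<epsilon> = ?\<epsilon>"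
    using v(3) by (metis o_assoc)
  then have "kern ?\<epsilon> x * kern ?\<epsilon> (s x) = kern ?\<epsilon> x" for x
    using kern_compose_diag(1)[OF Y v(4) b\<epsilon>, of x] by simp
  then have idem: "kern ?\<epsilon> (s x) = 1" if "x \<in> W" for x
    using that by (auto simp: W_def supp_def)
  have sx: "s x = x" if "x \<in> W" for x
    using that WY clopen_unitsD(1)[OF Y] by auto
  have "W = Y \<inter> kern ?\<epsilon> -` {1}"
    using idem sx WY by (force simp: W_def supp_def)
  moreover have "closed (kern ?\<epsilon> -` {1})"
    using Topological_Spaces.closed_vimage[OF _ continuous_kern[OF Cred_compose[OF vC(2,1)]], of "{1}"] by simp
  ultimately have cW: "compact W"
    using clopen_unitsD(3)[OF Y] by (simp add: compact_Int_closed)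
  \<comment> \<open>From \<open>v = v (v' v)\<close>, sources of arrows in the support of
    \<open>v\<close> lie in \<open>W\<close>. Over any other unit the kernel of \<open>v\<close>
    vanishes, and with it that of \<open>v' v\<close>.\<close>
  have "s ` ?S = W"
  proof
    show "s ` ?S \<subseteq> W"
    proof
      fix x
      assume "x \<in> s ` ?S"
      then obtain g where g: "g \<in> ?S" "x = s g"
        by auto
      have "kern (v \<circ> ?\<epsilon>) g = kern v g * kern ?\<epsilon> (s g)"
        by (rule kern_compose_diag(1)[OF Y v(4) Cred_bounded[OF vC(1)]])
      moreover have "v \<circ> ?\<epsilon> = v"
        using v(3) by (simp only: o_assoc)
      ultimately show "x \<in> W"
        using g by (auto simp: W_def supp_def)
    qed
    show "W \<subseteq> s ` ?S"
    proof
      fix x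
      assume x: "x \<in> W"
      show "x \<in> s ` ?S"
      proof (rule ccontr)
        assume no: "x \<notin> s ` ?S"
        have "kern v d = 0" if "s d = s x" for d
          using no that sx[OF x] by (auto simp: supp_def)
        then have "kern ?\<epsilon> x = 0"
          using vC by (intro kern_compose_eq_0 Cred_conv_op) auto
        then show False
          using x by (simp add: W_def supp_def)
      qed
    qed
  qed
  \<comment> \<open>The source map is open, so its inverse from \<open>W\<close> onto the support is
    continuous and carries compactness over.\<close>
  moreover have "openin (top_of_set (s ` ?S)) (s ` U)" if "openin (top_of_set ?S) U" for U
  proof -
    have "open (s ` U)"
      using that op openin_open_trans open_s_image by blast
    moreover have "s ` U \<subseteq> s ` ?S"
      using openin_imp_subset[OF that] by blast
    ultimately show ?thesis
      using open_openin_trans[OF open_s_image[OF op]] by blast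
  qed
  moreover have "continuous_on ?S s"
    using cont_structure(2) continuous_on_subset by blast
  ultimately have "continuous_on W (the_inv_into ?S s)"
    using continuous_on_inverse_open_map[of ?S s W "the_inv_into ?S s"] the_inv_into_f_f[OF inj_s] by metis
  then have "compact (the_inv_into ?S s ` W)"
    using cW by (rule compact_continuous_image)
  moreover have "the_inv_into ?S s ` W = ?S"
    using \<open>s ` ?S = W\<close> inj_s by (metis the_inv_into_onto)
  ultimately have "compact ?S"
    by simp
  then show "cob ?S"
    using op inj_s inj_r by (simp add: cob_def)
qed

end

section \<open>Recovering the groupoid from its bisections\<close>

context ample
begin

definition bisections :: "'g set \<Rightarrow> 'g set set" where
  "bisections Y = {U. cob U \<and> U \<subseteq> restr Y}"

lemma bisections_empty [simp]: "{} \<in> bisections Y"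
  by (simp add: bisections_def)

lemma bisections_ops:
  assumes "U \<in> bisections Y" "V \<in> bisections Y"
  shows "U \<inter> V \<in> bisections Y" "U - V \<in> bisections Y" "setmul U V \<in> bisections Y"
  using assms cob_Int_clopen[of U V] cob_Diff[of U V] cob_setmul[of U V] setmul_restr[of U Y V]
  by (auto simp: bisections_def cobD)

lemma bisections_nbhd:
  assumes "clopen_units Y" "open A" "g \<in> A" "g \<in> restr Y"
  obtains U where "U \<in> bisections Y" "g \<in> U" "U \<subseteq> A"
  using cob_basis[of "A \<inter> restr Y" g] assms clopen_restr(1)[OF assms(1)]
  unfolding bisections_def by (metis (no_types, lifting) IntI le_inf_iff mem_Collect_eq open_Int)

end

locale ample_pair = A: ample G1 + B: ample G2
  for G1 :: "('g::t2_space) groupoid" and G2 :: "('h::t2_space) groupoid"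
begin

text \<open>Only the order is recorded: it already determines points and topology. The inverse is
  named, so the notion is symmetric and the inverse point map comes from exchanging the two
  groupoids.\<close>

definition bisection_iso :: "'g set \<Rightarrow> 'h set \<Rightarrow> ('g set \<Rightarrow> 'h set) \<Rightarrow> ('h set \<Rightarrow> 'g set) \<Rightarrow> bool" where
  "bisection_iso Y1 Y2 \<Phi> \<Psi> \<longleftrightarrow> A.clopen_units Y1 \<and> B.clopen_units Y2
     \<and> (\<forall>U \<in> A.bisections Y1. \<Phi> U \<in> B.bisections Y2 \<and> \<Psi> (\<Phi> U) = U)
     \<and> (\<forall>V \<in> B.bisections Y2. \<Psi> V \<in> A.bisections Y1 \<and> \<Phi> (\<Psi> V) = V)
     \<and> (\<forall>U \<in> A.bisections Y1. \<forall>U' \<in> A.bisections Y1. U \<subseteq> U' \<longrightarrow> \<Phi> U \<subseteq> \<Phi> U')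
     \<and> (\<forall>V \<in> B.bisections Y2. \<forall>V' \<in> B.bisections Y2. V \<subseteq> V' \<longrightarrow> \<Psi> V \<subseteq> \<Psi> V')"

lemma bisection_isoD:
  assumes "bisection_iso Y1 Y2 \<Phi> \<Psi>"
  shows "A.clopen_units Y1" "B.clopen_units Y2"
    and "U \<in> A.bisections Y1 \<Longrightarrow> \<Phi> U \<in> B.bisections Y2" "U \<in> A.bisections Y1 \<Longrightarrow> \<Psi> (\<Phi> U) = U"
    and "V \<in> B.bisections Y2 \<Longrightarrow> \<Psi> V \<in> A.bisections Y1" "V \<in> B.bisections Y2 \<Longrightarrow> \<Phi> (\<Psi> V) = V"
    and "U \<in> A.bisections Y1 \<Longrightarrow> U' \<in> A.bisections Y1 \<Longrightarrow> U \<subseteq> U' \<Longrightarrow> \<Phi> U \<subseteq> \<Phi> U'"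
    and "V \<in> B.bisections Y2 \<Longrightarrow> V' \<in> B.bisections Y2 \<Longrightarrow> V \<subseteq> V' \<Longrightarrow> \<Psi> V \<subseteq> \<Psi> V'"
  using assms by (simp_all add: bisection_iso_def)

lemma bisection_iso_empty:
  assumes "bisection_iso Y1 Y2 \<Phi> \<Psi>"
  shows "\<Phi> {} = {}" "\<Psi> {} = {}"
proof -
  note D = bisection_isoD[OF assms]
  have "\<Psi> {} \<subseteq> \<Psi> (\<Phi> {})"
    by (intro D(8) D(3)) auto
  then show "\<Psi> {} = {}"
    using D(4)[of "{}"] by simp
  then show "\<Phi> {} = {}"
    using D(6)[of "{}"] by simp
qed

text \<open>As in Stone duality, a point is identified with the family of bisections that contain
  it, and that family is carried over by \<open>\<Phi>\<close>.\<close>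

definition matches :: "'g set \<Rightarrow> 'h set \<Rightarrow> ('g set \<Rightarrow> 'h set) \<Rightarrow> 'g \<Rightarrow> 'h \<Rightarrow> bool" where
  "matches Y1 Y2 \<Phi> g k \<longleftrightarrow> k \<in> B.restr Y2 \<and> (\<forall>U \<in> A.bisections Y1. g \<in> U \<longleftrightarrow> k \<in> \<Phi> U)"

text \<open>
  A matching point exists because the compact sets \<open>\<Phi> U\<close> with \<open>g \<in> U\<close> have the finite intersection property;
  it lies in no other \<open>\<Phi> U\<close> since \<open>\<Phi>\<close> preserves disjointness, and it is unique since bisections separate
  points.
\<close>

lemma matches_ex1:
  assumes iso: "bisection_iso Y1 Y2 \<Phi> \<Psi>" and g: "g \<in> A.restr Y1"
  shows "\<exists>!k. matches Y1 Y2 \<Phi> g k"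
proof (rule ex_ex1I)
  note D = bisection_isoD[OF iso]
  note empty = bisection_iso_empty[OF iso]
  obtain U0 where U0: "U0 \<in> A.bisections Y1" "g \<in> U0"
    using A.bisections_nbhd[OF D(1) open_UNIV _ g] by blast
  define \<F> where "\<F> = {\<Phi> U |U. U \<in> A.bisections Y1 \<and> g \<in> U}"
  \<comment> \<open>Bisections through \<open>g\<close> are directed downwards by intersection, so
    one of them has its image inside any finite subfamily.\<close>
  have small: "\<exists>U \<in> A.bisections Y1. g \<in> U \<and> U \<subseteq> U0 \<and> \<Phi> U \<subseteq> \<Inter>\<F>'" if "finite \<F>'" "\<F>' \<subseteq> \<F>" for \<F>'
    using that
  proof (induction \<F>')
    case empty
    then show ?case
      using U0 by auto
  next
    case (insert X \<F>')
    then obtain U where U: "U \<in> A.bisections Y1" "g \<in> U" "U \<subseteq> U0" "\<Phi> U \<subseteq> \<Inter>\<F>'"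
      by auto
    obtain U' where U': "U' \<in> A.bisections Y1" "g \<in> U'" "X = \<Phi> U'"
      using insert by (auto simp: \<F>_def)
    have i: "U \<inter> U' \<in> A.bisections Y1"
      using U(1) U'(1) by (rule A.bisections_ops)
    then have "\<Phi> (U \<inter> U') \<subseteq> \<Phi> U" "\<Phi> (U \<inter> U') \<subseteq> \<Phi> U'"
      using U(1) U'(1) by (auto intro: D(7)[THEN subsetD])
    then show ?case
      using i U U' by (intro bexI[of _ "U \<inter> U'"]) auto
  qed
  have "\<Phi> U0 \<inter> \<Inter>\<F> \<noteq> {}"
  proof (rule compact_imp_fip)
    show "compact (\<Phi> U0)"
      using D(3)[OF U0(1)] by (auto simp: B.bisections_def B.cobD)
    show "closed X" if "X \<in> \<F>" for X
      using that D(3) by (auto simp: \<F>_def B.bisections_def B.cobD)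
    show "\<Phi> U0 \<inter> \<Inter>\<F>' \<noteq> {}" if "finite \<F>'" "\<F>' \<subseteq> \<F>" for \<F>'
    proof -
      note sm = small[OF that]
      obtain U where U: "U \<in> A.bisections Y1" "g \<in> U" "U \<subseteq> U0" "\<Phi> U \<subseteq> \<Inter>\<F>'"
        using sm by blast
      have "\<Phi> U \<noteq> {}"
        using U(1,2) D(4)[OF U(1)] empty by auto
      moreover have "\<Phi> U \<subseteq> \<Phi> U0"
        by (intro D(7) U U0)
      ultimately show ?thesis
        using U(4) by blast
    qed
  qed
  then obtain k where k0: "k \<in> \<Phi> U0" "k \<in> \<Inter>\<F>"
    by blast
  have k: "k \<in> \<Phi> U0" "U \<in> A.bisections Y1 \<Longrightarrow> g \<in> U \<Longrightarrow> k \<in> \<Phi> U" for U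
    using k0 by (auto simp: \<F>_def)
  have "g \<in> U" if U: "U \<in> A.bisections Y1" "k \<in> \<Phi> U" for U
  proof (rule ccontr)
    assume "g \<notin> U"
    \<comment> \<open>\<open>X\<close> sits below the images of the disjoint bisections
      \<open>U0 - U\<close> and \<open>U\<close>. Its preimage sits below both, hence is empty,
      although \<open>k\<close> would lie in \<open>X\<close>.\<close>
    define X where "X = \<Phi> (U0 - U) \<inter> \<Phi> U"
    have d: "U0 - U \<in> A.bisections Y1"
      by (intro A.bisections_ops U U0)
    have X: "X \<in> B.bisections Y2"
      unfolding X_def by (intro B.bisections_ops D(3) d U)
    have "\<Psi> X \<subseteq> \<Psi> (\<Phi> (U0 - U))"
      by (rule D(8)[OF X D(3)[OF d]]) (simp add: X_def)
    moreover have "\<Psi> X \<subseteq> \<Psi> (\<Phi> U)"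
      by (rule D(8)[OF X D(3)[OF U(1)]]) (simp add: X_def)
    ultimately have "\<Psi> X \<subseteq> U0 - U" "\<Psi> X \<subseteq> U"
      unfolding D(4)[OF d] D(4)[OF U(1)] .
    then have "\<Psi> X = {}"
      by blast
    then have "X = {}"
      using D(6)[OF X] empty by simp
    moreover have "k \<in> X"
      using k(2)[OF d] U U0(2) \<open>g \<notin> U\<close> by (simp add: X_def)
    ultimately show False
      by simp
  qed
  moreover have "k \<in> B.restr Y2"
    using k(1) D(3)[OF U0(1)] by (auto simp: B.bisections_def)
  ultimately show "\<exists>k. matches Y1 Y2 \<Phi> g k"
    using k(2) unfolding matches_def by blast
next
  note D = bisection_isoD[OF iso]
  fix k k'
  assume m: "matches Y1 Y2 \<Phi> g k" "matches Y1 Y2 \<Phi> g k'"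
  show "k = k'"
  proof (rule ccontr)
    assume "k \<noteq> k'"
    then obtain V where V: "V \<in> B.bisections Y2" "k \<in> V" "V \<subseteq> - {k'}"
      using B.bisections_nbhd[OF D(2), of "- {k'}" k] m(1) by (auto simp: matches_def open_Compl)
    then show False
      using m D(5)[OF V(1)] D(6)[OF V(1)] unfolding matches_def by blast
  qed
qed

text \<open>Continuity is automatic: the preimage of a basic bisection \<open>V\<close> under the
  point map is the bisection \<open>\<Psi> V\<close>.\<close>

lemma bisection_iso_map:
  assumes iso: "bisection_iso Y1 Y2 \<Phi> \<Psi>"
  shows "\<exists>\<phi>. continuous_on (A.restr Y1) \<phi> \<and> (\<forall>g \<in> A.restr Y1. matches Y1 Y2 \<Phi> g (\<phi> g))"
proof -
  note D = bisection_isoD[OF iso]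
  define \<phi> where "\<phi> g = (THE k. matches Y1 Y2 \<Phi> g k)" for g
  have m: "matches Y1 Y2 \<Phi> g (\<phi> g)" if "g \<in> A.restr Y1" for g
    unfolding \<phi>_def by (rule theI'[OF matches_ex1[OF iso that]])
  then have m': "\<phi> g \<in> B.restr Y2" "U \<in> A.bisections Y1 \<Longrightarrow> g \<in> U \<longleftrightarrow> \<phi> g \<in> \<Phi> U" if "g \<in> A.restr Y1" for g U
    using that by (auto simp: matches_def)
  have "continuous_on (A.restr Y1) \<phi>"
    unfolding continuous_on_topological
  proof (intro ballI allI impI)
    fix g W
    assume g: "g \<in> A.restr Y1" and W: "open W" "\<phi> g \<in> W"
    obtain V where V: "V \<in> B.bisections Y2" "\<phi> g \<in> V" "V \<subseteq> W"
      using B.bisections_nbhd[OF D(2) W m'(1)[OF g]] by metis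
    have \<Psi>V: "\<Psi> V \<in> A.bisections Y1" "\<Phi> (\<Psi> V) = V"
      using D V by auto
    show "\<exists>A. open A \<and> g \<in> A \<and> (\<forall>y\<in>A.restr Y1. y \<in> A \<longrightarrow> \<phi> y \<in> W)"
      using \<Psi>V m'(2)[OF _ \<Psi>V(1)] g V by (intro exI[of _ "\<Psi> V"]) (auto simp: A.bisections_def A.cobD)
  qed
  then show ?thesis
    using m by blast
qed

text \<open>Algebraic relations between points are tested on small bisections around them:
  composability through products being non-empty, the value of a product through products of
  neighbourhoods. Hausdorff separation makes these tests conclusive.\<close>

lemma bisection_iso_imp_groupoid_iso:
  assumes iso: "bisection_iso Y1 Y2 \<Phi> \<Psi>"
    and mult: "\<And>U U'. U \<in> A.bisections Y1 \<Longrightarrow> U' \<in> A.bisections Y1 \<Longrightarrow>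
      \<Phi> (A.setmul U U') = B.setmul (\<Phi> U) (\<Phi> U')"
  shows "\<exists>\<phi>. groupoid_iso_on G1 (A.restr Y1) G2 (B.restr Y2) \<phi>"
proof -
  note D = bisection_isoD[OF iso]
  interpret swap: ample_pair G2 G1 ..
  have iso': "swap.bisection_iso Y2 Y1 \<Psi> \<Phi>"
    using iso unfolding swap.bisection_iso_def bisection_iso_def
    by (elim conjE) (intro conjI; assumption)
  obtain \<phi> where c\<phi>: "continuous_on (A.restr Y1) \<phi>"
    and m\<phi>: "\<And>g. g \<in> A.restr Y1 \<Longrightarrow> matches Y1 Y2 \<Phi> g (\<phi> g)"
    using bisection_iso_map[OF iso] by metis
  have \<phi>: "\<phi> g \<in> B.restr Y2" "U \<in> A.bisections Y1 \<Longrightarrow> g \<in> U \<longleftrightarrow> \<phi> g \<in> \<Phi> U"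
    "matches Y1 Y2 \<Phi> g k \<Longrightarrow> \<phi> g = k" if "g \<in> A.restr Y1" for g U k
    using m\<phi>[OF that] matches_ex1[OF iso that] by (auto simp: matches_def)
  obtain \<psi> where c\<psi>: "continuous_on (B.restr Y2) \<psi>"
    and m\<psi>: "\<And>k. k \<in> B.restr Y2 \<Longrightarrow> swap.matches Y2 Y1 \<Psi> k (\<psi> k)"
    using swap.bisection_iso_map[OF iso'] by metis
  have \<psi>: "\<psi> g \<in> A.restr Y1" "U \<in> B.bisections Y2 \<Longrightarrow> g \<in> U \<longleftrightarrow> \<psi> g \<in> \<Psi> U"
    "swap.matches Y2 Y1 \<Psi> g k \<Longrightarrow> \<psi> g = k" if "g \<in> B.restr Y2" for g U k
    using m\<psi>[OF that] swap.matches_ex1[OF iso' that] by (auto simp: swap.matches_def)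
  have inv1: "\<psi> (\<phi> g) = g" if "g \<in> A.restr Y1" for g
  proof (rule \<psi>(3)[OF \<phi>(1)[OF that]])
    show "swap.matches Y2 Y1 \<Psi> (\<phi> g) g"
      unfolding swap.matches_def using that \<phi>(2)[OF that D(5)] D(6) by auto
  qed
  have inv2: "\<phi> (\<psi> k) = k" if "k \<in> B.restr Y2" for k
  proof (rule \<phi>(3)[OF \<psi>(1)[OF that]])
    show "matches Y1 Y2 \<Phi> (\<psi> k) k"
      unfolding matches_def using that \<psi>(2)[OF that D(3)] D(4) by auto
  qed
  have homeo: "homeomorphism (A.restr Y1) (B.restr Y2) \<phi> \<psi>"
    using \<phi>(1) \<psi>(1) inv1 inv2 c\<phi> c\<psi> by (intro homeomorphismI) auto
  have \<Psi>: "V \<in> B.bisections Y2 \<Longrightarrow> \<phi> g \<in> V \<longleftrightarrow> g \<in> \<Psi> V" if "g \<in> A.restr Y1" for g V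
    using \<phi>(2)[OF that D(5)[of V]] D(6)[of V] by simp
  have prod: "A.mult g h \<in> A.restr Y1" if "g \<in> A.restr Y1" "h \<in> A.restr Y1" "A.s g = A.r h" for g h
    using that by (simp add: A.restr_iff)
  have comp: "B.s (\<phi> g) = B.r (\<phi> h)" if gh: "g \<in> A.restr Y1" "h \<in> A.restr Y1" "A.s g = A.r h" for g h
  proof (rule ccontr)
    assume ne: "B.s (\<phi> g) \<noteq> B.r (\<phi> h)"
    obtain P Q where PQ: "open P" "open Q" "B.s (\<phi> g) \<in> P" "B.r (\<phi> h) \<in> Q" "P \<inter> Q = {}"
      using hausdorff[OF ne] by metis
    have "\<phi> g \<in> B.s -` P" "\<phi> h \<in> B.r -` Q"
      using PQ by simp_all
    then obtain V V' where V: "V \<in> B.bisections Y2" "\<phi> g \<in> V" "V \<subseteq> B.s -` P"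
      and V': "V' \<in> B.bisections Y2" "\<phi> h \<in> V'" "V' \<subseteq> B.r -` Q"
      using B.bisections_nbhd[OF D(2) B.open_vimage(2)[OF PQ(1)] _ \<phi>(1)[OF gh(1)]]
        B.bisections_nbhd[OF D(2) B.open_vimage(1)[OF PQ(2)] _ \<phi>(1)[OF gh(2)]] by metis
    \<comment> \<open>No arrow of \<open>V\<close> composes with one of \<open>V'\<close>, yet the
      preimages contain the composable arrows \<open>g\<close> and \<open>h\<close>.\<close>
    have "B.setmul V V' = {}"
      using V(3) V'(3) PQ(5) by (fastforce simp: B.setmul_def)
    then have "\<Phi> (A.setmul (\<Psi> V) (\<Psi> V')) = {}"
      using mult[OF D(5)[OF V(1)] D(5)[OF V'(1)]] D(6) V(1) V'(1) by simp
    moreover have "A.mult g h \<in> A.setmul (\<Psi> V) (\<Psi> V')"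
      using \<Psi> gh V V' by (intro A.setmulI) auto
    ultimately show False
      using \<phi>(2)[OF prod[OF gh] A.bisections_ops(3)[OF D(5)[OF V(1)] D(5)[OF V'(1)]]] by simp
  qed
  have hom: "\<phi> (A.mult g h) = B.mult (\<phi> g) (\<phi> h)" if gh: "g \<in> A.restr Y1" "h \<in> A.restr Y1" "A.s g = A.r h" for g h
  proof (rule ccontr)
    let ?k = "B.mult (\<phi> g) (\<phi> h)"
    assume "\<phi> (A.mult g h) \<noteq> ?k"
    then have "open (- {?k})" "\<phi> (A.mult g h) \<in> - {?k}"
      by (auto simp: open_Compl)
    then obtain V where V: "V \<in> B.bisections Y2" "\<phi> (A.mult g h) \<in> V" "V \<subseteq> - {?k}"
      using B.bisections_nbhd[OF D(2) _ _ \<phi>(1)[OF prod[OF gh]]] by metis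
    have X: "\<Psi> V \<in> A.bisections Y1" "A.mult g h \<in> \<Psi> V"
      using D(5) V \<Psi>[OF prod[OF gh]] by auto
    obtain U where U: "U \<in> A.bisections Y1" "g \<in> U"
      using A.bisections_nbhd[OF D(1) open_UNIV _ gh(1)] by blast
    have cU: "A.cob U"
      using U by (simp add: A.bisections_def)
    \<comment> \<open>A neighbourhood of \<open>h\<close> inside the product of the inverse of
      \<open>U\<close> with \<open>\<Psi> V\<close> is chosen so that multiplying it by
      \<open>U\<close> lands in \<open>\<Psi> V\<close>.\<close>
    have "open (A.setmul (A.iv ` U) (\<Psi> V))"
      using X by (intro A.open_setmul A.cob_iv[OF cU]) (simp add: A.bisections_def A.cobD)
    moreover have "h \<in> A.setmul (A.iv ` U) (\<Psi> V)"
      using A.setmulI[of "A.iv g" "A.iv ` U" "A.mult g h" "\<Psi> V"] U X gh by simp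
    ultimately obtain U' where U': "U' \<in> A.bisections Y1" "h \<in> U'" "U' \<subseteq> A.setmul (A.iv ` U) (\<Psi> V)"
      using A.bisections_nbhd[OF D(1) _ _ gh(2)] by metis
    have "A.setmul U U' \<subseteq> \<Psi> V"
    proof
      fix z
      assume "z \<in> A.setmul U U'"
      then obtain u u' where z: "u \<in> U" "u' \<in> U'" "A.s u = A.r u'" "z = A.mult u u'"
        by (auto simp: A.setmul_def)
      then obtain u2 x where u2: "u2 \<in> U" "x \<in> \<Psi> V" "A.r u2 = A.r x" "u' = A.mult (A.iv u2) x"
        using U'(3) by (force simp: A.setmul_def)
      \<comment> \<open>Both arrows of \<open>U\<close> have the range of \<open>u'\<close> as
        source, and \<open>U\<close> is a bisection.\<close>
      then have "u = u2"
        using z inj_onD[OF A.cobD(5)[OF cU]] by simp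
      then show "z \<in> \<Psi> V"
        using z u2 by simp
    qed
    then have "\<Phi> (A.setmul U U') \<subseteq> V"
      using D(7)[OF A.bisections_ops(3)[OF U(1) U'(1)] X(1)] D(6)[OF V(1)] by simp
    moreover have "?k \<in> \<Phi> (A.setmul U U')"
      unfolding mult[OF U(1) U'(1)] using \<phi>(2)[OF gh(1) U(1)] \<phi>(2)[OF gh(2) U'(1)] U(2) U'(2) comp[OF gh]
      by (intro B.setmulI) auto
    ultimately show False
      using V(3) by blast
  qed
  have un: "A.r g \<in> A.restr Y1" "A.s g \<in> A.restr Y1" if "g \<in> A.restr Y1" for g
    using that by (auto simp: A.restr_iff)
  \<comment> \<open>The image of the range unit acts as a left identity on \<open>\<phi> g\<close>;
    cancelling that arrow identifies it.\<close>
  have "\<phi> (A.r g) = B.r (\<phi> g)" if g: "g \<in> A.restr Y1" for g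
  proof -
    have c: "B.s (\<phi> (A.r g)) = B.r (\<phi> g)"
      by (rule comp[OF un(1)[OF g] g]) simp
    have "\<phi> (A.mult (A.r g) g) = B.mult (\<phi> (A.r g)) (\<phi> g)"
      by (rule hom[OF un(1)[OF g] g]) simp
    then have "B.mult (\<phi> (A.r g)) (\<phi> g) = \<phi> g"
      by simp
    then show ?thesis
      using B.cancel(3)[OF c] by simp
  qed
  moreover have "\<phi> (A.s g) = B.s (\<phi> g)" if g: "g \<in> A.restr Y1" for g
  proof -
    have c: "B.s (\<phi> g) = B.r (\<phi> (A.s g))"
      by (rule comp[OF g un(2)[OF g]]) simp
    have "\<phi> (A.mult g (A.s g)) = B.mult (\<phi> g) (\<phi> (A.s g))"
      by (rule hom[OF g un(2)[OF g]]) simp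
    then have "B.mult (\<phi> g) (\<phi> (A.s g)) = \<phi> g"
      by simp
    then show ?thesis
      using B.cancel(1)[OF c] by simp
  qed
  ultimately show ?thesis
    unfolding groupoid_iso_on_def using homeo hom by blast
qed

end

section \<open>From diagonal-preserving isomorphisms to groupoid isomorphisms\<close>

context grpd
begin

lemma setmul_range_left: "setmul (r ` U) U = U" if "inj_on r U"
proof
  show "setmul (r ` U) U \<subseteq> U"
  proof
    fix z
    assume "z \<in> setmul (r ` U) U"
    then obtain a b where z: "a \<in> U" "b \<in> U" "r a = r b" "z = r a \<odot> b"
      by (auto simp: setmul_def)
    then show "z \<in> U"
      by simp
  qed
  show "U \<subseteq> setmul (r ` U) U"
  proof
    fix z
    assume "z \<in> U"
    then show "z \<in> setmul (r ` U) U"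
      using setmulI[of "r z" "r ` U" z U] by simp
  qed
qed

end

context ample
begin

lemma corner_alg_compose:
  assumes "T \<in> corner_alg Y" "S \<in> corner_alg Y"
  shows "T \<circ> S \<in> corner_alg Y"
proof -
  have C: "T \<in> Cred G" "S \<in> Cred G"
    using assms by (auto simp: corner_alg_def)
  have "g \<in> restr Y" if nz: "kern (T \<circ> S) g \<noteq> 0" for g
  proof (rule ccontr)
    assume "g \<notin> restr Y"
    then have "kern T (g \<odot> iv b) = 0 \<or> kern S b = 0" if "s b = s g" for b
      using assms that unfolding corner_alg_def restr_iff by fastforce
    then show False
      using nz kern_compose_eq_0[OF C[THEN Cred_conv_op]] by blast
  qed
  then show ?thesis
    using Cred_compose[OF C] by (simp add: corner_alg_def)
qed

lemma bisections_iv: "U \<in> bisections Y \<Longrightarrow> iv ` U \<in> bisections Y"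
  using cob_iv[of U] by (auto simp: bisections_def restr_iff)

lemma bisections_images:
  assumes "U \<in> bisections Y"
  shows "clopen_units (r ` U)" "r ` U \<subseteq> Y" "clopen_units (s ` U)" "s ` U \<subseteq> Y"
  using assms cob_r_image[of U] by (auto simp: bisections_def clopen_units_def cobD restr_iff)

lemma bisections_corner: "U \<in> bisections Y \<Longrightarrow> char_op U \<in> corner_alg Y"
  by (simp add: bisections_def char_op_corner_alg)

text \<open>The support lies in the product of the inverse of \<open>U\<close> with
  \<open>U\<close>, and for a bisection this product consists of sources of
  \<open>U\<close>.\<close>

lemma conjugate_diag:
  assumes Y: "clopen_units Y" and U: "U \<in> bisections Y" and d: "d \<in> diag_alg Y"
  shows "char_op (iv ` U) \<circ> d \<circ> char_op U \<in> diag_alg Y"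
proof -
  have c: "cob U" "cob (iv ` U)"
    using U cob_iv by (auto simp: bisections_def)
  have dC: "d \<in> Cred G" "char_op U \<in> Cred G" "char_op (iv ` U) \<in> Cred G"
    using d c char_op_Cred by (auto simp: diag_alg_def)
  have "supp (d \<circ> char_op U) \<subseteq> U"
    using kern_compose_diag(2)[OF Y d Cred_bounded[OF dC(2)]] by (auto simp: supp_def split: if_splits)
  moreover have "supp (char_op (iv ` U) \<circ> (d \<circ> char_op U)) = setmul (iv ` U) (supp (d \<circ> char_op U))"
    using supp_compose_cob[OF dC(3) _ Cred_compose[OF dC(1,2)]] c by simp
  ultimately have "supp (char_op (iv ` U) \<circ> (d \<circ> char_op U)) \<subseteq> setmul (iv ` U) U"
    by (auto simp: setmul_def)
  also have "\<dots> \<subseteq> Y"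
    using setmul_iv_left[OF cobD(4)[OF c(1)]] bisections_images(4)[OF U] by simp
  finally show ?thesis
    using Cred_compose[OF Cred_compose[OF dC(3,1)] dC(2)] by (simp add: diag_alg_iff o_assoc)
qed

lemma normalizer_pair_char_op:
  assumes Y: "clopen_units Y" and U: "U \<in> bisections Y"
  shows "normalizer_pair Y (char_op U) (char_op (iv ` U))"
  unfolding normalizer_pair_def
proof (intro conjI ballI)
  have c: "cob U" "cob (iv ` U)"
    using U cob_iv by (auto simp: bisections_def)
  have iv2: "iv ` iv ` U = U"
    by (simp add: image_image)
  show "char_op U \<in> corner_alg Y" "char_op (iv ` U) \<in> corner_alg Y"
    using U bisections_iv bisections_corner by auto
  have 1: "char_op U \<circ> char_op (iv ` U) = char_op (r ` U)"
    using c by (simp add: char_op_compose setmul_iv_right cobD)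
  then show "char_op U \<circ> char_op (iv ` U) \<circ> char_op U = char_op U"
    using c cob_r_image by (simp add: char_op_compose setmul_range_left cobD)
  show "char_op U \<circ> char_op (iv ` U) \<in> diag_alg Y"
    unfolding 1 by (intro char_op_diag_alg bisections_images[OF U])
  show "char_op (iv ` U) \<circ> char_op U \<in> diag_alg Y"
    using c char_op_diag_alg[OF bisections_images(3,4)[OF U]] by (simp add: char_op_compose setmul_iv_left cobD)
  show "char_op (iv ` U) \<circ> d \<circ> char_op U \<in> diag_alg Y" if "d \<in> diag_alg Y" for d
    by (rule conjugate_diag[OF Y U that])
  show "char_op U \<circ> d \<circ> char_op (iv ` U) \<in> diag_alg Y" if "d \<in> diag_alg Y" for d
    using conjugate_diag[OF Y bisections_iv[OF U] that] by (simp only: iv2)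
qed

end

context ample_pair
begin

text \<open>Products and diagonals, with the inverse named: symmetric in the two sides, so each
  argument also runs backwards.\<close>

definition diagonal_iso :: "'g set \<Rightarrow> 'h set \<Rightarrow> ('g op \<Rightarrow> 'h op) \<Rightarrow> ('h op \<Rightarrow> 'g op) \<Rightarrow> bool" where
  "diagonal_iso Y1 Y2 \<pi> \<rho> \<longleftrightarrow>
     (\<forall>T \<in> A.corner_alg Y1. \<pi> T \<in> B.corner_alg Y2 \<and> \<rho> (\<pi> T) = T)
   \<and> (\<forall>T \<in> B.corner_alg Y2. \<rho> T \<in> A.corner_alg Y1 \<and> \<pi> (\<rho> T) = T)
   \<and> (\<forall>T \<in> A.corner_alg Y1. \<forall>S \<in> A.corner_alg Y1. \<pi> (T \<circ> S) = \<pi> T \<circ> \<pi> S)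
   \<and> (\<forall>T \<in> B.corner_alg Y2. \<forall>S \<in> B.corner_alg Y2. \<rho> (T \<circ> S) = \<rho> T \<circ> \<rho> S)
   \<and> (\<forall>T \<in> A.diag_alg Y1. \<pi> T \<in> B.diag_alg Y2)
   \<and> (\<forall>T \<in> B.diag_alg Y2. \<rho> T \<in> A.diag_alg Y1)"

lemma diagonal_isoD:
  assumes "diagonal_iso Y1 Y2 \<pi> \<rho>"
  shows "T \<in> A.corner_alg Y1 \<Longrightarrow> \<pi> T \<in> B.corner_alg Y2" "T \<in> A.corner_alg Y1 \<Longrightarrow> \<rho> (\<pi> T) = T"
    and "V \<in> B.corner_alg Y2 \<Longrightarrow> \<rho> V \<in> A.corner_alg Y1" "V \<in> B.corner_alg Y2 \<Longrightarrow> \<pi> (\<rho> V) = V"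
    and "T \<in> A.corner_alg Y1 \<Longrightarrow> S \<in> A.corner_alg Y1 \<Longrightarrow> \<pi> (T \<circ> S) = \<pi> T \<circ> \<pi> S"
    and "V \<in> B.corner_alg Y2 \<Longrightarrow> W \<in> B.corner_alg Y2 \<Longrightarrow> \<rho> (V \<circ> W) = \<rho> V \<circ> \<rho> W"
    and "T \<in> A.diag_alg Y1 \<Longrightarrow> \<pi> T \<in> B.diag_alg Y2" "V \<in> B.diag_alg Y2 \<Longrightarrow> \<rho> V \<in> A.diag_alg Y1"
  using assms by (simp_all add: diagonal_iso_def)

text \<open>The image \<open>v\<close> of the indicator of \<open>U\<close> has some bisection
  \<open>S\<close> as support. Since \<open>v\<close> and the indicator of \<open>S\<close> divide
  each other by diagonal elements, so do their preimages, which therefore have the same support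
  \<open>U\<close>.\<close>

lemma diagonal_iso_bisection:
  assumes Y: "A.clopen_units Y1" "B.clopen_units Y2" and ep: "essentially_principal G2"
    and iso: "diagonal_iso Y1 Y2 \<pi> \<rho>" and U: "U \<in> A.bisections Y1"
  shows "B.supp (\<pi> (A.char_op U)) \<in> B.bisections Y2"
    and "A.supp (\<rho> (B.char_op (B.supp (\<pi> (A.char_op U))))) = U"
    and "U' \<in> A.bisections Y1 \<Longrightarrow> U' \<subseteq> U \<Longrightarrow> B.supp (\<pi> (A.char_op U')) \<subseteq> B.supp (\<pi> (A.char_op U))"
    and "U' \<in> A.bisections Y1 \<Longrightarrow>
      B.supp (\<pi> (A.char_op (A.setmul U U'))) = B.setmul (B.supp (\<pi> (A.char_op U))) (B.supp (\<pi> (A.char_op U')))"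
proof -
  note D = diagonal_isoD[OF iso]
  have sub: "A.diag_alg Y1 \<subseteq> A.corner_alg Y1" "B.diag_alg Y2 \<subseteq> B.corner_alg Y2"
    using A.diag_alg_subset[OF Y(1)] B.diag_alg_subset[OF Y(2)] by auto
  let ?u = "A.char_op U" and ?w = "A.char_op (A.iv ` U)"
  let ?v = "\<pi> ?u" and ?v' = "\<pi> ?w"
  have n: "A.normalizer_pair Y1 ?u ?w"
    by (rule A.normalizer_pair_char_op[OF Y(1) U])
  have uw: "?u \<in> A.corner_alg Y1" "?w \<in> A.corner_alg Y1"
    using n by (auto simp: A.normalizer_pair_def)
  have prod: "\<pi> (T \<circ> S \<circ> R) = \<pi> T \<circ> \<pi> S \<circ> \<pi> R"
    if "T \<in> A.corner_alg Y1" "S \<in> A.corner_alg Y1" "R \<in> A.corner_alg Y1" for T S R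
    using that by (simp only: D(5) A.corner_alg_compose)
  have "B.normalizer_pair Y2 ?v ?v'"
    unfolding B.normalizer_pair_def
  proof (intro conjI ballI)
    show "?v \<in> B.corner_alg Y2" "?v' \<in> B.corner_alg Y2"
      using uw D(1) by auto
    show "?v \<circ> ?v' \<circ> ?v = ?v"
      using prod[OF uw(1,2,1)] n by (simp only: A.normalizer_pair_def)
    have "?u \<circ> ?w \<in> A.diag_alg Y1" "?w \<circ> ?u \<in> A.diag_alg Y1"
      using n by (simp_all only: A.normalizer_pair_def)
    then show "?v \<circ> ?v' \<in> B.diag_alg Y2" "?v' \<circ> ?v \<in> B.diag_alg Y2"
      using D(7) D(5)[OF uw] D(5)[OF uw(2,1)] by metis+
    fix d
    assume d: "d \<in> B.diag_alg Y2"
    \<comment> \<open>Every diagonal \<open>d\<close> on the second side is the image of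
      \<open>\<rho> d\<close>, so its conjugates are images of conjugates on the first side.\<close>
    then have d': "\<rho> d \<in> A.diag_alg Y1" "\<rho> d \<in> A.corner_alg Y1" "\<pi> (\<rho> d) = d"
      using D sub by auto
    have "?w \<circ> \<rho> d \<circ> ?u \<in> A.diag_alg Y1" "?u \<circ> \<rho> d \<circ> ?w \<in> A.diag_alg Y1"
      using n d'(1) unfolding A.normalizer_pair_def by metis+
    then have "\<pi> (?w \<circ> \<rho> d \<circ> ?u) \<in> B.diag_alg Y2" "\<pi> (?u \<circ> \<rho> d \<circ> ?w) \<in> B.diag_alg Y2"
      using D(7) by metis+
    then show "?v' \<circ> d \<circ> ?v \<in> B.diag_alg Y2" "?v \<circ> d \<circ> ?v' \<in> B.diag_alg Y2"
      by (simp_all only: prod[OF uw(2) d'(2) uw(1)] prod[OF uw(1) d'(2) uw(2)] d'(3))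
  qed
  note nc = B.normalizer_cob[OF ep Y(2) this]
  let ?S = "B.supp ?v"
  show S: "?S \<in> B.bisections Y2"
    using nc by (simp add: B.bisections_def)
  have vC: "?v \<in> Cred G2" "B.char_op ?S \<in> Cred G2"
    using D(1)[OF uw(1)] B.char_op_Cred[OF nc(1)] by (auto simp: B.corner_alg_def)
  have eS: "B.char_op ?S \<in> B.corner_alg Y2"
    by (rule B.bisections_corner[OF S])
  show "A.supp (\<rho> (B.char_op ?S)) = U"
  proof
    obtain d where d: "d \<in> B.diag_alg Y2" "B.char_op ?S = ?v \<circ> d"
      using B.cob_factor[OF Y(2) vC(1) nc vC(2)] by auto
    have "\<rho> (B.char_op ?S) = \<rho> ?v \<circ> \<rho> d"
      unfolding d(2) using D(6)[OF D(1)[OF uw(1)], of d] d(1) sub by auto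
    then have "\<rho> (B.char_op ?S) = ?u \<circ> \<rho> d"
      using D(2)[OF uw(1)] by simp
    then show "A.supp (\<rho> (B.char_op ?S)) \<subseteq> U"
      using A.supp_compose_diag[OF Y(1) D(8)[OF d(1)], of ?u] uw(1) by (simp add: A.corner_alg_def)
    obtain d' where d': "d' \<in> B.diag_alg Y2" "?v = B.char_op ?S \<circ> d'"
      using B.cob_factor[OF Y(2) vC(2) _ _ vC(1)] nc by auto
    have "?u = \<rho> ?v"
      using D(2)[OF uw(1)] by simp
    also have "\<dots> = \<rho> (B.char_op ?S \<circ> d')"
      using d'(2) by simp
    also have "\<dots> = \<rho> (B.char_op ?S) \<circ> \<rho> d'"
      using D(6)[OF eS] d'(1) sub by auto
    finally have "A.supp ?u \<subseteq> A.supp (\<rho> (B.char_op ?S))"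
      using A.supp_compose_diag[OF Y(1) D(8)[OF d'(1)], of "\<rho> (B.char_op ?S)"] D(3)[OF eS]
      by (simp add: A.corner_alg_def)
    then show "U \<subseteq> A.supp (\<rho> (B.char_op ?S))"
      by simp
  qed
  show "B.supp (\<pi> (A.char_op U')) \<subseteq> ?S" if U': "U' \<in> A.bisections Y1" "U' \<subseteq> U"
  proof -
    have "A.char_op U' \<in> Cred G1" "?u \<in> Cred G1" "A.cob U" "U \<subseteq> A.restr Y1"
      using U U' A.char_op_Cred by (auto simp: A.bisections_def)
    then obtain d where d: "d \<in> A.diag_alg Y1" "A.char_op U' = ?u \<circ> d"
      using A.cob_factor[OF Y(1), of ?u "A.char_op U'"] U' by auto
    then have "\<pi> (A.char_op U') = ?v \<circ> \<pi> d"
      using D(5)[OF uw(1), of d] sub by auto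
    then show ?thesis
      using B.supp_compose_diag[OF Y(2) D(7)[OF d(1)] vC(1)] by simp
  qed
  show "B.supp (\<pi> (A.char_op (A.setmul U U'))) = B.setmul ?S (B.supp (\<pi> (A.char_op U')))"
    if U': "U' \<in> A.bisections Y1"
  proof -
    have u': "A.char_op U' \<in> A.corner_alg Y1"
      by (rule A.bisections_corner[OF U'])
    have "A.char_op (A.setmul U U') = ?u \<circ> A.char_op U'"
      using U U' by (simp add: A.char_op_compose A.bisections_def)
    then have "\<pi> (A.char_op (A.setmul U U')) = ?v \<circ> \<pi> (A.char_op U')"
      using D(5)[OF uw(1) u'] by simp
    moreover have "\<pi> (A.char_op U') \<in> Cred G2"
      using D(1)[OF u'] by (simp add: B.corner_alg_def)
    ultimately show ?thesis
      using B.supp_compose_cob[OF vC(1) nc(1)] by simp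
  qed
qed

text \<open>The bisection lemma is applied in both directions; each groupoid's essential
  principality serves to turn its own normalizers into bisections.\<close>

lemma diagonal_iso_imp_groupoid_iso:
  assumes Y: "A.clopen_units Y1" "B.clopen_units Y2"
    and ep: "essentially_principal G1" "essentially_principal G2"
    and iso: "diagonal_iso Y1 Y2 \<pi> \<rho>"
  shows "\<exists>\<phi>. groupoid_iso_on G1 (A.restr Y1) G2 (B.restr Y2) \<phi>"
proof (rule bisection_iso_imp_groupoid_iso)
  interpret swap: ample_pair G2 G1 ..
  have iso': "swap.diagonal_iso Y2 Y1 \<rho> \<pi>"
    using iso unfolding swap.diagonal_iso_def diagonal_iso_def
    by (elim conjE) (intro conjI; assumption)
  note P = diagonal_iso_bisection[OF Y ep(2) iso]
  note Q = swap.diagonal_iso_bisection[OF Y(2,1) ep(1) iso']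
  show "bisection_iso Y1 Y2 (\<lambda>U. B.supp (\<pi> (A.char_op U))) (\<lambda>V. A.supp (\<rho> (B.char_op V)))"
    unfolding bisection_iso_def by (intro conjI ballI impI Y P(1,2) Q(1,2)) (assumption | rule P(3), assumption+ | rule Q(3), assumption+)+
  show "B.supp (\<pi> (A.char_op (A.setmul U U'))) = B.setmul (B.supp (\<pi> (A.char_op U))) (B.supp (\<pi> (A.char_op U')))"
    if "U \<in> A.bisections Y1" "U' \<in> A.bisections Y1" for U U'
    using that by (rule P(4))
qed

end

section \<open>Transport along a groupoid isomorphism\<close>

context ample_pair
begin

text \<open>\<open>groupoid_iso_on\<close> with the inverse named and its homomorphism laws
  included, which makes exchanging the two groupoids immediate.\<close>

definition restr_iso :: "'g set \<Rightarrow> 'h set \<Rightarrow> ('g \<Rightarrow> 'h) \<Rightarrow> ('h \<Rightarrow> 'g) \<Rightarrow> bool" where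
  "restr_iso Y1 Y2 \<phi> \<psi> \<longleftrightarrow> homeomorphism (A.restr Y1) (B.restr Y2) \<phi> \<psi>
    \<and> (\<forall>g\<in>A.restr Y1. \<phi> (A.r g) = B.r (\<phi> g) \<and> \<phi> (A.s g) = B.s (\<phi> g))
    \<and> (\<forall>g\<in>A.restr Y1. \<forall>h\<in>A.restr Y1. A.s g = A.r h \<longrightarrow> \<phi> (A.mult g h) = B.mult (\<phi> g) (\<phi> h))
    \<and> (\<forall>g\<in>B.restr Y2. \<psi> (B.r g) = A.r (\<psi> g) \<and> \<psi> (B.s g) = A.s (\<psi> g))
    \<and> (\<forall>g\<in>B.restr Y2. \<forall>h\<in>B.restr Y2. B.s g = B.r h \<longrightarrow> \<psi> (B.mult g h) = A.mult (\<psi> g) (\<psi> h))"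

lemma restr_isoD:
  assumes "restr_iso Y1 Y2 \<phi> \<psi>"
  shows "continuous_on (A.restr Y1) \<phi>" "continuous_on (B.restr Y2) \<psi>"
    and "g \<in> A.restr Y1 \<Longrightarrow> \<phi> g \<in> B.restr Y2" "h \<in> B.restr Y2 \<Longrightarrow> \<psi> h \<in> A.restr Y1"
    and "g \<in> A.restr Y1 \<Longrightarrow> \<psi> (\<phi> g) = g" "h \<in> B.restr Y2 \<Longrightarrow> \<phi> (\<psi> h) = h"
    and "g \<in> A.restr Y1 \<Longrightarrow> \<phi> (A.r g) = B.r (\<phi> g)" "g \<in> A.restr Y1 \<Longrightarrow> \<phi> (A.s g) = B.s (\<phi> g)"
    and "g \<in> A.restr Y1 \<Longrightarrow> g' \<in> A.restr Y1 \<Longrightarrow> A.s g = A.r g' \<Longrightarrow> \<phi> (A.mult g g') = B.mult (\<phi> g) (\<phi> g')"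
    and "h \<in> B.restr Y2 \<Longrightarrow> \<psi> (B.r h) = A.r (\<psi> h)" "h \<in> B.restr Y2 \<Longrightarrow> \<psi> (B.s h) = A.s (\<psi> h)"
    and "h \<in> B.restr Y2 \<Longrightarrow> h' \<in> B.restr Y2 \<Longrightarrow> B.s h = B.r h' \<Longrightarrow> \<psi> (B.mult h h') = A.mult (\<psi> h) (\<psi> h')"
  using assms unfolding restr_iso_def homeomorphism_def by (auto 0 3)

lemma groupoid_iso_restr_iso:
  assumes "groupoid_iso_on G1 (A.restr Y1) G2 (B.restr Y2) \<phi>"
  obtains \<psi> where "restr_iso Y1 Y2 \<phi> \<psi>"
proof -
  obtain \<psi> where \<psi>: "homeomorphism (A.restr Y1) (B.restr Y2) \<phi> \<psi>"
    using assms by (auto simp: groupoid_iso_on_def)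
  have \<phi>: "\<phi> (A.r g) = B.r (\<phi> g)" "\<phi> (A.s g) = B.s (\<phi> g)" if "g \<in> A.restr Y1" for g
    using assms that by (auto simp: groupoid_iso_on_def)
  have \<phi>m: "\<phi> (A.mult g h) = B.mult (\<phi> g) (\<phi> h)" if "g \<in> A.restr Y1" "h \<in> A.restr Y1" "A.s g = A.r h" for g h
    using assms that by (auto simp: groupoid_iso_on_def)
  have h: "\<psi> k \<in> A.restr Y1" "\<phi> (\<psi> k) = k" if "k \<in> B.restr Y2" for k
    using \<psi> that by (auto simp: homeomorphism_def)
  have h': "\<psi> (\<phi> g) = g" if "g \<in> A.restr Y1" for g
    using \<psi> that by (auto simp: homeomorphism_def)
  have un: "A.r g \<in> A.restr Y1" "A.s g \<in> A.restr Y1" if "g \<in> A.restr Y1" for g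
    using that by (auto simp: A.restr_iff)
  have \<psi>rs: "\<psi> (B.r k) = A.r (\<psi> k)" "\<psi> (B.s k) = A.s (\<psi> k)" if "k \<in> B.restr Y2" for k
    using \<phi>[OF h(1)[OF that]] h(2)[OF that] h'[OF un(1)[OF h(1)[OF that]]] h'[OF un(2)[OF h(1)[OF that]]]
    by simp_all
  have "\<psi> (B.mult k l) = A.mult (\<psi> k) (\<psi> l)" if kl: "k \<in> B.restr Y2" "l \<in> B.restr Y2" "B.s k = B.r l" for k l
  proof -
    have c: "A.s (\<psi> k) = A.r (\<psi> l)"
      using \<psi>rs kl by metis
    have "\<phi> (A.mult (\<psi> k) (\<psi> l)) = B.mult k l"
      using \<phi>m[OF h(1)[OF kl(1)] h(1)[OF kl(2)] c] h(2) kl by simp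
    moreover have "A.mult (\<psi> k) (\<psi> l) \<in> A.restr Y1"
      using h(1)[OF kl(1)] h(1)[OF kl(2)] c by (simp add: A.restr_iff)
    ultimately show ?thesis
      using h' by metis
  qed
  then have "restr_iso Y1 Y2 \<phi> \<psi>"
    unfolding restr_iso_def using \<psi> \<phi> \<phi>m \<psi>rs by blast
  then show thesis
    by (rule that)
qed

lemma restr_iso_iv:
  assumes iso: "restr_iso Y1 Y2 \<phi> \<psi>" and h: "h \<in> B.restr Y2"
  shows "\<psi> (B.iv h) = A.iv (\<psi> h)"
proof -
  note D = restr_isoD[OF iso]
  have ih: "B.iv h \<in> B.restr Y2"
    using h by (simp add: B.restr_iff)
  have c: "A.s (\<psi> h) = A.r (\<psi> (B.iv h))"
    using D(11)[OF h] D(10)[OF ih] by simp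
  have "A.mult (\<psi> h) (\<psi> (B.iv h)) = \<psi> (B.r h)"
    using D(12)[OF h ih] by simp
  then have "A.mult (\<psi> h) (\<psi> (B.iv h)) = A.r (\<psi> h)"
    using D(10)[OF h] by simp
  then have "\<psi> (B.iv h) = A.mult (A.iv (\<psi> h)) (A.r (\<psi> h))"
    using A.cancel(1)[OF c] by metis
  then show ?thesis
    by (simp only: A.mult_units(2) A.ax(8))
qed

definition transport :: "'h set \<Rightarrow> ('h \<Rightarrow> 'g) \<Rightarrow> ('g \<Rightarrow> complex) \<Rightarrow> 'h \<Rightarrow> complex" where
  "transport Y2 \<psi> k h = (if h \<in> B.restr Y2 then k (\<psi> h) else 0)"

lemma transport_bounded:
  assumes iso: "restr_iso Y1 Y2 \<phi> \<psi>" and Y2: "B.clopen_units Y2" and full: "G_full G2 Y2"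
    and T: "A.conv_op T" and supp: "\<And>g. A.kern T g \<noteq> 0 \<Longrightarrow> g \<in> A.restr Y1"
  shows "bounded_op (lreg G2 (transport Y2 \<psi> (A.kern T)))"
    and "opnorm (lreg G2 (transport Y2 \<psi> (A.kern T))) \<le> opnorm T"
proof -
  note D = restr_isoD[OF iso]
  have bT: "bounded_op T"
    by (rule A.conv_opD(1)[OF T])
  let ?k = "transport Y2 \<psi> (A.kern T)"
  have "\<exists>g. B.s g = x \<and> B.r g \<in> Y2" if x: "x \<in> B.units" for x
  proof -
    obtain g where "B.r g = x" "B.s g \<in> Y2"
      using bspec[OF full[unfolded G_full_def] x] by metis
    then show ?thesis
      by (intro exI[of _ "B.iv g"]) simp
  qed
  then obtain c where c: "\<And>x. x \<in> B.units \<Longrightarrow> B.s (c x) = x" "\<And>x. x \<in> B.units \<Longrightarrow> B.r (c x) \<in> Y2"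
    by metis
  \<comment> \<open>\<open>W x\<close> is right translation by \<open>c x\<close> followed by transport: it maps the square-summable functions on the part of
    the fibre over \<open>x\<close> with range in \<open>Y2\<close> isometrically onto those on a fibre of \<open>G1|Y1\<close>. Different units may share
    a target fibre, so the norm estimate has to sum over the fibres of \<open>G2\<close>.\<close>
  define P where "P x = {d. B.s d = x \<and> B.r d \<in> Y2}" for x
  define Q where "Q x = {g \<in> A.restr Y1. A.s g = \<psi> (B.r (c x))}" for x
  define t where "t x d = \<psi> (B.mult d (B.iv (c x)))" for x d
  define u where "u x g = B.mult (\<phi> g) (c x)" for x g
  define W where "W x w g = (if g \<in> Q x then w (u x g) else 0)" for x and w :: "'h \<Rightarrow> complex" and g
  have H: "B.mult d (B.iv (c x)) \<in> B.restr Y2" if "x \<in> B.units" "d \<in> P x" for x d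
    using that c by (simp add: P_def B.restr_iff)
  have tQ: "t x d \<in> Q x" "u x (t x d) = d" if x: "x \<in> B.units" and d: "d \<in> P x" for x d
  proof -
    have sb: "B.s d = B.s (c x)"
      using c(1)[OF x] d by (simp add: P_def)
    show "t x d \<in> Q x"
      using D(4)[OF H[OF x d]] D(11)[OF H[OF x d]] sb by (simp add: Q_def t_def)
    show "u x (t x d) = d"
      using D(6)[OF H[OF x d]] sb by (simp add: u_def t_def)
  qed
  have uP: "u x g \<in> P x" "t x (u x g) = g" if x: "x \<in> B.units" and g: "g \<in> Q x" for x g
  proof -
    have g': "g \<in> A.restr Y1" "A.s g = \<psi> (B.r (c x))"
      using g by (auto simp: Q_def)
    have "B.r (c x) \<in> B.restr Y2"
      using c(2)[OF x] by (simp add: B.restr_iff)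
    then have sg: "B.s (\<phi> g) = B.r (c x)"
      using D(8)[OF g'(1)] D(6) g'(2) by simp
    show "u x g \<in> P x"
      using sg c(1)[OF x] D(3)[OF g'(1)] by (simp add: u_def P_def B.restr_iff)
    show "t x (u x g) = g"
      using sg D(5)[OF g'(1)] by (simp add: u_def t_def)
  qed
  have bij: "bij_betw (t x) (P x) (Q x)" if "x \<in> B.units" for x
    by (rule bij_betw_byWitness[where f' = "u x"]) (use tQ uP that in auto)
  have Wt: "W x w (t x d) = w d" if "x \<in> B.units" "d \<in> P x" for x w d
    using tQ[OF that] by (simp add: W_def)
  have Wnorm: "W x w \<in> l2" "(l2norm (W x w))\<^sup>2 = infsum (\<lambda>d. (cmod (w d))\<^sup>2) (P x)"
    if x: "x \<in> B.units" and w: "w \<in> l2" for x w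
  proof -
    have "(\<lambda>d. (cmod (w d))\<^sup>2) summable_on P x"
      using w by (auto simp: l2_def intro: summable_on_subset)
    then have "((\<lambda>d. (cmod (w d))\<^sup>2) has_sum infsum (\<lambda>d. (cmod (w d))\<^sup>2) (P x)) (P x)"
      by (rule has_sum_infsum)
    then have "((\<lambda>d. (cmod (W x w (t x d)))\<^sup>2) has_sum infsum (\<lambda>d. (cmod (w d))\<^sup>2) (P x)) (P x)"
      by (rule iffD1[OF has_sum_cong, rotated]) (simp add: Wt[OF x])
    then have "((\<lambda>g. (cmod (W x w g))\<^sup>2) has_sum infsum (\<lambda>d. (cmod (w d))\<^sup>2) (P x)) (Q x)"
      using has_sum_reindex_bij_betw[OF bij[OF x], where f = "\<lambda>g. (cmod (W x w g))\<^sup>2"] by blast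
    then have hs: "((\<lambda>g. (cmod (W x w g))\<^sup>2) has_sum infsum (\<lambda>d. (cmod (w d))\<^sup>2) (P x)) UNIV"
      by (rule iffD1[OF has_sum_cong_neutral, rotated -1]) (auto simp: W_def)
    then show "W x w \<in> l2"
      using has_sum_imp_summable by (auto simp: l2_def)
    show "(l2norm (W x w))\<^sup>2 = infsum (\<lambda>d. (cmod (w d))\<^sup>2) (P x)"
      unfolding l2_norm_sq by (rule infsumI[OF hs])
  qed
  have hs: "((\<lambda>d. B.kmat ?k y d * w d) has_sum T (W x w) (t x y)) UNIV"
    if x: "x \<in> B.units" and y: "y \<in> P x" and w: "w \<in> l2" for x y w
  proof -
    have "((\<lambda>g. A.kmat (A.kern T) (t x y) g * W x w g) has_sum T (W x w) (t x y)) UNIV"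
      by (rule A.conv_op_has_sum[OF T Wnorm(1)[OF x w]])
    then have "((\<lambda>g. A.kmat (A.kern T) (t x y) g * W x w g) has_sum T (W x w) (t x y)) (Q x)"
      by (rule iffD1[OF has_sum_cong_neutral, rotated -1]) (auto simp: W_def)
    then have "((\<lambda>d. A.kmat (A.kern T) (t x y) (t x d) * W x w (t x d)) has_sum T (W x w) (t x y)) (P x)"
      using has_sum_reindex_bij_betw[OF bij[OF x], where f = "\<lambda>g. A.kmat (A.kern T) (t x y) g * W x w g"] by blast
    \<comment> \<open>Right translation by \<open>c x\<close> leaves the quotient of
      \<open>y\<close> and \<open>d\<close> unchanged and \<open>\<psi>\<close> is multiplicative,
      so the matrix entries agree.\<close>
    moreover have "A.kmat (A.kern T) (t x y) (t x d) * W x w (t x d) = B.kmat ?k y d * w d" if d: "d \<in> P x" for d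
    proof -
      have s: "B.s y = x" "B.s d = x" "B.s (c x) = x" "B.r y \<in> Y2" "B.r d \<in> Y2"
        using y d c(1)[OF x] by (auto simp: P_def)
      let ?a = "B.mult y (B.iv (c x))" and ?b = "B.mult d (B.iv (c x))"
      have ib: "B.iv ?b \<in> B.restr Y2"
        using H[OF x d] by (simp add: B.restr_iff)
      have "B.mult ?a (B.iv ?b) = B.mult y (B.iv d)"
        using s by (simp add: B.iv_mult B.assoc)
      moreover have "\<psi> (B.mult ?a (B.iv ?b)) = A.mult (t x y) (A.iv (t x d))"
        unfolding t_def using D(12)[OF H[OF x y] ib] restr_iso_iv[OF iso H[OF x d]] s by simp
      moreover have "B.mult y (B.iv d) \<in> B.restr Y2"
        using s by (simp add: B.restr_iff)
      moreover have "A.s (t x d) = A.s (t x y)"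
        using tQ(1)[OF x y] tQ(1)[OF x d] by (simp add: Q_def)
      ultimately show ?thesis
        using s by (simp add: A.kmat_def B.kmat_def transport_def Wt[OF x d])
    qed
    ultimately have "((\<lambda>d. B.kmat ?k y d * w d) has_sum T (W x w) (t x y)) (P x)"
      by (rule iffD1[OF has_sum_cong, rotated])
    then show ?thesis
    proof (rule iffD1[OF has_sum_cong_neutral, rotated -1])
      show "B.kmat ?k y d * w d = 0" if "d \<in> UNIV - P x" for d
        using that y by (auto simp: B.kmat_def transport_def P_def B.restr_iff)
    qed auto
  qed
  have hs0: "((\<lambda>d. B.kmat ?k y d * w d) has_sum 0) UNIV" if "B.r y \<notin> Y2" for y w
  proof -
    have "B.kmat ?k y d = 0" for d
      using that by (auto simp: B.kmat_def transport_def B.restr_iff)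
    then show ?thesis
      by simp
  qed
  have summ: "(\<lambda>d. B.kmat ?k y d * w d) summable_on UNIV" if w: "w \<in> l2" for y w
  proof (cases "B.r y \<in> Y2")
    case True
    then have "y \<in> P (B.s y)"
      by (simp add: P_def)
    then show ?thesis
      using hs[OF B.s_units _ w] has_sum_imp_summable by blast
  next
    case False
    then show ?thesis
      by (intro has_sum_imp_summable[OF hs0])
  qed
  have bound: "(\<Sum>y\<in>F. (cmod (lreg G2 ?k w y))\<^sup>2) \<le> (opnorm T * l2norm w)\<^sup>2" if w: "w \<in> l2" and F: "finite F" for w F
  proof -
    define F' where "F' = {y \<in> F. B.r y \<in> Y2}"
    have F': "finite F'"
      using F by (simp add: F'_def)
    have val: "lreg G2 ?k w y = T (W x w) (t x y)" if "y \<in> P x" "x \<in> B.units" for y x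
      unfolding B.lreg_apply[OF w] by (rule infsumI[OF hs[OF that(2,1) w]])
    have "(\<Sum>y\<in>F. (cmod (lreg G2 ?k w y))\<^sup>2) = (\<Sum>y\<in>F'. (cmod (lreg G2 ?k w y))\<^sup>2)"
    proof (rule sum.mono_neutral_right[OF F])
      show "\<forall>y\<in>F - F'. (cmod (lreg G2 ?k w y))\<^sup>2 = 0"
        using infsumI[OF hs0] by (auto simp: F'_def B.lreg_apply[OF w])
    qed (auto simp: F'_def)
    \<comment> \<open>Grouped by source: on each fibre the operator is a copy of a piece of
      \<open>T\<close>, so the bound by \<open>opnorm T\<close> is available there.\<close>
    also have "\<dots> = (\<Sum>x\<in>B.s ` F'. \<Sum>y\<in>{y \<in> F'. B.s y = x}. (cmod (lreg G2 ?k w y))\<^sup>2)"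
      by (rule sum.image_gen[OF F'])
    also have "\<dots> \<le> (\<Sum>x\<in>B.s ` F'. (opnorm T)\<^sup>2 * infsum (\<lambda>d. (cmod (w d))\<^sup>2) (P x))"
    proof (rule sum_mono)
      fix x
      assume "x \<in> B.s ` F'"
      then have x: "x \<in> B.units"
        by auto
      let ?E = "{y \<in> F'. B.s y = x}"
      have EP: "?E \<subseteq> P x"
        by (auto simp: F'_def P_def)
      have inj: "inj_on (t x) ?E"
        using bij[OF x] EP by (meson bij_betw_imp_inj_on inj_on_subset)
      have TW: "T (W x w) \<in> l2"
        by (rule bounded_opD(1)[OF bT Wnorm(1)[OF x w]])
      have "(\<Sum>y\<in>?E. (cmod (lreg G2 ?k w y))\<^sup>2) = (\<Sum>y\<in>?E. (cmod (T (W x w) (t x y)))\<^sup>2)"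
        using val[OF _ x] EP by (intro sum.cong) auto
      also have "\<dots> = (\<Sum>g\<in>t x ` ?E. (cmod (T (W x w) g))\<^sup>2)"
        by (simp add: sum.reindex[OF inj])
      also have "\<dots> \<le> (l2norm (T (W x w)))\<^sup>2"
        using F' by (intro l2_sum_le TW) auto
      also have "\<dots> \<le> (opnorm T * l2norm (W x w))\<^sup>2"
        by (intro power_mono l2norm_le_opnorm bT Wnorm(1)[OF x w]) simp
      also have "\<dots> = (opnorm T)\<^sup>2 * infsum (\<lambda>d. (cmod (w d))\<^sup>2) (P x)"
        by (simp add: power_mult_distrib Wnorm(2)[OF x w])
      finally show "(\<Sum>y\<in>?E. (cmod (lreg G2 ?k w y))\<^sup>2) \<le> (opnorm T)\<^sup>2 * infsum (\<lambda>d. (cmod (w d))\<^sup>2) (P x)" .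
    qed
    \<comment> \<open>The sets \<open>P x\<close> for different \<open>x\<close> are disjoint, so
      the fibre contributions add up to at most the full norm of \<open>w\<close>.\<close>
    also have "\<dots> = (opnorm T)\<^sup>2 * infsum (\<lambda>d. (cmod (w d))\<^sup>2) (\<Union>x\<in>B.s ` F'. P x)"
    proof -
      have "(\<Sum>x\<in>B.s ` F'. infsum (\<lambda>d. (cmod (w d))\<^sup>2) (P x)) = infsum (\<lambda>d. (cmod (w d))\<^sup>2) (\<Union>x\<in>B.s ` F'. P x)"
        using F' w by (intro sum_infsum) (auto simp: P_def l2_def intro: summable_on_subset)
      then show ?thesis
        by (simp add: sum_distrib_left[symmetric])
    qed
    also have "\<dots> \<le> (opnorm T)\<^sup>2 * (l2norm w)\<^sup>2"
      unfolding l2_norm_sq using w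
      by (intro mult_left_mono infsum_mono2) (auto simp: l2_def intro: summable_on_subset)
    finally show ?thesis
      by (simp add: power_mult_distrib)
  qed
  show "bounded_op (lreg G2 ?k)" "opnorm (lreg G2 ?k) \<le> opnorm T"
    using B.bounded_op_lregI[OF opnorm_nonneg[OF bT], of ?k] summ bound by auto
qed

definition transport_op :: "'h set \<Rightarrow> ('h \<Rightarrow> 'g) \<Rightarrow> 'g op \<Rightarrow> 'h op" where
  "transport_op Y2 \<psi> T = lreg G2 (transport Y2 \<psi> (A.kern T))"

lemma kern_transport_op [simp]: "B.kern (transport_op Y2 \<psi> T) = transport Y2 \<psi> (A.kern T)"
  by (simp add: transport_op_def)

lemma transport_op_conv:
  assumes "restr_iso Y1 Y2 \<phi> \<psi>" "B.clopen_units Y2" "G_full G2 Y2"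
    and "A.conv_op T" "\<And>g. A.kern T g \<noteq> 0 \<Longrightarrow> g \<in> A.restr Y1"
  shows "B.conv_op (transport_op Y2 \<psi> T)"
  unfolding transport_op_def using transport_bounded(1)[OF assms] by (rule B.conv_op_lreg)

lemma transport_Cc:
  assumes iso: "restr_iso Y1 Y2 \<phi> \<psi>" and Y: "A.clopen_units Y1" "B.clopen_units Y2" and f: "f \<in> Cc"
  shows "transport Y2 \<psi> f \<in> Cc"
proof (rule CcI)
  note D = restr_isoD[OF iso]
  let ?K = "closure {g. f g \<noteq> 0}"
  have "continuous_on (B.restr Y2) (\<lambda>h. f (\<psi> h))"
    by (rule continuous_on_compose2[OF CcD(1)[OF f] D(2)]) simp
  then show "continuous_on UNIV (transport Y2 \<psi> f)"
    unfolding transport_def[abs_def] by (intro continuous_on_clopen_extend B.clopen_restr[OF Y(2)])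
  have "compact (?K \<inter> A.restr Y1)"
    by (intro compact_Int_closed CcD(2)[OF f] A.clopen_restr[OF Y(1)])
  then show "compact (\<phi> ` (?K \<inter> A.restr Y1))"
    by (rule compact_continuous_image[rotated]) (use D(1) in \<open>auto elim: continuous_on_subset\<close>)
  show "h \<in> \<phi> ` (?K \<inter> A.restr Y1)" if "transport Y2 \<psi> f h \<noteq> 0" for h
  proof -
    have h: "h \<in> B.restr Y2" "f (\<psi> h) \<noteq> 0"
      using that by (auto simp: transport_def split: if_splits)
    then show ?thesis
      using D(4)[OF h(1)] D(6)[OF h(1)] CcD(3)[OF f h(2)] by (intro image_eqI[of _ _ "\<psi> h"]) auto
  qed
qed

text \<open>An approximating function in \<open>Cc\<close> need not live on the restricted groupoid.
  The error is therefore compressed by the projection of \<open>Y1\<close>, which does not raise its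
  norm, before \<open>transport_bounded\<close> is applied to it.\<close>

lemma transport_op_corner:
  assumes iso: "restr_iso Y1 Y2 \<phi> \<psi>" and Y: "A.clopen_units Y1" "B.clopen_units Y2"
    and full: "G_full G2 Y2" and T: "T \<in> A.corner_alg Y1"
  shows "transport_op Y2 \<psi> T \<in> B.corner_alg Y2"
proof -
  note D = restr_isoD[OF iso]
  have TC: "T \<in> Cred G1" "\<And>g. A.kern T g \<noteq> 0 \<Longrightarrow> g \<in> A.restr Y1"
    using T by (auto simp: A.corner_alg_def)
  have "transport_op Y2 \<psi> T \<in> Cred G2"
  proof (rule B.Cred_closed)
    have bp: "bounded_op (lreg G2 (transport Y2 \<psi> (A.kern T)))"
      by (rule transport_bounded(1)[OF iso Y(2) full A.Cred_conv_op[OF TC(1)] TC(2)])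
    then show "bounded_op (transport_op Y2 \<psi> T)"
      by (simp add: transport_op_def)
    fix \<epsilon> :: real
    assume "\<epsilon> > 0"
    then obtain f where f: "f \<in> Cc" "opnorm (op_diff T (lreg G1 f)) < \<epsilon>"
      using A.Cred_approx[OF TC(1)] by metis
    define R where "R = op_diff T (lreg G1 f)"
    define E where "E = A.char_op Y1"
    have E: "E \<in> A.diag_alg Y1" "E \<in> Cred G1" "opnorm E \<le> 1" "0 \<le> opnorm E"
      using A.char_op_diag_alg[OF Y(1) subset_refl] A.opnorm_char_op_le[OF A.clopen_unitsD(5)[OF Y(1)]]
        opnorm_nonneg[OF A.Cred_bounded[OF A.char_op_Cred[OF A.clopen_unitsD(5)[OF Y(1)]]]]
      by (auto simp: E_def A.diag_alg_def)
    have cR: "A.conv_op R"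
      unfolding R_def by (intro A.conv_op_ops A.Cred_conv_op TC A.conv_op_lreg_Cc f)
    have bR: "bounded_op R" "bounded_op E"
      using A.conv_opD(1)[OF cR] A.Cred_bounded[OF E(2)] by auto
    define R' where "R' = E \<circ> R \<circ> E"
    have cR': "A.conv_op R'"
      unfolding R'_def by (intro A.conv_op_compose A.Cred_conv_op E(2) cR)
    have kR': "A.kern R' g = (if g \<in> A.restr Y1 then A.kern T g - f g else 0)" for g
      unfolding R'_def
      using A.kern_compose_diag(1)[OF Y(1) E(1) bounded_op_compose[OF bR(2,1)], of g]
        A.kern_compose_diag(2)[OF Y(1) E(1) bR(1), of g]
      by (auto simp: A.restr_iff E_def R_def simp del: comp_apply)
    have "opnorm R' \<le> opnorm (E \<circ> R) * opnorm E"
      unfolding R'_def by (intro opnorm_compose_le bounded_op_compose bR)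
    also have "\<dots> \<le> opnorm (E \<circ> R)"
      using E(3) opnorm_nonneg[OF bounded_op_compose[OF bR(2,1)]] by (rule mult_left_le)
    also have "\<dots> \<le> opnorm E * opnorm R"
      by (intro opnorm_compose_le bR)
    also have "\<dots> \<le> opnorm R"
      using mult_right_mono[OF E(3) opnorm_nonneg[OF bR(1)]] by simp
    finally have nR': "opnorm R' < \<epsilon>"
      using f(2) by (simp add: R_def)
    have tf: "transport Y2 \<psi> f \<in> Cc"
      by (rule transport_Cc[OF iso Y f(1)])
    have "transport Y2 \<psi> (A.kern R') = (\<lambda>h. transport Y2 \<psi> (A.kern T) h - transport Y2 \<psi> f h)"
      using D(4) by (auto simp: transport_def kR' fun_eq_iff)
    then have "op_diff (transport_op Y2 \<psi> T) (lreg G2 (transport Y2 \<psi> f)) = lreg G2 (transport Y2 \<psi> (A.kern R'))"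
      using B.lreg_add(2)[OF bp B.bounded_lreg_Cc[OF tf]] by (simp add: transport_op_def)
    moreover have "opnorm (lreg G2 (transport Y2 \<psi> (A.kern R'))) \<le> opnorm R'"
      by (rule transport_bounded(2)[OF iso Y(2) full cR']) (simp add: kR' split: if_splits)
    ultimately have "opnorm (op_diff (transport_op Y2 \<psi> T) (lreg G2 (transport Y2 \<psi> f))) < \<epsilon>"
      using nR' by simp
    then show "\<exists>S\<in>Cred G2. opnorm (op_diff (transport_op Y2 \<psi> T) S) < \<epsilon>"
      using B.lreg_Cc_Cred[OF tf] by blast
  qed
  then show ?thesis
    by (auto simp: B.corner_alg_def transport_def split: if_splits)
qed

lemma restr_iso_swap:
  assumes "restr_iso Y1 Y2 \<phi> \<psi>"
  shows "ample_pair.restr_iso G2 G1 Y2 Y1 \<psi> \<phi>"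
proof -
  interpret swap: ample_pair G2 G1 ..
  have "homeomorphism (B.restr Y2) (A.restr Y1) \<psi> \<phi>"
    by (rule homeomorphism_symD[OF conjunct1[OF assms[unfolded restr_iso_def]]])
  then show ?thesis
    using assms unfolding restr_iso_def swap.restr_iso_def by (elim conjE) (intro conjI; assumption)
qed

lemma transport_op_inverse:
  assumes iso: "restr_iso Y1 Y2 \<phi> \<psi>" and Y: "A.clopen_units Y1" "B.clopen_units Y2"
    and full: "G_full G1 Y1" "G_full G2 Y2" and T: "T \<in> A.corner_alg Y1"
  shows "ample_pair.transport_op G2 G1 Y1 \<phi> (transport_op Y2 \<psi> T) = T"
proof -
  interpret swap: ample_pair G2 G1 ..
  note iso' = restr_iso_swap[OF iso]
  note D = restr_isoD[OF iso]
  have TC: "T \<in> Cred G1" "\<And>g. A.kern T g \<noteq> 0 \<Longrightarrow> g \<in> A.restr Y1"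
    using T by (auto simp: A.corner_alg_def)
  show ?thesis
  proof (rule A.conv_op_eqI)
    have "transport_op Y2 \<psi> T \<in> B.corner_alg Y2"
      by (rule transport_op_corner[OF iso Y full(2) T])
    then have "swap.transport_op Y1 \<phi> (transport_op Y2 \<psi> T) \<in> A.corner_alg Y1"
      by (rule swap.transport_op_corner[OF iso' Y(2,1) full(1)])
    then show "A.conv_op (swap.transport_op Y1 \<phi> (transport_op Y2 \<psi> T))"
      by (auto simp: A.corner_alg_def A.Cred_conv_op)
    show "A.conv_op T"
      by (rule A.Cred_conv_op[OF TC(1)])
    show "A.kern (swap.transport_op Y1 \<phi> (transport_op Y2 \<psi> T)) g = A.kern T g" for g
      using D(3,5) TC(2)[of g] by (auto simp: swap.transport_def transport_def)
  qed
qed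

text \<open>Supports confine both convolution sums to arrows of the restricted groupoids with a
  fixed source, and \<open>\<psi>\<close> is a bijection between these index sets that respects
  quotients.\<close>

lemma transport_op_compose:
  assumes iso: "restr_iso Y1 Y2 \<phi> \<psi>" and Y: "A.clopen_units Y1" "B.clopen_units Y2"
    and full: "G_full G2 Y2" and TS: "T \<in> A.corner_alg Y1" "S \<in> A.corner_alg Y1"
  shows "transport_op Y2 \<psi> (T \<circ> S) = transport_op Y2 \<psi> T \<circ> transport_op Y2 \<psi> S"
proof (rule B.conv_op_eqI)
  note D = restr_isoD[OF iso]
  let ?\<pi> = "transport_op Y2 \<psi>"
  have TC: "A.conv_op T" "A.conv_op S"
    using TS A.Cred_conv_op by (auto simp: A.corner_alg_def)
  note tc = transport_op_corner[OF iso Y full]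
  have \<pi>C: "?\<pi> T \<in> B.corner_alg Y2" "?\<pi> S \<in> B.corner_alg Y2"
    using tc TS by auto
  have cc: "B.conv_op R" if "R \<in> B.corner_alg Y2" for R
    using that B.Cred_conv_op by (simp add: B.corner_alg_def)
  show "B.conv_op (?\<pi> (T \<circ> S))" "B.conv_op (?\<pi> T \<circ> ?\<pi> S)"
    using cc tc[OF A.corner_alg_compose[OF TS]] B.corner_alg_compose[OF \<pi>C] by auto
  fix h
  show "B.kern (?\<pi> (T \<circ> S)) h = B.kern (?\<pi> T \<circ> ?\<pi> S) h"
  proof (cases "h \<in> B.restr Y2")
    case False
    then show ?thesis
      using B.corner_alg_compose[OF \<pi>C] by (auto simp: B.corner_alg_def transport_def simp del: comp_apply)
  next
    case h: True
    let ?P = "{b \<in> B.restr Y2. B.s b = B.s h}" and ?Q = "{b \<in> A.restr Y1. A.s b = A.s (\<psi> h)}"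
    have sh: "B.s h \<in> B.restr Y2" "A.s (\<psi> h) \<in> A.restr Y1"
      using h D(4)[OF h] by (auto simp: A.restr_iff B.restr_iff)
    have bij: "bij_betw \<psi> ?P ?Q"
    proof (rule bij_betw_byWitness[where f' = \<phi>])
      show "\<psi> ` ?P \<subseteq> ?Q"
        using D(4,11) h by (auto, metis D(11))
      have "B.s (\<phi> g) = B.s h" if "g \<in> A.restr Y1" "A.s g = A.s (\<psi> h)" for g
        using D(8)[OF that(1)] that(2) D(8)[OF D(4)[OF h]] D(6)[OF h] by simp
      then show "\<phi> ` ?Q \<subseteq> ?P"
        using D(3) by auto
    qed (use D(5,6) in auto)
    have "((\<lambda>b. A.kern T (A.mult (\<psi> h) (A.iv b)) * A.kern S b) has_sum A.kern (T \<circ> S) (\<psi> h)) {b. A.s b = A.s (\<psi> h)}"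
      by (rule A.conv_op_compose(2)[OF TC])
    then have "((\<lambda>b. A.kern T (A.mult (\<psi> h) (A.iv b)) * A.kern S b) has_sum A.kern (T \<circ> S) (\<psi> h)) ?Q"
      by (rule iffD1[OF has_sum_cong_neutral, rotated -1]) (use TS(2) in \<open>auto simp: A.corner_alg_def\<close>)
    then have 1: "((\<lambda>b. A.kern T (A.mult (\<psi> h) (A.iv (\<psi> b))) * A.kern S (\<psi> b)) has_sum A.kern (T \<circ> S) (\<psi> h)) ?P"
      using has_sum_reindex_bij_betw[OF bij, where f = "\<lambda>b. A.kern T (A.mult (\<psi> h) (A.iv b)) * A.kern S b"] by blast
    have "((\<lambda>b. B.kern (?\<pi> T) (B.mult h (B.iv b)) * B.kern (?\<pi> S) b) has_sum B.kern (?\<pi> T \<circ> ?\<pi> S) h) {b. B.s b = B.s h}"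
      by (rule B.conv_op_compose(2)[OF cc[OF \<pi>C(1)] cc[OF \<pi>C(2)]])
    then have "((\<lambda>b. B.kern (?\<pi> T) (B.mult h (B.iv b)) * B.kern (?\<pi> S) b) has_sum B.kern (?\<pi> T \<circ> ?\<pi> S) h) ?P"
      by (rule iffD1[OF has_sum_cong_neutral, rotated -1]) (auto simp: transport_def)
    then have 2: "((\<lambda>b. A.kern T (A.mult (\<psi> h) (A.iv (\<psi> b))) * A.kern S (\<psi> b)) has_sum B.kern (?\<pi> T \<circ> ?\<pi> S) h) ?P"
    proof (rule iffD1[OF has_sum_cong, rotated])
      fix b
      assume "b \<in> ?P"
      then have b: "b \<in> B.restr Y2" "B.s b = B.s h"
        by auto
      have i: "B.iv b \<in> B.restr Y2" "B.mult h (B.iv b) \<in> B.restr Y2"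
        using b h by (auto simp: B.restr_iff)
      show "B.kern (?\<pi> T) (B.mult h (B.iv b)) * B.kern (?\<pi> S) b = A.kern T (A.mult (\<psi> h) (A.iv (\<psi> b))) * A.kern S (\<psi> b)"
        using i b D(12)[OF h i(1)] restr_iso_iv[OF iso b(1)] by (simp add: transport_def)
    qed
    show ?thesis
      using has_sum_unique[OF 1 2] h by (simp add: transport_def)
  qed
qed

text \<open>Units are the arrows equal to their own range, a property that the injective map
  \<open>\<psi>\<close> both preserves and reflects.\<close>

lemma transport_op_diag:
  assumes iso: "restr_iso Y1 Y2 \<phi> \<psi>" and Y: "A.clopen_units Y1" "B.clopen_units Y2"
    and full: "G_full G2 Y2" and T: "T \<in> A.diag_alg Y1"
  shows "transport_op Y2 \<psi> T \<in> B.diag_alg Y2"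
proof -
  note D = restr_isoD[OF iso]
  have TC: "T \<in> A.corner_alg Y1" "\<And>g. A.kern T g \<noteq> 0 \<Longrightarrow> g \<in> Y1"
    using T A.diag_alg_subset[OF Y(1)] by (auto simp: A.diag_alg_def)
  have "h \<in> Y2" if "transport Y2 \<psi> (A.kern T) h \<noteq> 0" for h
  proof -
    have h: "h \<in> B.restr Y2" "\<psi> h \<in> Y1"
      using that TC(2) by (auto simp: transport_def split: if_splits)
    have "A.r (\<psi> h) = \<psi> h"
      using h(2) A.clopen_unitsD(1)[OF Y(1)] by auto
    then have "\<psi> (B.r h) = \<psi> h"
      using D(10)[OF h(1)] by simp
    moreover have "B.r h \<in> B.restr Y2"
      using h(1) by (simp add: B.restr_iff)
    ultimately have "B.r h = h"
      using D(6) h(1) by metis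
    then show ?thesis
      using h(1) by (simp add: B.restr_iff)
  qed
  then show ?thesis
    using transport_op_corner[OF iso Y full TC(1)] by (simp add: B.diag_alg_def B.corner_alg_def)
qed

text \<open>The identities are compared on kernels, where transport is composition with
  \<open>\<psi>\<close>. The inverse is transport along \<open>\<phi>\<close>, whose boundedness
  uses fullness of \<open>Y1\<close>.\<close>

lemma transport_star_iso:
  assumes iso: "restr_iso Y1 Y2 \<phi> \<psi>" and Y: "A.clopen_units Y1" "B.clopen_units Y2"
    and full: "G_full G1 Y1" "G_full G2 Y2"
  shows "star_iso (A.corner_alg Y1) (B.corner_alg Y2) (transport_op Y2 \<psi>)"
    and "transport_op Y2 \<psi> ` A.diag_alg Y1 = B.diag_alg Y2"
proof -
  interpret swap: ample_pair G2 G1 ..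
  note iso' = restr_iso_swap[OF iso]
  note D = restr_isoD[OF iso]
  let ?\<pi> = "transport_op Y2 \<psi>" and ?\<rho> = "swap.transport_op Y1 \<phi>"
  note \<pi>C = transport_op_corner[OF iso Y full(2)]
  note \<rho>C = swap.transport_op_corner[OF iso' Y(2,1) full(1)]
  note inv1 = transport_op_inverse[OF iso Y full]
  note inv2 = swap.transport_op_inverse[OF iso' Y(2,1) full(2,1)]
  have bij: "bij_betw ?\<pi> (A.corner_alg Y1) (B.corner_alg Y2)"
    by (rule bij_betw_byWitness[where f' = ?\<rho>]) (use \<pi>C \<rho>C inv1 inv2 in auto)
  have cA: "A.conv_op T" "A.kern T g \<noteq> 0 \<Longrightarrow> g \<in> A.restr Y1" if "T \<in> A.corner_alg Y1" for T g
    using that A.Cred_conv_op by (auto simp: A.corner_alg_def)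
  have cB: "B.conv_op (?\<pi> T)" if "T \<in> A.corner_alg Y1" for T
    using \<pi>C[OF that] B.Cred_conv_op by (auto simp: B.corner_alg_def)
  have op_add: "?\<pi> (op_add T S) = op_add (?\<pi> T) (?\<pi> S)" if TS: "T \<in> A.corner_alg Y1" "S \<in> A.corner_alg Y1" for T S
  proof (rule B.conv_op_eqI)
    have "op_add T S \<in> A.corner_alg Y1"
      using TS A.Cred_add by (auto simp: A.corner_alg_def) (metis add.right_neutral)
    then show "B.conv_op (?\<pi> (op_add T S))"
      by (rule cB)
    show "B.conv_op (op_add (?\<pi> T) (?\<pi> S))"
      by (intro B.conv_op_ops cB TS)
  qed (simp add: transport_def)
  have op_scale: "?\<pi> (op_scale c T) = op_scale c (?\<pi> T)" if T: "T \<in> A.corner_alg Y1" for T c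
  proof (rule B.conv_op_eqI)
    have "op_scale c T \<in> A.corner_alg Y1"
      using T A.Cred_scale by (auto simp: A.corner_alg_def)
    then show "B.conv_op (?\<pi> (op_scale c T))"
      by (rule cB)
    show "B.conv_op (op_scale c (?\<pi> T))"
      by (rule B.conv_op_ops(3)[OF cB[OF T] cB[OF T]])
  qed (simp add: transport_def)
  have op_adj: "?\<pi> (op_adj T) = op_adj (?\<pi> T)" if T: "T \<in> A.corner_alg Y1" for T
  proof (rule B.conv_op_eqI)
    note adj = A.conv_op_adj[OF cA(1)[OF T]]
    have "g \<in> A.restr Y1" if "A.kern (op_adj T) g \<noteq> 0" for g
      using that cA(2)[OF T, of "A.iv g"] by (simp add: adj(2) A.restr_iff)
    then show "B.conv_op (?\<pi> (op_adj T))"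
      by (rule transport_op_conv[OF iso Y(2) full(2) adj(1)])
    show "B.conv_op (op_adj (?\<pi> T))"
      by (rule B.conv_op_adj[OF cB[OF T]])
    fix h
    have "B.iv h \<in> B.restr Y2 \<longleftrightarrow> h \<in> B.restr Y2"
      by (auto simp: B.restr_iff)
    then show "B.kern (?\<pi> (op_adj T)) h = B.kern (op_adj (?\<pi> T)) h"
      using restr_iso_iv[OF iso, of h] by (simp add: B.conv_op_adj(2)[OF cB[OF T]] adj(2) transport_def)
  qed
  show "star_iso (A.corner_alg Y1) (B.corner_alg Y2) ?\<pi>"
    unfolding star_iso_def
    using bij op_add op_scale op_adj transport_op_compose[OF iso Y full(2)] by blast
  note diag = transport_op_diag[OF iso Y full(2)] swap.transport_op_diag[OF iso' Y(2,1) full(1)]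
  show "?\<pi> ` A.diag_alg Y1 = B.diag_alg Y2"
  proof
    show "?\<pi> ` A.diag_alg Y1 \<subseteq> B.diag_alg Y2"
      using diag(1) by blast
    show "B.diag_alg Y2 \<subseteq> ?\<pi> ` A.diag_alg Y1"
    proof
      fix T
      assume T: "T \<in> B.diag_alg Y2"
      then have "T = ?\<pi> (?\<rho> T)"
        using inv2[of T] B.diag_alg_subset[OF Y(2)] by auto
      then show "T \<in> ?\<pi> ` A.diag_alg Y1"
        using diag(2)[OF T] by blast
    qed
  qed
qed

end

lemma (in ample) clopen_units_iff:
  "clopen_units Y \<longleftrightarrow> Y \<subseteq> units \<and> openin (top_of_set units) Y \<and> closedin (top_of_set units) Y"
proof
  assume "clopen_units Y"
  then show "Y \<subseteq> units \<and> openin (top_of_set units) Y \<and> closedin (top_of_set units) Y"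
    by (auto simp: clopen_units_def open_openin_trans closed_subset compact_imp_closed)
next
  assume "Y \<subseteq> units \<and> openin (top_of_set units) Y \<and> closedin (top_of_set units) Y"
  then show "clopen_units Y"
    unfolding clopen_units_def
    using openin_open_trans[OF _ open_units] closedin_compact[OF compact_units] by blast
qed

lemma (in ample_pair) diagonal_iso_of_star_iso:
  assumes Y: "A.clopen_units Y1" "B.clopen_units Y2"
    and si: "star_iso (A.corner_alg Y1) (B.corner_alg Y2) \<pi>"
    and diag: "\<pi> ` A.diag_alg Y1 = B.diag_alg Y2"
  shows "diagonal_iso Y1 Y2 \<pi> (the_inv_into (A.corner_alg Y1) \<pi>)"
proof -
  let ?\<rho> = "the_inv_into (A.corner_alg Y1) \<pi>"
  have bij: "bij_betw \<pi> (A.corner_alg Y1) (B.corner_alg Y2)"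
    and mult: "\<And>T S. T \<in> A.corner_alg Y1 \<Longrightarrow> S \<in> A.corner_alg Y1 \<Longrightarrow> \<pi> (T \<circ> S) = \<pi> T \<circ> \<pi> S"
    using si by (auto simp: star_iso_def)
  have inj: "inj_on \<pi> (A.corner_alg Y1)"
    using bij by (rule bij_betw_imp_inj_on)
  have \<pi>: "\<pi> T \<in> B.corner_alg Y2" "?\<rho> (\<pi> T) = T" if "T \<in> A.corner_alg Y1" for T
    using that bij_betwE[OF bij] the_inv_into_f_f[OF inj] by auto
  have \<rho>: "?\<rho> T \<in> A.corner_alg Y1" "\<pi> (?\<rho> T) = T" if "T \<in> B.corner_alg Y2" for T
    using that bij_betwE[OF bij_betw_the_inv_into[OF bij]] f_the_inv_into_f_bij_betw[OF bij] by auto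
  have "?\<rho> (T \<circ> S) = ?\<rho> T \<circ> ?\<rho> S" if TS: "T \<in> B.corner_alg Y2" "S \<in> B.corner_alg Y2" for T S
  proof -
    have "?\<rho> T \<circ> ?\<rho> S \<in> A.corner_alg Y1" "\<pi> (?\<rho> T \<circ> ?\<rho> S) = T \<circ> S"
      using \<rho>[OF TS(1)] \<rho>[OF TS(2)] by (simp_all only: A.corner_alg_compose mult)
    then show ?thesis
      using \<pi>(2) by metis
  qed
  moreover have "?\<rho> T \<in> A.diag_alg Y1" if T: "T \<in> B.diag_alg Y2" for T
  proof -
    obtain S where S: "S \<in> A.diag_alg Y1" "T = \<pi> S"
      using T diag by blast
    then have "?\<rho> T = S"
      using \<pi>(2) A.diag_alg_subset[OF Y(1)] by auto
    then show ?thesis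
      using S(1) by simp
  qed
  moreover have "\<pi> T \<in> B.diag_alg Y2" if "T \<in> A.diag_alg Y1" for T
    using that diag by blast
  ultimately show ?thesis
    unfolding diagonal_iso_def using \<pi> \<rho> mult by simp
qed

theorem theorem5p4:
  fixes G1 :: "('g::{t2_space, second_countable_topology}) groupoid"
    and G2 :: "('h::{t2_space, second_countable_topology}) groupoid"
  assumes "etale_groupoid G1" "essentially_principal G1"
      and "compact (unit_space G1)" "totally_disconnected_set (unit_space G1)"
      and "etale_groupoid G2" "essentially_principal G2"
      and "compact (unit_space G2)" "totally_disconnected_set (unit_space G2)"
  shows "kakutani_equivalent G1 G2 \<longleftrightarrow>
    (\<exists>p1 p2 \<pi>. projection_in_C_units G1 p1 \<and> projection_in_C_units G2 p2
       \<and> full_in (mulop G1 p1) (Cred G1) \<and> full_in (mulop G2 p2) (Cred G2)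
       \<and> star_iso (corner (mulop G1 p1) (Cred G1)) (corner (mulop G2 p2) (Cred G2)) \<pi>
       \<and> \<pi> ` {mulop G1 p1 \<circ> mulop G1 f | f. f \<in> C_units G1}
           = {mulop G2 p2 \<circ> mulop G2 f | f. f \<in> C_units G2})"
proof -
  interpret ample_pair G1 G2
    by (intro ample_pair.intro ample.intro etale.intro ample_axioms.intro assms)
  show ?thesis
  proof (rule iffI, goal_cases)
    case 1
    then obtain Y1 Y2 \<phi> where Y: "A.clopen_units Y1" "B.clopen_units Y2"
      and full: "G_full G1 Y1" "G_full G2 Y2"
      and iso: "groupoid_iso_on G1 (A.restr Y1) G2 (B.restr Y2) \<phi>"
      unfolding kakutani_equivalent_def A.clopen_units_iff B.clopen_units_iff A.restr_def B.restr_def by metis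
    obtain \<psi> where \<psi>: "restr_iso Y1 Y2 \<phi> \<psi>"
      using groupoid_iso_restr_iso[OF iso] by metis
    let ?p1 = "\<lambda>x. if x \<in> Y1 then 1 else 0 :: complex" and ?p2 = "\<lambda>x. if x \<in> Y2 then 1 else 0 :: complex"
    have p: "mulop G1 ?p1 = A.char_op Y1" "mulop G2 ?p2 = B.char_op Y2"
      using A.mulop_ind[OF Y(1)] B.mulop_ind[OF Y(2)] by auto
    show ?case
    proof (intro exI conjI)
      show "projection_in_C_units G1 ?p1" "projection_in_C_units G2 ?p2"
        by (rule A.projection_ind[OF Y(1)], rule B.projection_ind[OF Y(2)])
      show "full_in (mulop G1 ?p1) (Cred G1)" "full_in (mulop G2 ?p2) (Cred G2)"
        unfolding p by (rule A.G_full_imp_full[OF Y(1) full(1)], rule B.G_full_imp_full[OF Y(2) full(2)])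
      show "star_iso (corner (mulop G1 ?p1) (Cred G1)) (corner (mulop G2 ?p2) (Cred G2)) (transport_op Y2 \<psi>)"
        unfolding p A.corner_eq[OF Y(1)] B.corner_eq[OF Y(2)] by (rule transport_star_iso(1)[OF \<psi> Y full])
      show "transport_op Y2 \<psi> ` {mulop G1 ?p1 \<circ> mulop G1 f | f. f \<in> C_units G1}
           = {mulop G2 ?p2 \<circ> mulop G2 f | f. f \<in> C_units G2}"
        unfolding p A.diag_eq[OF Y(1)] B.diag_eq[OF Y(2)] by (rule transport_star_iso(2)[OF \<psi> Y full])
    qed
  next
    case 2
    then obtain p1 p2 \<pi> where proj: "projection_in_C_units G1 p1" "projection_in_C_units G2 p2"
      and full: "full_in (mulop G1 p1) (Cred G1)" "full_in (mulop G2 p2) (Cred G2)"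
      and si: "star_iso (corner (mulop G1 p1) (Cred G1)) (corner (mulop G2 p2) (Cred G2)) \<pi>"
      and diag: "\<pi> ` {mulop G1 p1 \<circ> mulop G1 f | f. f \<in> C_units G1} = {mulop G2 p2 \<circ> mulop G2 f | f. f \<in> C_units G2}"
      by (elim exE conjE)
    \<comment> \<open>A projection is constrained on the unit space alone, so \<open>p1\<close>
      agrees with the indicator of \<open>Y1\<close> only there; \<open>mulop\<close> evaluates it
      at ranges and sees no more.\<close>
    obtain Y1 where Y1: "A.clopen_units Y1" "\<And>x. x \<in> A.units \<Longrightarrow> p1 x = (if x \<in> Y1 then 1 else 0)"
      using A.projection_support[OF proj(1)] by metis
    obtain Y2 where Y2: "B.clopen_units Y2" "\<And>x. x \<in> B.units \<Longrightarrow> p2 x = (if x \<in> Y2 then 1 else 0)"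
      using B.projection_support[OF proj(2)] by metis
    have p: "mulop G1 p1 = A.char_op Y1" "mulop G2 p2 = B.char_op Y2"
      by (rule A.mulop_ind[OF Y1], assumption, rule B.mulop_ind[OF Y2], assumption)
    note si' = si[unfolded p A.corner_eq[OF Y1(1)] B.corner_eq[OF Y2(1)]]
    note diag' = diag[unfolded p A.diag_eq[OF Y1(1)] B.diag_eq[OF Y2(1)]]
    obtain \<phi> where "groupoid_iso_on G1 (A.restr Y1) G2 (B.restr Y2) \<phi>"
      using diagonal_iso_imp_groupoid_iso[OF Y1(1) Y2(1) assms(2,6)
          diagonal_iso_of_star_iso[OF Y1(1) Y2(1) si' diag']] by blast
    moreover have "G_full G1 Y1" "G_full G2 Y2"
      using A.full_imp_G_full[OF Y1(1)] B.full_imp_G_full[OF Y2(1)] full p by simp_all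
    ultimately show ?case
      using Y1(1) Y2(1)
      unfolding kakutani_equivalent_def A.clopen_units_iff B.clopen_units_iff A.restr_def B.restr_def by blast
  qed
qed

end
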